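(* Let $k\ge0$ and let $(X_t)_{t\ge0}$ be an arbitrary stochastic process on $\mathbb R$ such that $(R_n^{\Gamma,k}(t,X_t))_{t\ge0}$ is a martingale (with respect to the canonical filtration of $(X_t)_{t\ge 0}$) for $n=1,2,4,6,8$. Then $(X_t)_{t\ge0}$ is a Dunkl process of index $k$.
   Context: Rank-one Dunkl setting: $W=\mathbb Z_2$ acts on $\mathbb R$ by $x\mapsto-x$, with multiplicity $k\ge0$. The Dunkl operator is $Tf(x)=f'(x)+k\frac{f(x)-f(-x)}{x}$ and the Dunkl Laplacian is $\Delta_k=T^2$. The Dunkl kernel $E_k(x,y)$ is the unique real-analytic (in $x$) solution of $T f=yf$, $f(0)=1$; explicitly $E_k(x,y)=j_{k-1/2}(ixy)+\frac{xy}{2k+1}j_{k+1/2}(ixy)$ with $j_\alpha(z)=\Gamma(\alpha+1)\sum_{n\ge0}\frac{(-1)^n(z/2)^{2n}}{n!\,\Gamma(n+\alpha+1)}$. The Dunkl heat semigroup of index $k$ on $\mathbb R$ consists of the Markov kernels $P_t^\Gamma(x,dy)=\Gamma_k(t,x,y)|y|^{2k}dy$ ($t>0$), $P_0^\Gamma(x,\cdot)=\delta_x$, with $$\Gamma_k(t,x,y)=\frac{1}{(2t)^{k+1/2}c_k}e^{-(x^2+y^2)/4t}E_k\Bigl(\frac{x}{\sqrt{2t}},\frac{y}{\sqrt{2t}}\Bigr),\qquad c_k=\int_{\mathbb R}e^{-x^2/2}|x|^{2k}dx;$$ its generator is $\Delta_k$. A Dunkl process of index $k$ is a Markov process on $\mathbb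 R$ associated with this semigroup, i.e. $P(X_t\in B\mid\sigma(X_u:u\le s))=P^\Gamma_{t-s}(X_s,B)$ a.s. for $s\le t$ (arbitrary initial distribution). The moment functions are $m_{2n}(x)=\frac{\Gamma(k+1/2)(2n)!}{\Gamma(n+k+1/2)2^{2n}n!}x^{2n}$ and $m_{2n+1}(x)=\frac{\Gamma(k+1/2)(2n+1)!}{\Gamma(n+k+3/2)2^{2n+1}n!}x^{2n+1}$ ($n\in\mathbb Z_+$), and the Appell characters (generalized heat polynomials) are $$R_n^{\Gamma,k}(t,x)=\sum_{0\le j\le n/2}\frac{n!}{(n-2j)!\,j!}(-t)^j\,m_{n-2j}(x).$$ (Up to multiplicative constants, $R_{2n}^{\Gamma,k}(t,x)$ is $t^nL_n^{(k-1/2)}(x^2/4t)$ and $R_{2n+1}^{\Gamma,k}(t,x)$ is $t^nxL_n^{(k+1/2)}(x^2/4t)$ with Laguerre polynomials $L_n^{(\alpha)}$.) *)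

theory Defs
  imports "HOL-Probability.Probability"
begin

definition natural_filtration :: "'a measure \<Rightarrow> (real \<Rightarrow> 'a \<Rightarrow> real) \<Rightarrow> real \<Rightarrow> 'a measure" where
  "natural_filtration M X t =
     sigma (space M) {X u -` A \<inter> space M | u A. 0 \<le> u \<and> u \<le> t \<and> A \<in> sets borel}"

definition martingale :: "'a measure \<Rightarrow> (real \<Rightarrow> 'a measure) \<Rightarrow> (real \<Rightarrow> 'a \<Rightarrow> real) \<Rightarrow> bool" where
  "martingale M F Y \<longleftrightarrow>
     (\<forall>t\<ge>0. Y t \<in> borel_measurable (F t) \<and> integrable M (Y t)) \<and>
     (\<forall>s t. 0 \<le> s \<and> s \<le> t \<longrightarrow> (AE \<omega> in M. real_cond_exp M (F s) (Y t) \<omega> = Y s \<omega>))"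

definition bessel_j :: "real \<Rightarrow> complex \<Rightarrow> complex" where
  "bessel_j \<alpha> z = of_real (Gamma (\<alpha> + 1)) *
     (\<Sum>n. (- 1) ^ n * (z / 2) ^ (2 * n) / of_real (fact n * Gamma (real n + \<alpha> + 1)))"

text \<open>
  The series are written over the complex numbers because they are evaluated at imaginary
  arguments; the value is real for \<open>k \<ge> 0\<close>, so taking the real part loses nothing
  (lemma \<open>of_real_dunkl_E\<close> below).
\<close>

definition dunkl_E :: "real \<Rightarrow> real \<Rightarrow> real \<Rightarrow> real" where
  "dunkl_E k x y =
     Re (bessel_j (k - 1/2) (\<i> * of_real (x * y))
         + of_real (x * y / (2 * k + 1)) * bessel_j (k + 1/2) (\<i> * of_real (x * y)))"

lemma bessel_j_imaginary_Reals:
  assumes "\<alpha> \<ge> - 1/2"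
  shows "bessel_j \<alpha> (\<i> * of_real r) \<in> \<real>"
proof -
  define f :: "nat \<Rightarrow> real" where
    "f = (\<lambda>n. (r / 2) ^ (2 * n) / (fact n * Gamma (real n + \<alpha> + 1)))"
  have pos: "Gamma (real n + \<alpha> + 1) > 0" for n
    using assms by (intro Gamma_real_pos) auto
  have eq: "(- 1) ^ n * (\<i> * of_real r / 2) ^ (2 * n) /
              of_real (fact n * Gamma (real n + \<alpha> + 1)) = (of_real (f n) :: complex)" for n
  proof -
    have "(- 1) ^ n * (\<i> * of_real r / 2) ^ (2 * n) = ((- 1) * (\<i> * of_real r / 2)\<^sup>2 :: complex) ^ n"
      by (simp only: power_mult power_mult_distrib)
    also have "(- 1) * (\<i> * of_real r / 2)\<^sup>2 = (of_real ((r / 2)\<^sup>2) :: complex)"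
      by (simp add: power_mult_distrib power_divide)
    finally show ?thesis
      by (simp add: f_def power_mult)
  qed
  obtain N :: nat where N: "real N \<ge> 2 * (r / 2)\<^sup>2" "N \<ge> 1"
    by (metis (no_types, opaque_lifting) max.bounded_iff of_nat_le_iff order_trans real_arch_simple
        max.cobounded1 max.cobounded2)
  have "summable f"
  proof (rule summable_ratio_test[of "1/2" N])
    fix n assume n: "n \<ge> N"
    have G: "Gamma (real (Suc n) + \<alpha> + 1) = (real n + \<alpha> + 1) * Gamma (real n + \<alpha> + 1)"
      using Gamma_plus1[of "real n + \<alpha> + 1"] assms
      by (auto simp: add_ac nonpos_Ints_def)
    have nn: "f m \<ge> 0" for m
      using pos[of m] by (simp add: f_def)
    have fS: "f (Suc n) = (r / 2)\<^sup>2 / ((real n + 1) * (real n + \<alpha> + 1)) * f n"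
      by (simp only: f_def G) (simp add: power_add power2_eq_square field_simps)
    have "2 * (r / 2)\<^sup>2 \<le> real n + 1"
      using N n by linarith
    also have "\<dots> \<le> (real n + 1) * (real n + \<alpha> + 1)"
    proof -
      have "1 \<le> real n + \<alpha> + 1"
        using N n assms by linarith
      then show ?thesis
        using mult_left_mono[of 1 "real n + \<alpha> + 1" "real n + 1"] by simp
    qed
    finally have "(r / 2)\<^sup>2 / ((real n + 1) * (real n + \<alpha> + 1)) \<le> 1/2"
      using assms N n by (subst pos_divide_le_eq) (auto intro!: mult_pos_pos)
    then have "f (Suc n) \<le> 1/2 * f n"
      unfolding fS by (rule mult_right_mono[OF _ nn])
    then show "norm (f (Suc n)) \<le> 1/2 * norm (f n)"
      using nn by simp
  qed simp
  then have "(\<Sum>n. of_real (f n) :: complex) = of_real (\<Sum>n. f n)"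
    by (rule suminf_of_real[symmetric])
  then show ?thesis
    unfolding bessel_j_def eq by simp
qed

lemma of_real_dunkl_E:
  assumes "k \<ge> 0"
  shows "of_real (dunkl_E k x y) =
           bessel_j (k - 1/2) (\<i> * of_real (x * y))
           + of_real (x * y / (2 * k + 1)) * bessel_j (k + 1/2) (\<i> * of_real (x * y))"
  unfolding dunkl_E_def
  using assms by (intro of_real_Re Reals_add Reals_mult bessel_j_imaginary_Reals) auto

definition dunkl_c :: "real \<Rightarrow> real" where
  "dunkl_c k = (LINT x|lborel. exp (- x\<^sup>2 / 2) * \<bar>x\<bar> powr (2 * k))"

definition dunkl_heat_kernel :: "real \<Rightarrow> real \<Rightarrow> real \<Rightarrow> real \<Rightarrow> real" where
  "dunkl_heat_kernel k t x y =
     1 / ((2 * t) powr (k + 1/2) * dunkl_c k) * exp (- (x\<^sup>2 + y\<^sup>2) / (4 * t))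
     * dunkl_E k (x / sqrt (2 * t)) (y / sqrt (2 * t))"

text \<open>
  For \<open>k = 0\<close> the weight \<open>\<bar>y\<bar> powr (2 * k)\<close> is \<open>1\<close> except at \<open>y = 0\<close>
  (where \<open>0 powr 0 = 0\<close>), a Lebesgue null set.
\<close>

definition dunkl_semigroup :: "real \<Rightarrow> real \<Rightarrow> real \<Rightarrow> real measure" where
  "dunkl_semigroup k t x =
     (if t = 0 then return borel x
      else density lborel (\<lambda>y. ennreal (dunkl_heat_kernel k t x y * \<bar>y\<bar> powr (2 * k))))"

text \<open>
  The conditional probability of an event is the conditional expectation of its indicator.
\<close>

definition dunkl_process :: "real \<Rightarrow> 'a measure \<Rightarrow> (real \<Rightarrow> 'a \<Rightarrow> real) \<Rightarrow> bool" where
  "dunkl_process k M X \<longleftrightarrow>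
     (\<forall>t\<ge>0. X t \<in> borel_measurable M) \<and>
     (\<forall>s t. \<forall>B\<in>sets borel. 0 \<le> s \<and> s \<le> t \<longrightarrow>
        (AE \<omega> in M. real_cond_exp M (natural_filtration M X s) (\<lambda>\<omega>'. indicator B (X t \<omega>')) \<omega>
                    = measure (dunkl_semigroup k (t - s) (X s \<omega>)) B))"

definition dunkl_moment :: "real \<Rightarrow> nat \<Rightarrow> real \<Rightarrow> real" where
  "dunkl_moment k m x =
     (let n = m div 2 in
      if even m
      then Gamma (k + 1/2) * fact (2 * n) / (Gamma (real n + k + 1/2) * 2 ^ (2 * n) * fact n)
             * x ^ (2 * n)
      else Gamma (k + 1/2) * fact (2 * n + 1)
             / (Gamma (real n + k + 3/2) * 2 ^ (2 * n + 1) * fact n) * x ^ (2 * n + 1))"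

definition dunkl_appell :: "real \<Rightarrow> nat \<Rightarrow> real \<Rightarrow> real \<Rightarrow> real" where
  "dunkl_appell k n t x =
     (\<Sum>j\<le>n div 2. fact n / (fact (n - 2 * j) * fact j) * (- t) ^ j * dunkl_moment k (n - 2 * j) x)"

end

theory Submission
  imports Defs
begin

text \<open>
  Put \<open>\<kappa> = k + 1/2\<close>. For an increment from \<open>X\<close> at time \<open>s\<close> to \<open>Y\<close> at time \<open>s + h\<close> write \<open>D = Y - X\<close>
  and \<open>\<Delta> = Y\<^sup>2 - X\<^sup>2\<close>. The martingale property for \<open>n = 2, 4, 6, 8\<close> gives the conditional means
  of the powers of \<open>\<Delta>\<close>, in particular \<open>E \<Delta>\<^sup>4 = O(h\<^sup>2)\<close>, and \<open>n = 1\<close> gives \<open>E[D\<^sup>2 | X] = 4 \<kappa> h\<close>.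
  For \<open>f = g(x\<^sup>2)\<close> a Taylor expansion in \<open>x\<^sup>2\<close> then yields the infinitesimal identity
  \<open>E[f(Y) - f(X) | X] = h \<Delta>\<^sub>k f(X) + o(h)\<close>. For \<open>f = x g(x\<^sup>2)\<close> one needs in addition the conditional mean of
  \<open>D\<^sup>3\<close>, which records the sign changes; it follows from those of \<open>\<Delta>\<^sup>2\<close> and \<open>D\<^sup>2\<close> because
  \<open>E[D\<^sup>2 |\<Delta>|] = o(h)\<close>: a jump of the sign leaves \<open>X\<^sup>2\<close> continuous.

  Applied to the explicit solutions \<open>\<rho>\<^sup>-\<^sup>\<kappa> exp(-x\<^sup>2/4\<rho>)\<close> and \<open>\<rho>\<^sup>-\<^sup>\<kappa>\<^sup>-\<^sup>1 x exp(-x\<^sup>2/4\<rho>)\<close>, \<open>\<rho> = \<tau> - t\<close>,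
  of the backward heat equation, this shows that they become martingales along the process. The
  Dunkl kernels integrate these functions to the same values, and a finite measure on the line is
  determined by its integrals of \<open>exp(-a x\<^sup>2)\<close> and \<open>x exp(-a x\<^sup>2)\<close>.
\<close>

section \<open>Even Appell characters\<close>

text \<open>The obstacle is that \<open>D\<close> is not small: a flip from \<open>X\<close> to
  \<open>- X\<close> makes even \<open>E D^4\<close> of order \<open>h\<close>, so a Taylor
  expansion in \<open>x\<close> itself leaves no negligible remainder, and of the odd Appell
  characters only the first is given. The mean of \<open>D^3\<close> has to come from
  \<open>2 X D^3 = \<Delta>^2 - 4 X^2 D^2 - D^2 \<Delta>\<close>, which says little where
  \<open>X\<close> is near 0. Cutting at \<open>|X| = q\<close> costs about
  \<open>E[D^2 |\<Delta>|] / q\<close> outside the strip and \<open>q h\<close> inside it. Since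
  \<open>E[D^2 |\<Delta>|]\<close> is bounded by a multiple of \<open>h^(5/4)\<close>, the two
  losses balance at \<open>q = h^(1/8)\<close> and leave an error of order \<open>h^(9/8)\<close>.
  This is the origin of \<open>root 8\<close> and of the exponent 9. The exponent 9/8 exceeds 1, so
  the mean of a heat solution along the process has derivative 0 in time and is constant. An
  arbitrary process offers no regular paths to work with, so the argument stays with such means,
  weighted by bounded functions of the past.\<close>

lemma dunkl_moment_even:
  assumes "k \<ge> 0"
  shows "dunkl_moment k (2 * n) x =
           fact (2 * n) / (4 ^ n * fact n * pochhammer (k + 1/2) n) * x ^ (2 * n)"
proof -
  have G: "Gamma (k + 1/2) > 0"
    using assms by (intro Gamma_real_pos) auto
  have "k + 1/2 \<notin> \<int>\<^sub>\<le>\<^sub>0"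
    using assms by (auto dest: nonpos_Ints_nonpos)
  then have "pochhammer (k + 1/2) n = Gamma (k + 1/2 + real n) / Gamma (k + 1/2)"
    by (rule pochhammer_Gamma)
  moreover have "Gamma (k + 1/2 + real n) > 0"
    using assms by (intro Gamma_real_pos) auto
  moreover have "(4::real) ^ n = (2 ^ n)\<^sup>2"
    by (simp add: power2_eq_square flip: power_mult_distrib)
  ultimately show ?thesis
    using G by (simp add: dunkl_moment_def Let_def power_mult add_ac mult_ac)
qed

lemma dunkl_appell_1:
  assumes "k \<ge> 0"
  shows "dunkl_appell k 1 t x = x / (2 * k + 1)"
proof -
  have "k + 1/2 \<notin> \<int>\<^sub>\<le>\<^sub>0"
    using assms by (auto dest: nonpos_Ints_nonpos)
  then have "Gamma (k + 3/2) = (k + 1/2) * Gamma (k + 1/2)"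
    using Gamma_plus1[of "k + 1/2"] by (simp add: add_ac)
  moreover have "Gamma (k + 1/2) > 0"
    using assms by (intro Gamma_real_pos) auto
  ultimately show ?thesis
    by (simp add: dunkl_appell_def dunkl_moment_def)
qed

text \<open>For \<open>t \<noteq> 0\<close> this is \<open>n! (-4t)^n\<close> times the Laguerre
  polynomial of degree \<open>n\<close> and index \<open>\<kappa> - 1\<close> at
  \<open>x^2 / (4t)\<close>: the even Appell character rescaled to leading coefficient 1. With monic
  polynomials the moments can be solved for one after the other.\<close>

definition heat_poly :: "real \<Rightarrow> nat \<Rightarrow> real \<Rightarrow> real \<Rightarrow> real" where
  "heat_poly \<kappa> n t x = (\<Sum>j\<le>n. real (n choose j) * (- 4 * t) ^ j *
     pochhammer (\<kappa> + real (n - j)) j * x ^ (2 * (n - j)))"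

lemma heat_poly_numeral:
  "heat_poly \<kappa> 1 t x = x ^ 2 - 4 * \<kappa> * t"
  "heat_poly \<kappa> 2 t x = x ^ 4 - 8 * (\<kappa> + 1) * t * x ^ 2 + 16 * \<kappa> * (\<kappa> + 1) * t ^ 2"
  "heat_poly \<kappa> 3 t x = x ^ 6 - 12 * (\<kappa> + 2) * t * x ^ 4 + 48 * (\<kappa> + 1) * (\<kappa> + 2) * t ^ 2 * x ^ 2
      - 64 * \<kappa> * (\<kappa> + 1) * (\<kappa> + 2) * t ^ 3"
  "heat_poly \<kappa> 4 t x = x ^ 8 - 16 * (\<kappa> + 3) * t * x ^ 6 + 96 * (\<kappa> + 2) * (\<kappa> + 3) * t ^ 2 * x ^ 4
      - 256 * (\<kappa> + 1) * (\<kappa> + 2) * (\<kappa> + 3) * t ^ 3 * x ^ 2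
      + 256 * \<kappa> * (\<kappa> + 1) * (\<kappa> + 2) * (\<kappa> + 3) * t ^ 4"
  by (simp_all add: heat_poly_def atMost_nat_numeral eval_nat_numeral pochhammer_Suc algebra_simps)

text \<open>Splitting \<open>pochhammer \<kappa> n\<close> at \<open>n - j\<close> moves the
  Pochhammer symbol from the denominator of the moment function to the numerator. The factor left
  over depends on \<open>n\<close> only and is nonzero, so it drops out of every martingale
  identity.\<close>

lemma dunkl_appell_even:
  assumes "k \<ge> 0" "\<kappa> = k + 1/2"
  shows "dunkl_appell k (2 * n) t x =
           fact (2 * n) / (4 ^ n * fact n * pochhammer \<kappa> n) * heat_poly \<kappa> n t x"
  unfolding dunkl_appell_def heat_poly_def sum_distrib_left
proof (rule sum.cong)
  fix j assume "j \<in> {..n}"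
  then have j: "j \<le> n" by simp
  have pos: "pochhammer \<kappa> (n - j) > 0" "pochhammer (\<kappa> + real (n - j)) j > 0"
    using assms by (auto intro!: pochhammer_pos)
  have 1: "pochhammer \<kappa> n = pochhammer \<kappa> (n - j) * pochhammer (\<kappa> + real (n - j)) j"
    using pochhammer_product'[of \<kappa> "n - j" j] j by simp
  have 2: "2 * n - 2 * j = 2 * (n - j)" by simp
  have 3: "real (n choose j) = fact n / (fact j * fact (n - j))"
    using j by (rule binomial_fact)
  have 4: "(4::real) ^ n = 4 ^ (n - j) * 4 ^ j"
    using j by (simp flip: power_add)
  have 5: "(- 4 * t) ^ j = 4 ^ j * (- t) ^ j"
    by (simp flip: power_mult_distrib)
  show "fact (2 * n) / (fact (2 * n - 2 * j) * fact j) * (- t) ^ j * dunkl_moment k (2 * n - 2 * j) x =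
      fact (2 * n) / (4 ^ n * fact n * pochhammer \<kappa> n) *
      (real (n choose j) * (- 4 * t) ^ j * pochhammer (\<kappa> + real (n - j)) j * x ^ (2 * (n - j)))"
    unfolding 2 dunkl_moment_even[OF assms(1)] assms(2)[symmetric] 1 3 4 5
    using pos by (simp add: divide_simps)
qed simp

section \<open>Martingale identities tested against weights, and integrability of the
  moments\<close>

locale dunkl_martingales = prob_space M for M :: "'a measure" +
  fixes k :: real and X :: "real \<Rightarrow> 'a \<Rightarrow> real" and \<kappa> :: real
  assumes k_nonneg: "k \<ge> 0"
    and kappa: "\<kappa> = k + 1/2"
    and X_measurable: "\<And>t. t \<ge> 0 \<Longrightarrow> X t \<in> borel_measurable M"
    and martingales: "\<And>n. n \<in> {1, 2, 4, 6, 8} \<Longrightarrow>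
      martingale M (natural_filtration M X) (\<lambda>t \<omega>. dunkl_appell k n t (X t \<omega>))"
begin

abbreviation F where "F \<equiv> natural_filtration M X"

lemma kappa_pos: "\<kappa> > 0"
  using kappa k_nonneg by simp

lemma space_filtration [simp]: "space (F s) = space M"
  by (simp add: natural_filtration_def space_measure_of_conv)

lemma subalgebra_filtration: "subalgebra M (F s)"
  using X_measurable unfolding subalgebra_def natural_filtration_def
  by (auto intro!: sets.sigma_sets_subset simp: sets_measure_of_conv space_measure_of_conv
      dest: measurable_sets)

lemma finite_measure_subalgebra_filtration: "finite_measure_subalgebra M (F s)"
  by (simp add: finite_measure_subalgebra_def finite_measure_subalgebra_axioms_def
      subalgebra_filtration finite_measure_axioms)

lemma X_measurable_filtration:
  assumes "0 \<le> u" "u \<le> s"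
  shows "X u \<in> borel_measurable (F s)"
proof (rule measurableI)
  fix A :: "real set" assume "A \<in> sets borel"
  then show "X u -` A \<inter> space (F s) \<in> sets (F s)"
    using assms by (auto simp: natural_filtration_def sets_measure_of_conv)
qed auto

lemma measurable_filtrationD: "f \<in> borel_measurable (F s) \<Longrightarrow> f \<in> borel_measurable M"
  for f :: "'a \<Rightarrow> real"
  by (rule measurable_from_subalg[OF subalgebra_filtration])

text \<open>A conditional expectation may be tested with any weight from the past for which the
  product is integrable. Bounded weights would be too few: later \<open>W\<close> is a bounded
  function times a power of \<open>X s\<close>.\<close>

lemma expectation_martingale:
  fixes W :: "'a \<Rightarrow> real"
  assumes n: "n \<in> {1, 2, 4, 6, 8}" and st: "0 \<le> s" "s \<le> t"
    and W: "W \<in> borel_measurable (F s)"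
    and int: "integrable M (\<lambda>\<omega>. W \<omega> * dunkl_appell k n t (X t \<omega>))"
  shows "expectation (\<lambda>\<omega>. W \<omega> * dunkl_appell k n t (X t \<omega>)) =
         expectation (\<lambda>\<omega>. W \<omega> * dunkl_appell k n s (X s \<omega>))"
proof -
  interpret S: finite_measure_subalgebra M "F s"
    by (rule finite_measure_subalgebra_filtration)
  have m: "martingale M F (\<lambda>t \<omega>. dunkl_appell k n t (X t \<omega>))"
    using martingales[OF n] .
  have ae: "AE \<omega> in M. real_cond_exp M (F s) (\<lambda>\<omega>. dunkl_appell k n t (X t \<omega>)) \<omega>
      = dunkl_appell k n s (X s \<omega>)"
    using m st by (simp add: martingale_def)
  have meas: "(\<lambda>\<omega>. dunkl_appell k n t (X t \<omega>)) \<in> borel_measurable M"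
    using m st by (auto simp: martingale_def intro!: borel_measurable_integrable)
  have "expectation (\<lambda>\<omega>. W \<omega> * dunkl_appell k n t (X t \<omega>)) =
      expectation (\<lambda>\<omega>. W \<omega> * real_cond_exp M (F s) (\<lambda>\<omega>. dunkl_appell k n t (X t \<omega>)) \<omega>)"
    by (rule S.real_cond_exp_intg(2)[OF int W meas, symmetric])
  also have "\<dots> = expectation (\<lambda>\<omega>. W \<omega> * dunkl_appell k n s (X s \<omega>))"
  proof (rule integral_cong_AE)
    have "(\<lambda>\<omega>. dunkl_appell k n s (X s \<omega>)) \<in> borel_measurable M"
      using m st by (auto simp: martingale_def intro!: borel_measurable_integrable)
    then show "(\<lambda>\<omega>. W \<omega> * dunkl_appell k n s (X s \<omega>)) \<in> borel_measurable M"
      using measurable_filtrationD[OF W] by measurable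
  qed (use ae measurable_filtrationD[OF W] in auto)
  finally show ?thesis .
qed

lemma integrable_appell:
  assumes "n \<in> {1, 2, 4, 6, 8}" "0 \<le> t"
  shows "integrable M (\<lambda>\<omega>. dunkl_appell k n t (X t \<omega>))"
  using martingales[OF assms(1)] assms(2) by (auto simp: martingale_def)

lemma integrable_heat_poly:
  assumes n: "n \<in> {1, 2, 3, 4}" and "0 \<le> t"
  shows "integrable M (\<lambda>\<omega>. heat_poly \<kappa> n t (X t \<omega>))"
proof -
  have "2 * n \<in> {1, 2, 4, 6, 8}" using n by auto
  from integrable_appell[OF this \<open>0 \<le> t\<close>] show ?thesis
    using pochhammer_pos[OF kappa_pos, of n]
    by (simp only: dunkl_appell_even[OF k_nonneg kappa] integrable_mult_left_iff) simp
qed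

lemma expectation_heat_poly:
  fixes W :: "'a \<Rightarrow> real"
  assumes n: "n \<in> {1, 2, 3, 4}" and st: "0 \<le> s" "s \<le> t"
    and W: "W \<in> borel_measurable (F s)"
    and int: "integrable M (\<lambda>\<omega>. W \<omega> * heat_poly \<kappa> n t (X t \<omega>))"
  shows "expectation (\<lambda>\<omega>. W \<omega> * heat_poly \<kappa> n t (X t \<omega>)) =
         expectation (\<lambda>\<omega>. W \<omega> * heat_poly \<kappa> n s (X s \<omega>))"
proof -
  define c where "c = fact (2 * n) / (4 ^ n * fact n * pochhammer \<kappa> n)"
  have c: "c \<noteq> 0"
    using pochhammer_pos[OF kappa_pos, of n] by (simp add: c_def)
  have R: "W \<omega> * dunkl_appell k (2 * n) u x = c * (W \<omega> * heat_poly \<kappa> n u x)" for u x \<omega>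
    by (simp add: dunkl_appell_even[OF k_nonneg kappa] c_def)
  have "2 * n \<in> {1, 2, 4, 6, 8}" using n by auto
  from expectation_martingale[OF this st W] int c show ?thesis
    by (simp add: R)
qed

text \<open>The hypothesis gives integrability of whole polynomials. As \<open>heat_poly\<close> is
  monic, the powers 2, 4, 6 and 8 are recovered from it successively.\<close>

lemma integrable_power_8:
  assumes t: "0 \<le> t"
  shows "integrable M (\<lambda>\<omega>. X t \<omega> ^ 8)"
proof -
  note i = integrable_heat_poly[OF _ t]
  have "integrable M (\<lambda>\<omega>. heat_poly \<kappa> 1 t (X t \<omega>) + 4 * \<kappa> * t)"
    using i[of 1] by simp
  then have 2: "integrable M (\<lambda>\<omega>. X t \<omega> ^ 2)"
    by (simp only: heat_poly_numeral) simp
  have "integrable M (\<lambda>\<omega>. heat_poly \<kappa> 2 t (X t \<omega>)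
      + 8 * (\<kappa> + 1) * t * X t \<omega> ^ 2 - 16 * \<kappa> * (\<kappa> + 1) * t ^ 2)"
    using i[of 2] 2 by simp
  then have 4: "integrable M (\<lambda>\<omega>. X t \<omega> ^ 4)"
    by (simp add: heat_poly_numeral)
  have "integrable M (\<lambda>\<omega>. heat_poly \<kappa> 3 t (X t \<omega>)
        + 12 * (\<kappa> + 2) * t * X t \<omega> ^ 4 - 48 * (\<kappa> + 1) * (\<kappa> + 2) * t ^ 2 * X t \<omega> ^ 2
        + 64 * \<kappa> * (\<kappa> + 1) * (\<kappa> + 2) * t ^ 3)"
    using i[of 3] 2 4 by simp
  then have 6: "integrable M (\<lambda>\<omega>. X t \<omega> ^ 6)"
    by (simp add: heat_poly_numeral)
  have "integrable M (\<lambda>\<omega>. heat_poly \<kappa> 4 t (X t \<omega>)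
        + 16 * (\<kappa> + 3) * t * X t \<omega> ^ 6 - 96 * (\<kappa> + 2) * (\<kappa> + 3) * t ^ 2 * X t \<omega> ^ 4
        + 256 * (\<kappa> + 1) * (\<kappa> + 2) * (\<kappa> + 3) * t ^ 3 * X t \<omega> ^ 2
        - 256 * \<kappa> * (\<kappa> + 1) * (\<kappa> + 2) * (\<kappa> + 3) * t ^ 4)"
    using i[of 4] 2 4 6 by simp
  then show ?thesis
    by (simp add: heat_poly_numeral)
qed

end

section \<open>Moments of an increment\<close>

text \<open>The estimates for small time steps concern a single pair of times, so the process is
  reduced here to its past \<open>F\<close>, its present value \<open>X\<close> and one later value
  \<open>Y\<close>.\<close>

locale eighth_moments = prob_space M for M :: "'a measure" +
  fixes F :: "'a measure" and X Y :: "'a \<Rightarrow> real"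
  assumes subalg: "subalgebra M F"
    and X_F: "X \<in> borel_measurable F"
    and Y_meas: "Y \<in> borel_measurable M"
    and X8: "integrable M (\<lambda>\<omega>. X \<omega> ^ 8)"
    and Y8: "integrable M (\<lambda>\<omega>. Y \<omega> ^ 8)"
begin

lemma X_meas: "X \<in> borel_measurable M"
  by (rule measurable_from_subalg[OF subalg X_F])

text \<open>Joint polynomial growth in \<open>X\<close> and \<open>Y\<close>, as a bookkeeping
  device: closure rules compute the degree of an expression, and a degree of at most 8 settles its
  integrability.\<close>

definition growth :: "nat \<Rightarrow> ('a \<Rightarrow> real) \<Rightarrow> bool" where
  "growth d f \<longleftrightarrow> f \<in> borel_measurable M \<and> (\<exists>C. \<forall>\<omega>. \<bar>f \<omega>\<bar> \<le> C * (1 + \<bar>X \<omega>\<bar> + \<bar>Y \<omega>\<bar>) ^ d)"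

lemma growthI:
  assumes "f \<in> borel_measurable M" "\<And>\<omega>. \<bar>f \<omega>\<bar> \<le> C * (1 + \<bar>X \<omega>\<bar> + \<bar>Y \<omega>\<bar>) ^ d"
  shows "growth d f"
  using assms by (auto simp: growth_def)

lemma growthE:
  assumes "growth d f"
  obtains C where "C \<ge> 0" "f \<in> borel_measurable M" "\<And>\<omega>. \<bar>f \<omega>\<bar> \<le> C * (1 + \<bar>X \<omega>\<bar> + \<bar>Y \<omega>\<bar>) ^ d"
proof -
  obtain C where C: "\<And>\<omega>. \<bar>f \<omega>\<bar> \<le> C * (1 + \<bar>X \<omega>\<bar> + \<bar>Y \<omega>\<bar>) ^ d" and m: "f \<in> borel_measurable M"
    using assms by (auto simp: growth_def)
  have "\<bar>f \<omega>\<bar> \<le> \<bar>C\<bar> * (1 + \<bar>X \<omega>\<bar> + \<bar>Y \<omega>\<bar>) ^ d" for \<omega>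
    using C[of \<omega>] by (rule order_trans) (intro mult_right_mono, auto)
  then show ?thesis using m that[of "\<bar>C\<bar>"] by auto
qed

lemma growth_bounded:
  "w \<in> borel_measurable M \<Longrightarrow> (\<And>\<omega>. \<bar>w \<omega>\<bar> \<le> B) \<Longrightarrow> growth 0 w"
  by (rule growthI[where C=B]) auto

lemma growth_const: "growth 0 (\<lambda>\<omega>. c)"
  by (rule growthI[where C="\<bar>c\<bar>"]) auto

lemma growth_X: "growth 1 X" and growth_Y: "growth 1 Y"
  using X_meas Y_meas by (auto intro!: growthI[where C=1])

lemma growth_mult:
  assumes "growth a f" "growth b g"
  shows "growth (a + b) (\<lambda>\<omega>. f \<omega> * g \<omega>)"
proof -
  obtain C C' where *: "C \<ge> 0" "f \<in> borel_measurable M" "\<And>\<omega>. \<bar>f \<omega>\<bar> \<le> C * (1 + \<bar>X \<omega>\<bar> + \<bar>Y \<omega>\<bar>) ^ a"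
    "C' \<ge> 0" "g \<in> borel_measurable M" "\<And>\<omega>. \<bar>g \<omega>\<bar> \<le> C' * (1 + \<bar>X \<omega>\<bar> + \<bar>Y \<omega>\<bar>) ^ b"
    using assms by (elim growthE) blast
  show ?thesis
  proof (rule growthI)
    show "\<bar>f \<omega> * g \<omega>\<bar> \<le> (C * C') * (1 + \<bar>X \<omega>\<bar> + \<bar>Y \<omega>\<bar>) ^ (a + b)" for \<omega>
      using mult_mono[OF *(3)[of \<omega>] *(6)[of \<omega>]] *(1) by (simp add: abs_mult power_add mult_ac)
  qed (use * in measurable)
qed

lemma growth_add:
  assumes "growth a f" "growth b g"
  shows "growth (max a b) (\<lambda>\<omega>. f \<omega> + g \<omega>)"
proof -
  obtain C C' where *: "C \<ge> 0" "f \<in> borel_measurable M" "\<And>\<omega>. \<bar>f \<omega>\<bar> \<le> C * (1 + \<bar>X \<omega>\<bar> + \<bar>Y \<omega>\<bar>) ^ a"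
    "C' \<ge> 0" "g \<in> borel_measurable M" "\<And>\<omega>. \<bar>g \<omega>\<bar> \<le> C' * (1 + \<bar>X \<omega>\<bar> + \<bar>Y \<omega>\<bar>) ^ b"
    using assms by (elim growthE) blast
  show ?thesis
  proof (rule growthI)
    show "\<bar>f \<omega> + g \<omega>\<bar> \<le> (C + C') * (1 + \<bar>X \<omega>\<bar> + \<bar>Y \<omega>\<bar>) ^ max a b" for \<omega>
    proof -
      have "\<bar>f \<omega>\<bar> \<le> C * (1 + \<bar>X \<omega>\<bar> + \<bar>Y \<omega>\<bar>) ^ max a b"
        using *(3)[of \<omega>] by (rule order_trans) (intro mult_left_mono power_increasing, use * in auto)
      moreover have "\<bar>g \<omega>\<bar> \<le> C' * (1 + \<bar>X \<omega>\<bar> + \<bar>Y \<omega>\<bar>) ^ max a b"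
        using *(6)[of \<omega>] by (rule order_trans) (intro mult_left_mono power_increasing, use * in auto)
      ultimately show ?thesis unfolding distrib_right by linarith
    qed
  qed (use * in measurable)
qed

lemma growth_uminus: "growth a f \<Longrightarrow> growth a (\<lambda>\<omega>. - f \<omega>)"
  by (auto simp: growth_def)

lemma growth_diff:
  "growth a f \<Longrightarrow> growth b g \<Longrightarrow> growth (max a b) (\<lambda>\<omega>. f \<omega> - g \<omega>)"
  using growth_add[of a f b "\<lambda>\<omega>. - g \<omega>"] growth_uminus[of b g] by simp

lemma growth_abs: "growth a f \<Longrightarrow> growth a (\<lambda>\<omega>. \<bar>f \<omega>\<bar>)"
  by (auto simp: growth_def)

lemma growth_power: "growth a f \<Longrightarrow> growth (n * a) (\<lambda>\<omega>. f \<omega> ^ n)"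
proof (induction n)
  case 0
  show ?case using growth_const[of 1] by simp
next
  case (Suc n)
  then show ?case using growth_mult[of a f "n * a" "\<lambda>\<omega>. f \<omega> ^ n"] by simp
qed

lemmas growth_intros = growth_X growth_Y growth_const growth_mult growth_add growth_diff
  growth_uminus growth_abs growth_power

text \<open>The sum \<open>1 + |X| + |Y|\<close> is at most three times the largest of its terms,
  whence \<open>3 ^ 8\<close>. In use the degree stays schematic: \<open>growth_intros\<close> build
  it up, and \<open>simp\<close> compares it with 8 afterwards.\<close>

lemma integrable_growth:
  assumes "growth d f" "d \<le> 8"
  shows "integrable M f"
proof -
  obtain C where C: "C \<ge> 0" "f \<in> borel_measurable M"
    "\<And>\<omega>. \<bar>f \<omega>\<bar> \<le> C * (1 + \<bar>X \<omega>\<bar> + \<bar>Y \<omega>\<bar>) ^ d"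
    using assms by (elim growthE) blast
  show ?thesis
  proof (rule Bochner_Integration.integrable_bound[OF _ C(2)])
    show "integrable M (\<lambda>\<omega>. C * 3 ^ 8 * (1 + X \<omega> ^ 8 + Y \<omega> ^ 8))"
      using X8 Y8 by simp
    show "AE \<omega> in M. norm (f \<omega>) \<le> norm (C * 3 ^ 8 * (1 + X \<omega> ^ 8 + Y \<omega> ^ 8))"
    proof (rule AE_I2)
      fix \<omega>
      define m where "m = max 1 (max \<bar>X \<omega>\<bar> \<bar>Y \<omega>\<bar>)"
      have m8: "m ^ 8 \<le> 1 + X \<omega> ^ 8 + Y \<omega> ^ 8"
        by (auto simp: m_def max_def)
      have "(1 + \<bar>X \<omega>\<bar> + \<bar>Y \<omega>\<bar>) ^ d \<le> (1 + \<bar>X \<omega>\<bar> + \<bar>Y \<omega>\<bar>) ^ 8"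
        using assms(2) by (intro power_increasing) auto
      also have "\<dots> \<le> (3 * m) ^ 8"
        by (intro power_mono) (auto simp: m_def)
      also have "\<dots> = 3 ^ 8 * m ^ 8" by (rule power_mult_distrib)
      also have "\<dots> \<le> 3 ^ 8 * (1 + X \<omega> ^ 8 + Y \<omega> ^ 8)"
        using m8 by simp
      finally have "\<bar>f \<omega>\<bar> \<le> C * (3 ^ 8 * (1 + X \<omega> ^ 8 + Y \<omega> ^ 8))"
        using C(3)[of \<omega>] mult_left_mono[OF _ C(1)] by (meson order_trans)
      also have "\<dots> \<le> norm (C * 3 ^ 8 * (1 + X \<omega> ^ 8 + Y \<omega> ^ 8))"
        by (simp add: mult_ac)
      finally show "norm (f \<omega>) \<le> norm (C * 3 ^ 8 * (1 + X \<omega> ^ 8 + Y \<omega> ^ 8))" by simp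
    qed
  qed
qed

lemma growth_weight:
  "w \<in> borel_measurable F \<Longrightarrow> (\<And>\<omega>. \<bar>w \<omega>\<bar> \<le> B) \<Longrightarrow> growth 0 w"
  by (rule growth_bounded[OF measurable_from_subalg[OF subalg]])

lemma integrable_monomial:
  assumes "growth 0 w" "i + j \<le> 8"
  shows "integrable M (\<lambda>\<omega>. w \<omega> * (X \<omega> ^ i * Y \<omega> ^ j))"
    "integrable M (\<lambda>\<omega>. w \<omega> * X \<omega> ^ (i + j))"
  by (rule integrable_growth, (rule growth_intros assms(1))+, use assms(2) in simp)+

end

text \<open>Conditional moments in weak form, tested with \<open>w * X ^ i\<close> as long as the
  total degree stays within 8. The right sides of \<open>mom2\<close> to \<open>mom8\<close> are the
  terms of \<open>heat_poly \<kappa> n (- h) X\<close>, the even moments of the Dunkl kernel started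
  at \<open>X\<close>. \<open>mom8\<close> carries no weight because it serves the plain mean of
  \<open>\<Delta> ^ 4\<close>.\<close>

locale dunkl_increment = eighth_moments +
  fixes \<kappa> h :: real
  assumes kappa_nonneg: "\<kappa> \<ge> 0" and h_nonneg: "h \<ge> 0"
    and mom1: "\<And>w B i. w \<in> borel_measurable F \<Longrightarrow> (\<And>\<omega>. \<bar>w \<omega>\<bar> \<le> B) \<Longrightarrow> i + 1 \<le> 8 \<Longrightarrow>
      expectation (\<lambda>\<omega>. w \<omega> * (X \<omega> ^ i * Y \<omega> ^ 1)) = expectation (\<lambda>\<omega>. w \<omega> * X \<omega> ^ (i + 1))"
    and mom2: "\<And>w B i. w \<in> borel_measurable F \<Longrightarrow> (\<And>\<omega>. \<bar>w \<omega>\<bar> \<le> B) \<Longrightarrow> i + 2 \<le> 8 \<Longrightarrow>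
      expectation (\<lambda>\<omega>. w \<omega> * (X \<omega> ^ i * Y \<omega> ^ 2)) =
        expectation (\<lambda>\<omega>. w \<omega> * X \<omega> ^ (i + 2)) + 4 * \<kappa> * h * expectation (\<lambda>\<omega>. w \<omega> * X \<omega> ^ i)"
    and mom4: "\<And>w B i. w \<in> borel_measurable F \<Longrightarrow> (\<And>\<omega>. \<bar>w \<omega>\<bar> \<le> B) \<Longrightarrow> i + 4 \<le> 8 \<Longrightarrow>
      expectation (\<lambda>\<omega>. w \<omega> * (X \<omega> ^ i * Y \<omega> ^ 4)) =
        expectation (\<lambda>\<omega>. w \<omega> * X \<omega> ^ (i + 4)) +
        8 * (\<kappa> + 1) * h * expectation (\<lambda>\<omega>. w \<omega> * X \<omega> ^ (i + 2)) +
        16 * \<kappa> * (\<kappa> + 1) * h ^ 2 * expectation (\<lambda>\<omega>. w \<omega> * X \<omega> ^ i)"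
    and mom6: "\<And>w B i. w \<in> borel_measurable F \<Longrightarrow> (\<And>\<omega>. \<bar>w \<omega>\<bar> \<le> B) \<Longrightarrow> i + 6 \<le> 8 \<Longrightarrow>
      expectation (\<lambda>\<omega>. w \<omega> * (X \<omega> ^ i * Y \<omega> ^ 6)) =
        expectation (\<lambda>\<omega>. w \<omega> * X \<omega> ^ (i + 6)) +
        12 * (\<kappa> + 2) * h * expectation (\<lambda>\<omega>. w \<omega> * X \<omega> ^ (i + 4)) +
        48 * (\<kappa> + 1) * (\<kappa> + 2) * h ^ 2 * expectation (\<lambda>\<omega>. w \<omega> * X \<omega> ^ (i + 2)) +
        64 * \<kappa> * (\<kappa> + 1) * (\<kappa> + 2) * h ^ 3 * expectation (\<lambda>\<omega>. w \<omega> * X \<omega> ^ i)"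
    and mom8: "expectation (\<lambda>\<omega>. Y \<omega> ^ 8) =
        expectation (\<lambda>\<omega>. X \<omega> ^ 8) +
        16 * (\<kappa> + 3) * h * expectation (\<lambda>\<omega>. X \<omega> ^ 6) +
        96 * (\<kappa> + 2) * (\<kappa> + 3) * h ^ 2 * expectation (\<lambda>\<omega>. X \<omega> ^ 4) +
        256 * (\<kappa> + 1) * (\<kappa> + 2) * (\<kappa> + 3) * h ^ 3 * expectation (\<lambda>\<omega>. X \<omega> ^ 2) +
        256 * \<kappa> * (\<kappa> + 1) * (\<kappa> + 2) * (\<kappa> + 3) * h ^ 4"
begin

abbreviation D where "D \<omega> \<equiv> Y \<omega> - X \<omega>"
abbreviation \<Delta> where "\<Delta> \<omega> \<equiv> Y \<omega> ^ 2 - X \<omega> ^ 2"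

text \<open>By \<open>mom1\<close> the increment is orthogonal to the past. Replacing
  \<open>X Y\<close> by \<open>X ^ 2\<close> then shows that \<open>D ^ 2\<close> and
  \<open>\<Delta>\<close> have the same weighted means.\<close>

lemma expectation_square_difference:
  assumes w: "w \<in> borel_measurable F" "\<And>\<omega>. \<bar>w \<omega>\<bar> \<le> B" and i: "i + 2 \<le> 8"
  shows "expectation (\<lambda>\<omega>. w \<omega> * (X \<omega> ^ i * D \<omega> ^ 2)) =
      4 * \<kappa> * h * expectation (\<lambda>\<omega>. w \<omega> * X \<omega> ^ i)"
    and "expectation (\<lambda>\<omega>. w \<omega> * (X \<omega> ^ i * \<Delta> \<omega>)) =
      4 * \<kappa> * h * expectation (\<lambda>\<omega>. w \<omega> * X \<omega> ^ i)"
proof -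
  note int = integrable_monomial[OF growth_weight[OF w]]
  have "(\<lambda>\<omega>. w \<omega> * (X \<omega> ^ i * D \<omega> ^ 2)) = (\<lambda>\<omega>. w \<omega> * (X \<omega> ^ i * Y \<omega> ^ 2)
      - 2 * (w \<omega> * (X \<omega> ^ (i + 1) * Y \<omega> ^ 1)) + w \<omega> * X \<omega> ^ (i + 2))"
    by (simp add: fun_eq_iff algebra_simps power2_eq_square)
  then have "expectation (\<lambda>\<omega>. w \<omega> * (X \<omega> ^ i * D \<omega> ^ 2)) =
      expectation (\<lambda>\<omega>. w \<omega> * (X \<omega> ^ i * Y \<omega> ^ 2))
      - 2 * expectation (\<lambda>\<omega>. w \<omega> * (X \<omega> ^ (i + 1) * Y \<omega> ^ 1)) + expectation (\<lambda>\<omega>. w \<omega> * X \<omega> ^ (i + 2))"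
    using int(1)[of i 2] int(1)[of "i+1" 1] int(2)[of i 2] i by simp
  then show "expectation (\<lambda>\<omega>. w \<omega> * (X \<omega> ^ i * D \<omega> ^ 2)) =
      4 * \<kappa> * h * expectation (\<lambda>\<omega>. w \<omega> * X \<omega> ^ i)"
    using mom1[OF w, of "i + 1"] mom2[OF w, of i] i by simp
  have "(\<lambda>\<omega>. w \<omega> * (X \<omega> ^ i * \<Delta> \<omega>)) = (\<lambda>\<omega>. w \<omega> * (X \<omega> ^ i * Y \<omega> ^ 2) - w \<omega> * X \<omega> ^ (i + 2))"
    by (simp add: fun_eq_iff algebra_simps power2_eq_square)
  then have "expectation (\<lambda>\<omega>. w \<omega> * (X \<omega> ^ i * \<Delta> \<omega>)) =
      expectation (\<lambda>\<omega>. w \<omega> * (X \<omega> ^ i * Y \<omega> ^ 2)) - expectation (\<lambda>\<omega>. w \<omega> * X \<omega> ^ (i + 2))"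
    using int(1)[of i 2] int(2)[of i 2] i by simp
  then show "expectation (\<lambda>\<omega>. w \<omega> * (X \<omega> ^ i * \<Delta> \<omega>)) =
      4 * \<kappa> * h * expectation (\<lambda>\<omega>. w \<omega> * X \<omega> ^ i)"
    using mom2[OF w, of i] i by simp
qed

text \<open>In order \<open>h\<close> the multiples of \<open>\<kappa>\<close> cancel,
  \<open>8 (\<kappa> + 1) - 2 * 4 \<kappa> = 8\<close>, which leaves the squared-gradient term
  \<open>2 (2 X) ^ 2\<close> of the function \<open>x ^ 2\<close>.\<close>

lemma expectation_Delta_square:
  assumes w: "w \<in> borel_measurable F" "\<And>\<omega>. \<bar>w \<omega>\<bar> \<le> B" and i: "i + 4 \<le> 8"
  shows "expectation (\<lambda>\<omega>. w \<omega> * (X \<omega> ^ i * \<Delta> \<omega> ^ 2)) =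
      8 * h * expectation (\<lambda>\<omega>. w \<omega> * X \<omega> ^ (i + 2)) +
      16 * \<kappa> * (\<kappa> + 1) * h ^ 2 * expectation (\<lambda>\<omega>. w \<omega> * X \<omega> ^ i)"
proof -
  note int = integrable_monomial[OF growth_weight[OF w]]
  have "(\<lambda>\<omega>. w \<omega> * (X \<omega> ^ i * \<Delta> \<omega> ^ 2)) = (\<lambda>\<omega>. w \<omega> * (X \<omega> ^ i * Y \<omega> ^ 4)
      - 2 * (w \<omega> * (X \<omega> ^ (i + 2) * Y \<omega> ^ 2)) + w \<omega> * X \<omega> ^ (i + 4))"
    by (simp add: fun_eq_iff algebra_simps eval_nat_numeral)
  then have "expectation (\<lambda>\<omega>. w \<omega> * (X \<omega> ^ i * \<Delta> \<omega> ^ 2)) =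
      expectation (\<lambda>\<omega>. w \<omega> * (X \<omega> ^ i * Y \<omega> ^ 4))
      - 2 * expectation (\<lambda>\<omega>. w \<omega> * (X \<omega> ^ (i + 2) * Y \<omega> ^ 2)) + expectation (\<lambda>\<omega>. w \<omega> * X \<omega> ^ (i + 4))"
    using int(1)[of i 4] int(1)[of "i+2" 2] int(2)[of i 4] i by simp
  then show ?thesis
    using mom2[OF w, of "i + 2"] mom4[OF w, of i] i by (simp add: algebra_simps del: add_2_eq_Suc')
qed

text \<open>For odd test functions the Taylor remainder carries a factor \<open>Y\<close>; this mean
  pays for it in \<open>bound_Y_Delta3\<close>.\<close>

lemma expectation_Y2_Delta_square:
  "expectation (\<lambda>\<omega>. Y \<omega> ^ 2 * \<Delta> \<omega> ^ 2) = 8 * h * expectation (\<lambda>\<omega>. X \<omega> ^ 4)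
     + 16 * (\<kappa> + 1) * (\<kappa> + 6) * h ^ 2 * expectation (\<lambda>\<omega>. X \<omega> ^ 2)
     + 64 * \<kappa> * (\<kappa> + 1) * (\<kappa> + 2) * h ^ 3"
proof -
  have w: "(\<lambda>\<omega>. 1) \<in> borel_measurable F" "\<And>\<omega>. \<bar>1 :: real\<bar> \<le> 1" by auto
  note int = integrable_monomial[OF growth_weight[OF w], simplified]
  have "(\<lambda>\<omega>. Y \<omega> ^ 2 * \<Delta> \<omega> ^ 2) =
      (\<lambda>\<omega>. Y \<omega> ^ 6 - 2 * (X \<omega> ^ 2 * Y \<omega> ^ 4) + X \<omega> ^ 4 * Y \<omega> ^ 2)"
    by (simp add: fun_eq_iff algebra_simps eval_nat_numeral)
  then have "expectation (\<lambda>\<omega>. Y \<omega> ^ 2 * \<Delta> \<omega> ^ 2) =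
      expectation (\<lambda>\<omega>. Y \<omega> ^ 6) - 2 * expectation (\<lambda>\<omega>. X \<omega> ^ 2 * Y \<omega> ^ 4)
      + expectation (\<lambda>\<omega>. X \<omega> ^ 4 * Y \<omega> ^ 2)"
    using int(1)[of 0 6] int(1)[of 2 4] int(1)[of 4 2] by simp
  then show ?thesis
    using mom2[OF w, of 4] mom4[OF w, of 2] mom6[OF w, of 0]
    by (simp add: prob_space) (simp add: algebra_simps power2_eq_square)
qed

text \<open>In the moment of order \<open>2n\<close> the coefficient of \<open>h ^ j\<close> is a
  polynomial of degree \<open>2j\<close> in \<open>n\<close>, and expanding
  \<open>\<Delta> ^ 4\<close> takes a fourth difference in \<open>n\<close>. Hence the orders 1 and
  \<open>h\<close> vanish and \<open>h ^ 2\<close> is the first to survive. The eighth moment enters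
  here, and it is what makes \<open>\<Delta>\<close> much smaller than \<open>D\<close>.\<close>

lemma expectation_Delta_4:
  "expectation (\<lambda>\<omega>. \<Delta> \<omega> ^ 4) = 192 * h ^ 2 * expectation (\<lambda>\<omega>. X \<omega> ^ 4)
     + 768 * (\<kappa> + 1) * (\<kappa> + 2) * h ^ 3 * expectation (\<lambda>\<omega>. X \<omega> ^ 2)
     + 256 * \<kappa> * (\<kappa> + 1) * (\<kappa> + 2) * (\<kappa> + 3) * h ^ 4"
proof -
  have w: "(\<lambda>\<omega>. 1) \<in> borel_measurable F" "\<And>\<omega>. \<bar>1 :: real\<bar> \<le> 1" by auto
  note int = integrable_monomial[OF growth_weight[OF w], simplified]
  have "(\<lambda>\<omega>. \<Delta> \<omega> ^ 4) = (\<lambda>\<omega>. Y \<omega> ^ 8 - 4 * (X \<omega> ^ 2 * Y \<omega> ^ 6) + 6 * (X \<omega> ^ 4 * Y \<omega> ^ 4)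
      - 4 * (X \<omega> ^ 6 * Y \<omega> ^ 2) + X \<omega> ^ 8)"
    by (simp add: fun_eq_iff algebra_simps eval_nat_numeral)
  then have "expectation (\<lambda>\<omega>. \<Delta> \<omega> ^ 4) =
      expectation (\<lambda>\<omega>. Y \<omega> ^ 8) - 4 * expectation (\<lambda>\<omega>. X \<omega> ^ 2 * Y \<omega> ^ 6)
      + 6 * expectation (\<lambda>\<omega>. X \<omega> ^ 4 * Y \<omega> ^ 4) - 4 * expectation (\<lambda>\<omega>. X \<omega> ^ 6 * Y \<omega> ^ 2)
      + expectation (\<lambda>\<omega>. X \<omega> ^ 8)"
    using int(1)[of 2 6] int(1)[of 4 4] int(1)[of 6 2] X8 Y8 by simp
  then show ?thesis
    using mom2[OF w, of 6] mom4[OF w, of 4] mom6[OF w, of 2] mom8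
    by simp (simp add: algebra_simps power2_eq_square)
qed

end

section \<open>Small increments\<close>

text \<open>The weight \<open>r\<close> stays free so that factors of different order in
  \<open>h\<close> can be balanced.\<close>

lemma young_product: "r > 0 \<Longrightarrow> a * b \<le> (r * a ^ 2 + 1 / r * b ^ 2) / 2" for a b r :: real
proof -
  assume r: "r > 0"
  have "0 \<le> (r * a - b) ^ 2 / r" using r by simp
  also have "\<dots> = r * a ^ 2 + 1 / r * b ^ 2 - 2 * (a * b)"
    using r by (simp add: field_simps power2_eq_square)
  finally show ?thesis by simp
qed

text \<open>
  The coefficients collected here are those of the moment formulas above; only the fact that the
  constant dominates each group of them is used.
\<close>

definition increment_const :: "real \<Rightarrow> real \<Rightarrow> real" where
  "increment_const \<kappa> K = K * (4 * \<kappa> + (8 + 16 * \<kappa> * (\<kappa> + 1))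
     + (192 + 768 * (\<kappa> + 1) * (\<kappa> + 2) + 256 * \<kappa> * (\<kappa> + 1) * (\<kappa> + 2) * (\<kappa> + 3))
     + (8 + 16 * (\<kappa> + 1) * (\<kappa> + 6) + 64 * \<kappa> * (\<kappa> + 1) * (\<kappa> + 2)))"

text \<open>The eighth root \<open>q\<close> of the time step is both the cutoff for
  \<open>|X|\<close> and the source of the Young weights \<open>q ^ 2\<close> and
  \<open>q ^ 4\<close>, and it keeps all exponents integral. The bound \<open>K\<close> will be
  uniform over a time interval.\<close>

locale dunkl_small_increment = dunkl_increment +
  fixes q K :: real
  assumes q_pos: "0 < q" and q_le: "q \<le> 1" and h_q: "h = q ^ 8"
    and K_ge: "1 \<le> K" and K2: "expectation (\<lambda>\<omega>. X \<omega> ^ 2) \<le> K"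
    and K4: "expectation (\<lambda>\<omega>. X \<omega> ^ 4) \<le> K"
begin

abbreviation c where "c \<equiv> increment_const \<kappa> K"

lemma const_bounds:
  "K * (4 * \<kappa>) \<le> c" "K * (8 + 16 * \<kappa> * (\<kappa> + 1)) \<le> c"
  "K * (192 + 768 * (\<kappa> + 1) * (\<kappa> + 2) + 256 * \<kappa> * (\<kappa> + 1) * (\<kappa> + 2) * (\<kappa> + 3)) \<le> c"
  "K * (8 + 16 * (\<kappa> + 1) * (\<kappa> + 6) + 64 * \<kappa> * (\<kappa> + 1) * (\<kappa> + 2)) \<le> c"
  using K_ge kappa_nonneg unfolding increment_const_def
  by (auto intro!: mult_left_mono add_nonneg_nonneg)

lemma c_pos: "c > 0"
  using const_bounds(2) K_ge kappa_nonneg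
  by (smt (verit, best) mult_nonneg_nonneg mult_pos_pos)

lemma h_le: "h \<le> 1"
  using q_pos q_le by (simp add: h_q power_le_one)

lemma h_power_le: "h ^ n \<le> 1"
  using h_le h_nonneg by (simp add: power_le_one)

section \<open>Mean sizes of the increment in powers of \<open>q\<close>\<close>

lemma bound_D2: "expectation (\<lambda>\<omega>. D \<omega> ^ 2) \<le> c * q ^ 8"
proof -
  have "expectation (\<lambda>\<omega>. D \<omega> ^ 2) = 4 * \<kappa> * h"
    using expectation_square_difference(1)[of "\<lambda>_. 1" 1 0] by (simp add: prob_space)
  also have "\<dots> \<le> c * h"
  proof (rule mult_right_mono[OF _ h_nonneg])
    show "4 * \<kappa> \<le> c"
      using const_bounds(1) mult_right_mono[OF K_ge, of "4 * \<kappa>"] kappa_nonneg by simp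
  qed
  finally show ?thesis by (simp add: h_q)
qed

lemma bound_X2_D2: "expectation (\<lambda>\<omega>. X \<omega> ^ 2 * D \<omega> ^ 2) \<le> c * q ^ 8"
proof -
  have "expectation (\<lambda>\<omega>. X \<omega> ^ 2 * D \<omega> ^ 2) = (expectation (\<lambda>\<omega>. X \<omega> ^ 2) * (4 * \<kappa>)) * h"
    using expectation_square_difference(1)[of "\<lambda>_. 1" 1 2] by simp
  also have "\<dots> \<le> c * h"
    using const_bounds(1) mult_right_mono[OF K2, of "4 * \<kappa>"] kappa_nonneg
    by (intro mult_right_mono[OF _ h_nonneg]) simp
  finally show ?thesis by (simp add: h_q)
qed

lemma bound_Delta2: "expectation (\<lambda>\<omega>. \<Delta> \<omega> ^ 2) \<le> c * q ^ 8"
proof -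
  have "expectation (\<lambda>\<omega>. \<Delta> \<omega> ^ 2) = (8 * expectation (\<lambda>\<omega>. X \<omega> ^ 2) + 16 * \<kappa> * (\<kappa> + 1) * h) * h"
    using expectation_Delta_square[of "\<lambda>_. 1" 1 0]
    by (simp add: prob_space power2_eq_square eval_nat_numeral algebra_simps)
  also have "\<dots> \<le> (8 * K + 16 * \<kappa> * (\<kappa> + 1) * K) * h"
    using K2 K_ge h_le kappa_nonneg
    by (intro mult_right_mono[OF _ h_nonneg] add_mono mult_left_mono) auto
  also have "\<dots> \<le> c * h"
    using const_bounds(2) by (intro mult_right_mono[OF _ h_nonneg]) (simp add: algebra_simps)
  finally show ?thesis by (simp add: h_q)
qed

lemma bound_Y2_Delta2: "expectation (\<lambda>\<omega>. Y \<omega> ^ 2 * \<Delta> \<omega> ^ 2) \<le> c * q ^ 8"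
proof -
  have "expectation (\<lambda>\<omega>. Y \<omega> ^ 2 * \<Delta> \<omega> ^ 2) = (8 * expectation (\<lambda>\<omega>. X \<omega> ^ 4)
     + 16 * (\<kappa> + 1) * (\<kappa> + 6) * (h * expectation (\<lambda>\<omega>. X \<omega> ^ 2))
     + 64 * \<kappa> * (\<kappa> + 1) * (\<kappa> + 2) * h ^ 2) * h"
    unfolding expectation_Y2_Delta_square by (simp add: power2_eq_square eval_nat_numeral algebra_simps)
  also have "\<dots> \<le> (8 * K + 16 * (\<kappa> + 1) * (\<kappa> + 6) * (1 * K) + 64 * \<kappa> * (\<kappa> + 1) * (\<kappa> + 2) * K) * h"
    using K2 K4 K_ge h_le h_power_le[of 2] kappa_nonneg h_nonneg
    by (intro mult_right_mono[OF _ h_nonneg] add_mono mult_left_mono mult_mono) auto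
  also have "\<dots> \<le> c * h"
    using const_bounds(4) by (intro mult_right_mono[OF _ h_nonneg]) (simp add: algebra_simps)
  finally show ?thesis by (simp add: h_q)
qed

lemma bound_Delta4: "expectation (\<lambda>\<omega>. \<Delta> \<omega> ^ 4) \<le> c * q ^ 16"
proof -
  have "expectation (\<lambda>\<omega>. \<Delta> \<omega> ^ 4) = (192 * expectation (\<lambda>\<omega>. X \<omega> ^ 4)
     + 768 * (\<kappa> + 1) * (\<kappa> + 2) * (h * expectation (\<lambda>\<omega>. X \<omega> ^ 2))
     + 256 * \<kappa> * (\<kappa> + 1) * (\<kappa> + 2) * (\<kappa> + 3) * h ^ 2) * h ^ 2"
    unfolding expectation_Delta_4 by (simp add: power2_eq_square eval_nat_numeral algebra_simps)
  also have "\<dots> \<le> (192 * K + 768 * (\<kappa> + 1) * (\<kappa> + 2) * (1 * K)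
      + 256 * \<kappa> * (\<kappa> + 1) * (\<kappa> + 2) * (\<kappa> + 3) * K) * h ^ 2"
    using K2 K4 K_ge h_le h_power_le[of 2] kappa_nonneg h_nonneg
    by (intro mult_right_mono add_mono mult_left_mono mult_mono) auto
  also have "\<dots> \<le> c * h ^ 2"
    using const_bounds(3) by (intro mult_right_mono) (simp_all add: algebra_simps)
  finally show ?thesis by (simp add: h_q flip: power_mult)
qed

text \<open>The inequality \<open>D ^ 2 \<le> 8 X ^ 2 + 4 (X + Y) ^ 2\<close> is multiplied by
  \<open>D ^ 2\<close>, where \<open>X + Y\<close> turns \<open>D\<close> into
  \<open>\<Delta>\<close>; the constant 12 is 8 + 4. The order is \<open>h\<close>, the same as for
  \<open>D ^ 2\<close>, because sign flips are not small.\<close>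

lemma bound_D4: "expectation (\<lambda>\<omega>. D \<omega> ^ 4) \<le> 12 * c * q ^ 8"
proof -
  have pw: "D \<omega> ^ 4 \<le> 8 * (X \<omega> ^ 2 * D \<omega> ^ 2) + 4 * \<Delta> \<omega> ^ 2" for \<omega>
  proof -
    have "0 \<le> D \<omega> ^ 2 * (8 * X \<omega> ^ 2 + 4 * (Y \<omega> + X \<omega>) ^ 2 - D \<omega> ^ 2)"
    proof (intro mult_nonneg_nonneg)
      have "0 \<le> (Y \<omega> + 3 * X \<omega>) ^ 2 + 2 * (Y \<omega> + X \<omega>) ^ 2" by simp
      also have "\<dots> = 8 * X \<omega> ^ 2 + 4 * (Y \<omega> + X \<omega>) ^ 2 - D \<omega> ^ 2"
        by (simp add: algebra_simps power2_eq_square)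
      finally show "0 \<le> 8 * X \<omega> ^ 2 + 4 * (Y \<omega> + X \<omega>) ^ 2 - D \<omega> ^ 2" .
    qed auto
    also have "\<dots> = 8 * (X \<omega> ^ 2 * D \<omega> ^ 2) + 4 * \<Delta> \<omega> ^ 2 - D \<omega> ^ 4"
      by (simp add: algebra_simps eval_nat_numeral)
    finally show ?thesis by simp
  qed
  have "expectation (\<lambda>\<omega>. D \<omega> ^ 4) \<le> expectation (\<lambda>\<omega>. 8 * (X \<omega> ^ 2 * D \<omega> ^ 2) + 4 * \<Delta> \<omega> ^ 2)"
    by (intro integral_mono pw; rule integrable_growth, (rule growth_intros)+, simp)
  also have "\<dots> = 8 * expectation (\<lambda>\<omega>. X \<omega> ^ 2 * D \<omega> ^ 2) + 4 * expectation (\<lambda>\<omega>. \<Delta> \<omega> ^ 2)"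
    by (subst Bochner_Integration.integral_add; (simp; fail)?; rule integrable_growth, (rule growth_intros)+, simp)
  finally show ?thesis
    using bound_X2_D2 bound_Delta2 by simp
qed

lemma expectation_young:
  assumes "r > 0" and f: "growth a f" "2 * a \<le> 8" and g: "growth b g" "2 * b \<le> 8"
    and E: "expectation (\<lambda>\<omega>. f \<omega> ^ 2) \<le> A" "expectation (\<lambda>\<omega>. g \<omega> ^ 2) \<le> B"
  shows "expectation (\<lambda>\<omega>. f \<omega> * g \<omega>) \<le> (r * A + 1 / r * B) / 2"
proof -
  have int: "integrable M (\<lambda>\<omega>. f \<omega> ^ 2)" "integrable M (\<lambda>\<omega>. g \<omega> ^ 2)"
    using growth_power[OF f(1), of 2] growth_power[OF g(1), of 2] f g
    by (auto intro: integrable_growth)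
  have "integrable M (\<lambda>\<omega>. f \<omega> * g \<omega>)"
    using growth_mult[OF f(1) g(1)] f g by (auto intro: integrable_growth)
  then have "expectation (\<lambda>\<omega>. f \<omega> * g \<omega>) \<le> expectation (\<lambda>\<omega>. (r * f \<omega> ^ 2 + 1 / r * g \<omega> ^ 2) / 2)"
    using int \<open>r > 0\<close> by (intro integral_mono young_product) auto
  also have "\<dots> = (r * expectation (\<lambda>\<omega>. f \<omega> ^ 2) + 1 / r * expectation (\<lambda>\<omega>. g \<omega> ^ 2)) / 2"
    using int by simp
  also have "\<dots> \<le> (r * A + 1 / r * B) / 2"
    using E \<open>r > 0\<close> by (intro divide_right_mono add_mono mult_left_mono) auto
  finally show ?thesis .
qed

text \<open>Young's inequality with weight \<open>q ^ 4\<close> makes the orders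
  \<open>q ^ 8\<close> of \<open>D ^ 2\<close> and \<open>q ^ 16\<close> of
  \<open>\<Delta> ^ 4\<close> meet at \<open>q ^ 12\<close>, which is \<open>h\<close> to the power
  3/2. The two lemmas that follow balance in the same way.\<close>

lemma bound_D_Delta2: "expectation (\<lambda>\<omega>. \<bar>D \<omega>\<bar> * \<Delta> \<omega> ^ 2) \<le> c * q ^ 12"
proof -
  have "expectation (\<lambda>\<omega>. \<bar>D \<omega>\<bar> * \<Delta> \<omega> ^ 2) \<le> (q ^ 4 * (c * q ^ 8) + 1 / q ^ 4 * (c * q ^ 16)) / 2"
    by (rule expectation_young, use q_pos in simp, (rule growth_intros)+, simp, (rule growth_intros)+)
      (use bound_D2 bound_Delta4 in \<open>simp_all flip: power_mult\<close>)
  also have "\<dots> = c * q ^ 12"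
    using q_pos by (simp add: field_simps flip: power_add)
  finally show ?thesis .
qed

lemma bound_Y_Delta3: "expectation (\<lambda>\<omega>. \<bar>Y \<omega>\<bar> * \<bar>\<Delta> \<omega>\<bar> ^ 3) \<le> c * q ^ 12"
proof -
  have "expectation (\<lambda>\<omega>. (\<bar>Y \<omega>\<bar> * \<bar>\<Delta> \<omega>\<bar>) * \<Delta> \<omega> ^ 2) \<le> (q ^ 4 * (c * q ^ 8) + 1 / q ^ 4 * (c * q ^ 16)) / 2"
    by (rule expectation_young, use q_pos in simp, (rule growth_intros)+, simp, (rule growth_intros)+)
      (use bound_Y2_Delta2 bound_Delta4 in \<open>simp_all add: power_mult_distrib flip: power_mult\<close>)
  also have "\<dots> = c * q ^ 12"
    using q_pos by (simp add: field_simps flip: power_add)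
  finally show ?thesis by (simp add: eval_nat_numeral mult_ac)
qed

lemma bound_Delta3: "expectation (\<lambda>\<omega>. \<bar>\<Delta> \<omega>\<bar> ^ 3) \<le> c * q ^ 12"
proof -
  have "expectation (\<lambda>\<omega>. \<bar>\<Delta> \<omega>\<bar> * \<Delta> \<omega> ^ 2) \<le> (q ^ 4 * (c * q ^ 8) + 1 / q ^ 4 * (c * q ^ 16)) / 2"
    by (rule expectation_young, use q_pos in simp, (rule growth_intros)+, simp, (rule growth_intros)+)
      (use bound_Delta2 bound_Delta4 in \<open>simp_all add: power_mult_distrib flip: power_mult\<close>)
  also have "\<dots> = c * q ^ 12"
    using q_pos by (simp add: field_simps flip: power_add)
  finally show ?thesis by (simp add: eval_nat_numeral mult_ac)
qed

text \<open>Two Young steps. Weight \<open>q ^ 4\<close> brings \<open>D ^ 4\<close> and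
  \<open>\<Delta> ^ 4\<close> together at \<open>q ^ 12\<close> for
  \<open>D ^ 2 \<Delta> ^ 2\<close>; weight \<open>q ^ 2\<close> then balances this with
  \<open>D ^ 2\<close>, of order \<open>q ^ 8\<close>, at \<open>q ^ 10\<close>. The factors 13/2
  and 15/4 are the averages \<open>(12 + 1) / 2\<close> and \<open>(1 + 13/2) / 2\<close>.\<close>

lemma bound_D2_Delta: "expectation (\<lambda>\<omega>. D \<omega> ^ 2 * \<bar>\<Delta> \<omega>\<bar>) \<le> 4 * c * q ^ 10"
proof -
  have "expectation (\<lambda>\<omega>. D \<omega> ^ 2 * \<Delta> \<omega> ^ 2) \<le> (q ^ 4 * (12 * c * q ^ 8) + 1 / q ^ 4 * (c * q ^ 16)) / 2"
    by (rule expectation_young, use q_pos in simp, (rule growth_intros)+, simp, (rule growth_intros)+)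
      (use bound_D4 bound_Delta4 in \<open>simp_all flip: power_mult\<close>)
  also have "\<dots> = 13 / 2 * c * q ^ 12"
    using q_pos by (simp add: field_simps flip: power_add)
  finally have E: "expectation (\<lambda>\<omega>. (\<bar>D \<omega>\<bar> * \<bar>\<Delta> \<omega>\<bar>) ^ 2) \<le> 13 / 2 * c * q ^ 12"
    by (simp add: power_mult_distrib)
  have "expectation (\<lambda>\<omega>. \<bar>D \<omega>\<bar> * (\<bar>D \<omega>\<bar> * \<bar>\<Delta> \<omega>\<bar>)) \<le> (q ^ 2 * (c * q ^ 8) + 1 / q ^ 2 * (13 / 2 * c * q ^ 12)) / 2"
    by (rule expectation_young, use q_pos in simp, (rule growth_intros)+, simp, (rule growth_intros)+)
      (use bound_D2 E in simp_all)
  also have "\<dots> = 15 / 4 * c * q ^ 10"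
    using q_pos by (simp add: field_simps flip: power_add)
  also have "\<dots> \<le> 4 * c * q ^ 10"
    using c_pos q_pos by simp
  finally show ?thesis by (simp add: power2_eq_square abs_mult_self_eq flip: mult.assoc)
qed

end

text \<open>On the half line the derivatives of \<open>exp (- x)\<close> are bounded by 1. The
  expansion runs to second order because \<open>\<Delta> ^ 2\<close> still has a mean of order
  \<open>h\<close>, whereas \<open>|\<Delta>| ^ 3\<close> is negligible.\<close>

lemma exp_minus_taylor_2:
  fixes u v :: real
  assumes "u \<ge> 0" "v \<ge> 0"
  shows "\<bar>exp (- v) - exp (- u) * (1 - (v - u) + (v - u) ^ 2 / 2)\<bar> \<le> \<bar>v - u\<bar> ^ 3"
proof (cases "u = v")
  case False
  define diff :: "nat \<Rightarrow> real \<Rightarrow> real" where "diff = (\<lambda>m x. (- 1) ^ m * exp (- x))"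
  have "\<exists>t. (if v < u then v < t \<and> t < u else u < t \<and> t < v) \<and>
      exp (- v) = (\<Sum>m<3. diff m u / fact m * (v - u) ^ m) + diff 3 t / fact 3 * (v - u) ^ 3"
  proof (rule Taylor[where a = "min u v" and b = "max u v"])
    show "\<forall>m t. m < 3 \<and> min u v \<le> t \<and> t \<le> max u v \<longrightarrow> (diff m has_real_derivative diff (Suc m) t) (at t)"
      by (auto simp: diff_def intro!: derivative_eq_intros)
  qed (use False in \<open>auto simp: diff_def\<close>)
  then obtain t where t: "if v < u then v < t \<and> t < u else u < t \<and> t < v"
    and eq: "exp (- v) = (\<Sum>m<3. diff m u / fact m * (v - u) ^ m) + diff 3 t / fact 3 * (v - u) ^ 3"
    by blast
  have t0: "t \<ge> 0" using t assms by (auto split: if_splits)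
  have "exp (- v) - exp (- u) * (1 - (v - u) + (v - u) ^ 2 / 2) = - exp (- t) / 6 * (v - u) ^ 3"
    unfolding eq by (simp add: diff_def eval_nat_numeral algebra_simps)
  moreover have "\<bar>- exp (- t) / 6 * (v - u) ^ 3\<bar> \<le> 1 * \<bar>v - u\<bar> ^ 3"
    unfolding abs_mult power_abs using t0 by (intro mult_right_mono) (auto simp: order_trans[of _ 1])
  ultimately show ?thesis by simp
qed simp

context dunkl_increment
begin

lemma abs_expectation_le:
  assumes "growth a f" "a \<le> 8" "growth b g" "b \<le> 8" "\<And>\<omega>. \<bar>f \<omega>\<bar> \<le> g \<omega>"
  shows "\<bar>expectation f\<bar> \<le> expectation g"
proof -
  have "\<bar>expectation f\<bar> \<le> expectation (\<lambda>\<omega>. \<bar>f \<omega>\<bar>)"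
    by (rule integral_abs_bound)
  also have "\<dots> \<le> expectation g"
    using assms growth_abs[of a f] by (intro integral_mono) (auto intro: integrable_growth)
  finally show ?thesis .
qed

end

section \<open>The cubic increment and the infinitesimal identities\<close>

context dunkl_small_increment
begin

text \<open>The second bound is meant for \<open>|4 - 8 \<kappa>|\<close>.\<close>

lemma const_simple: "16 * \<kappa> * (\<kappa> + 1) \<le> c" "8 * \<kappa> + 4 \<le> c"
proof -
  define P where "P = 16 * \<kappa> * (\<kappa> + 1)"
  have "8 + P \<le> c"
    using const_bounds(2) mult_right_mono[OF K_ge, of "8 + P"] kappa_nonneg by (simp add: P_def)
  moreover have "16 * \<kappa> \<le> P"
    using mult_left_mono[of 1 "\<kappa> + 1" "16 * \<kappa>"] kappa_nonneg by (simp add: P_def)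
  ultimately have "P \<le> c" "8 * \<kappa> + 4 \<le> c"
    using kappa_nonneg by - linarith+
  then show "16 * \<kappa> * (\<kappa> + 1) \<le> c" "8 * \<kappa> + 4 \<le> c" by (simp_all add: P_def)
qed

lemma q_power_le: "m \<le> n \<Longrightarrow> q ^ n \<le> q ^ m"
  using q_pos q_le by (simp add: power_decreasing)

text \<open>With \<open>\<kappa> = k + 1/2\<close> the coefficient \<open>4 - 8 \<kappa>\<close> is
  \<open>- 8 k\<close>: a flip from \<open>X\<close> to \<open>- X\<close> has
  \<open>D ^ 3 = - 8 X ^ 3\<close>, and the Dunkl Laplacian prescribes flips at rate
  \<open>k / X ^ 2\<close>. The constant 11 collects 1 + 2 + 7 + 1 from \<open>b1\<close> to
  \<open>b4\<close>.\<close>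

lemma expectation_D3:
  assumes W[measurable]: "W \<in> borel_measurable F" and W1: "\<And>\<omega>. \<bar>W \<omega>\<bar> \<le> 1"
  shows "\<bar>expectation (\<lambda>\<omega>. W \<omega> * D \<omega> ^ 3) - (4 - 8 * \<kappa>) * h * expectation (\<lambda>\<omega>. W \<omega> * X \<omega>)\<bar> \<le> 11 * c * q ^ 9"
proof -
  note [measurable] = X_F
  \<comment> \<open>For \<open>\<bar>X\<bar> > q\<close>, \<open>2 X D\<^sup>3 = \<Delta>\<^sup>2 - 4 X\<^sup>2 D\<^sup>2 - D\<^sup>2 \<Delta>\<close> has a known conditional mean up to \<open>D\<^sup>2 \<Delta>\<close>
    and one can divide by \<open>X\<close>; for \<open>\<bar>X\<bar> \<le> q\<close>, \<open>\<bar>D\<bar>\<^sup>3\<close> itself is negligible.\<close>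
  define V where "V = (\<lambda>\<omega>. if \<bar>X \<omega>\<bar> > q then W \<omega> / X \<omega> else 0)"
  define W' where "W' = (\<lambda>\<omega>. if \<bar>X \<omega>\<bar> > q then 0 else W \<omega>)"
  have V: "V \<in> borel_measurable F" unfolding V_def by measurable
  have V1: "\<bar>V \<omega>\<bar> \<le> 1 / q" for \<omega>
    using W1[of \<omega>] q_pos by (auto simp: V_def abs_divide intro!: frac_le)
  have W': "W' \<in> borel_measurable F" unfolding W'_def by measurable
  have W'1: "\<bar>W' \<omega>\<bar> \<le> 1" for \<omega>
    using W1[of \<omega>] by (auto simp: W'_def)
  note gr = growth_weight[OF W W1] growth_weight[OF V V1] growth_weight[OF W' W'1] growth_intros
  have pw: "W \<omega> * D \<omega> ^ 3 = (V \<omega> * (X \<omega> ^ 0 * \<Delta> \<omega> ^ 2)) / 2 - 2 * (V \<omega> * (X \<omega> ^ 2 * D \<omega> ^ 2))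
      - (V \<omega> * (D \<omega> ^ 2 * \<Delta> \<omega>)) / 2 + W' \<omega> * D \<omega> ^ 3" for \<omega>
  proof (cases "\<bar>X \<omega>\<bar> > q")
    case True
    then have "X \<omega> \<noteq> 0" using q_pos by auto
    have "\<Delta> \<omega> ^ 2 / 2 - 2 * (X \<omega> ^ 2 * D \<omega> ^ 2) - (D \<omega> ^ 2 * \<Delta> \<omega>) / 2 = X \<omega> * D \<omega> ^ 3"
      by (simp add: field_simps eval_nat_numeral)
    then have "V \<omega> * (X \<omega> * D \<omega> ^ 3) = V \<omega> * (\<Delta> \<omega> ^ 2 / 2 - 2 * (X \<omega> ^ 2 * D \<omega> ^ 2) - (D \<omega> ^ 2 * \<Delta> \<omega>) / 2)"
      by simp
    moreover have "V \<omega> * (X \<omega> * D \<omega> ^ 3) = W \<omega> * D \<omega> ^ 3"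
      using True \<open>X \<omega> \<noteq> 0\<close> by (simp add: V_def)
    moreover have "W' \<omega> = 0" using True by (simp add: W'_def)
    ultimately show ?thesis by (simp add: algebra_simps)
  qed (simp add: V_def W'_def)
  have i1: "integrable M (\<lambda>\<omega>. V \<omega> * (X \<omega> ^ 0 * \<Delta> \<omega> ^ 2))"
    by (rule integrable_growth, (rule gr)+, simp)
  have i2: "integrable M (\<lambda>\<omega>. V \<omega> * (X \<omega> ^ 2 * D \<omega> ^ 2))"
    by (rule integrable_growth, (rule gr)+, simp)
  have i3: "integrable M (\<lambda>\<omega>. V \<omega> * (D \<omega> ^ 2 * \<Delta> \<omega>))"
    by (rule integrable_growth, (rule gr)+, simp)
  have i4: "integrable M (\<lambda>\<omega>. W' \<omega> * D \<omega> ^ 3)"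
    by (rule integrable_growth, (rule gr)+, simp)
  have e1: "expectation (\<lambda>\<omega>. W \<omega> * D \<omega> ^ 3) =
      expectation (\<lambda>\<omega>. V \<omega> * (X \<omega> ^ 0 * \<Delta> \<omega> ^ 2)) / 2
      - 2 * expectation (\<lambda>\<omega>. V \<omega> * (X \<omega> ^ 2 * D \<omega> ^ 2))
      - expectation (\<lambda>\<omega>. V \<omega> * (D \<omega> ^ 2 * \<Delta> \<omega>)) / 2 + expectation (\<lambda>\<omega>. W' \<omega> * D \<omega> ^ 3)"
    unfolding pw using i1 i2 i3 i4 by simp
  have "W \<omega> * X \<omega> = V \<omega> * X \<omega> ^ 2 + W' \<omega> * X \<omega>" for \<omega>
    using q_pos by (auto simp: V_def W'_def power2_eq_square)
  moreover have "integrable M (\<lambda>\<omega>. V \<omega> * X \<omega> ^ 2)" "integrable M (\<lambda>\<omega>. W' \<omega> * X \<omega>)"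
    by (rule integrable_growth, (rule gr)+, simp)+
  ultimately have e2: "expectation (\<lambda>\<omega>. W \<omega> * X \<omega>) =
      expectation (\<lambda>\<omega>. V \<omega> * X \<omega> ^ 2) + expectation (\<lambda>\<omega>. W' \<omega> * X \<omega>)"
    by simp
  \<comment> \<open>The terms of order \<open>h\<close> tested with \<open>V\<close> cancel, since
    half of 8 minus twice \<open>4 \<kappa>\<close> is \<open>4 - 8 \<kappa>\<close>. What is left
    carries \<open>h ^ 2\<close>, or the factor \<open>D ^ 2 * \<Delta>\<close>, or the weight
    \<open>W'\<close> of the strip.\<close>
  have e3: "expectation (\<lambda>\<omega>. W \<omega> * D \<omega> ^ 3) - (4 - 8 * \<kappa>) * h * expectation (\<lambda>\<omega>. W \<omega> * X \<omega>) =
      8 * \<kappa> * (\<kappa> + 1) * h ^ 2 * expectation V - expectation (\<lambda>\<omega>. V \<omega> * (D \<omega> ^ 2 * \<Delta> \<omega>)) / 2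
      + expectation (\<lambda>\<omega>. W' \<omega> * D \<omega> ^ 3) - (4 - 8 * \<kappa>) * h * expectation (\<lambda>\<omega>. W' \<omega> * X \<omega>)"
    unfolding e1 e2
    using expectation_Delta_square[OF V V1, of 0] expectation_square_difference(1)[OF V V1, of 2]
    by (simp add: algebra_simps power2_eq_square)
  have b1: "\<bar>8 * \<kappa> * (\<kappa> + 1) * h ^ 2 * expectation V\<bar> \<le> c * q ^ 9"
  proof -
    have "\<bar>expectation V\<bar> \<le> expectation (\<lambda>\<omega>. 1 / q)"
      by (rule abs_expectation_le[where a=0 and b=0]) (auto intro: gr V1)
    then have "\<bar>8 * \<kappa> * (\<kappa> + 1) * h ^ 2 * expectation V\<bar> \<le> (c * q ^ 16) * (1 / q)"
      unfolding abs_mult using const_simple kappa_nonneg c_pos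
      by (intro mult_mono) (auto simp: prob_space h_q simp flip: power_mult)
    also have "\<dots> = c * q ^ 15" using q_pos by (simp add: eval_nat_numeral)
    also have "\<dots> \<le> c * q ^ 9" using c_pos by (intro mult_left_mono q_power_le) auto
    finally show ?thesis .
  qed
  \<comment> \<open>The decisive loss: dividing by \<open>X\<close> costs \<open>1 / q\<close> and
    turns \<open>q ^ 10\<close> into \<open>q ^ 9\<close>.\<close>
  have b2: "\<bar>expectation (\<lambda>\<omega>. V \<omega> * (D \<omega> ^ 2 * \<Delta> \<omega>)) / 2\<bar> \<le> 2 * c * q ^ 9"
  proof -
    have "\<bar>expectation (\<lambda>\<omega>. V \<omega> * (D \<omega> ^ 2 * \<Delta> \<omega>))\<bar> \<le> expectation (\<lambda>\<omega>. 1 / q * (D \<omega> ^ 2 * \<bar>\<Delta> \<omega>\<bar>))"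
    proof (rule abs_expectation_le)
      show "\<bar>V \<omega> * (D \<omega> ^ 2 * \<Delta> \<omega>)\<bar> \<le> 1 / q * (D \<omega> ^ 2 * \<bar>\<Delta> \<omega>\<bar>)" for \<omega>
        unfolding abs_mult using V1[of \<omega>] q_pos by (intro mult_mono) auto
    qed ((rule gr)+, simp, (rule gr)+, simp)
    also have "\<dots> = 1 / q * expectation (\<lambda>\<omega>. D \<omega> ^ 2 * \<bar>\<Delta> \<omega>\<bar>)" by simp
    also have "\<dots> \<le> 1 / q * (4 * c * q ^ 10)"
      using bound_D2_Delta q_pos by (intro mult_left_mono) auto
    also have "\<dots> = 4 * c * q ^ 9" using q_pos by (simp add: eval_nat_numeral)
    finally show ?thesis by simp
  qed
  have b3: "\<bar>expectation (\<lambda>\<omega>. W' \<omega> * D \<omega> ^ 3)\<bar> \<le> 7 * c * q ^ 9"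
  proof -
    \<comment> \<open>Inside the strip \<open>Y ^ 2 \<le> q ^ 2 + |\<Delta>|\<close>, so one factor
      \<open>|D|\<close> of the cube can be replaced by a multiple of \<open>q\<close> plus
      \<open>|\<Delta>| / q\<close>.\<close>
    have pw: "\<bar>W' \<omega> * D \<omega> ^ 3\<bar> \<le> 3 * q * D \<omega> ^ 2 + 1 / q * (D \<omega> ^ 2 * \<bar>\<Delta> \<omega>\<bar>)" for \<omega>
    proof (cases "\<bar>X \<omega>\<bar> > q")
      case True
      then show ?thesis using q_pos by (simp add: W'_def)
    next
      case False
      have "Y \<omega> ^ 2 \<le> q ^ 2 + \<bar>\<Delta> \<omega>\<bar>"
        using power_mono[of "\<bar>X \<omega>\<bar>" q 2] False by simp
      also have "\<dots> \<le> (q + \<bar>\<Delta> \<omega>\<bar> / q) ^ 2"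
      proof -
        have "(q + \<bar>\<Delta> \<omega>\<bar> / q) ^ 2 = q ^ 2 + 2 * \<bar>\<Delta> \<omega>\<bar> + (\<bar>\<Delta> \<omega>\<bar> / q) ^ 2"
          using q_pos by (simp add: power2_sum)
        then show ?thesis by simp
      qed
      finally have Y2: "Y \<omega> ^ 2 \<le> (q + \<bar>\<Delta> \<omega>\<bar> / q) ^ 2" .
      have "0 \<le> q + \<bar>\<Delta> \<omega>\<bar> / q" using q_pos by simp
      then have "\<bar>Y \<omega>\<bar> \<le> q + \<bar>\<Delta> \<omega>\<bar> / q"
        using power2_le_iff_abs_le Y2 by blast
      then have D: "\<bar>D \<omega>\<bar> \<le> 3 * q + \<bar>\<Delta> \<omega>\<bar> / q"
        using False q_pos by linarith
      have "\<bar>W' \<omega> * D \<omega> ^ 3\<bar> \<le> 1 * (D \<omega> ^ 2 * \<bar>D \<omega>\<bar>)"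
        using W'1[of \<omega>] mult_right_mono[of "\<bar>W' \<omega>\<bar>" 1 "D \<omega> ^ 2 * \<bar>D \<omega>\<bar>"]
        by (simp add: abs_mult eval_nat_numeral)
      also have "\<dots> \<le> 1 * (D \<omega> ^ 2 * (3 * q + \<bar>\<Delta> \<omega>\<bar> / q))"
        using D by (intro mult_left_mono) auto
      finally show ?thesis by (simp add: algebra_simps)
    qed
    have "\<bar>expectation (\<lambda>\<omega>. W' \<omega> * D \<omega> ^ 3)\<bar> \<le>
        expectation (\<lambda>\<omega>. 3 * q * D \<omega> ^ 2 + 1 / q * (D \<omega> ^ 2 * \<bar>\<Delta> \<omega>\<bar>))"
      by (rule abs_expectation_le[OF _ _ _ _ pw], (rule gr)+, simp, (rule gr)+, simp)
    also have "\<dots> = 3 * q * expectation (\<lambda>\<omega>. D \<omega> ^ 2) + 1 / q * expectation (\<lambda>\<omega>. D \<omega> ^ 2 * \<bar>\<Delta> \<omega>\<bar>)"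
      by (subst Bochner_Integration.integral_add; (simp; fail)?; rule integrable_growth, (rule gr)+, simp)
    also have "\<dots> \<le> 3 * q * (c * q ^ 8) + 1 / q * (4 * c * q ^ 10)"
      using bound_D2 bound_D2_Delta q_pos by (intro add_mono mult_left_mono) auto
    also have "\<dots> = 7 * c * q ^ 9" using q_pos by (simp add: eval_nat_numeral)
    finally show ?thesis .
  qed
  have b4: "\<bar>(4 - 8 * \<kappa>) * h * expectation (\<lambda>\<omega>. W' \<omega> * X \<omega>)\<bar> \<le> c * q ^ 9"
  proof -
    have "\<bar>expectation (\<lambda>\<omega>. W' \<omega> * X \<omega>)\<bar> \<le> expectation (\<lambda>\<omega>. q)"
    proof (rule abs_expectation_le)
      show "\<bar>W' \<omega> * X \<omega>\<bar> \<le> q" for \<omega>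
        using mult_mono[OF W'1[of \<omega>], of "\<bar>X \<omega>\<bar>" q] q_pos by (auto simp: abs_mult W'_def)
    qed ((rule gr)+, simp, (rule gr)+, simp)
    then have "\<bar>(4 - 8 * \<kappa>) * h * expectation (\<lambda>\<omega>. W' \<omega> * X \<omega>)\<bar> \<le> (c * q ^ 8) * q"
      unfolding abs_mult using const_simple kappa_nonneg c_pos h_nonneg
      by (intro mult_mono) (auto simp: prob_space h_q)
    then show ?thesis by (simp add: eval_nat_numeral mult_ac)
  qed
  show ?thesis unfolding e3 using b1 b2 b3 b4 by linarith
qed

text \<open>The polynomial \<open>4 \<beta>^2 x^2 - 4 \<kappa> \<beta>\<close> is what the Dunkl
  Laplacian multiplies \<open>exp (- \<beta> x^2)\<close> by. The exponential at \<open>X\<close> is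
  absorbed into the weight \<open>W\<close>, still bounded by 1 as \<open>\<beta> \<ge> 0\<close>,
  so that the Taylor terms fall under the moment formulas for \<open>\<Delta>\<close> and
  \<open>\<Delta> ^ 2\<close>.\<close>

lemma heat_step_even:
  assumes w[measurable]: "w \<in> borel_measurable F" and w1: "\<And>\<omega>. \<bar>w \<omega>\<bar> \<le> 1"
    and \<beta>: "0 \<le> \<beta>" "\<beta> \<le> b" and b: "1 \<le> b"
  shows "\<bar>expectation (\<lambda>\<omega>. w \<omega> * (exp (- \<beta> * Y \<omega> ^ 2) - exp (- \<beta> * X \<omega> ^ 2)))
    - h * expectation (\<lambda>\<omega>. w \<omega> * (exp (- \<beta> * X \<omega> ^ 2) * (4 * \<beta> ^ 2 * X \<omega> ^ 2 - 4 * \<kappa> * \<beta>)))\<bar>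
    \<le> (13 + K) * b ^ 3 * c * q ^ 9"
proof -
  note [measurable] = X_F
  define W where "W = (\<lambda>\<omega>. w \<omega> * exp (- \<beta> * X \<omega> ^ 2))"
  have W: "W \<in> borel_measurable F" unfolding W_def by measurable
  have W1: "\<bar>W \<omega>\<bar> \<le> 1" for \<omega>
    using mult_mono[OF w1[of \<omega>], of "exp (- \<beta> * X \<omega> ^ 2)" 1] \<beta> by (auto simp: W_def abs_mult)
  define r where "r = (\<lambda>\<omega>. w \<omega> * (exp (- \<beta> * Y \<omega> ^ 2)
    - exp (- \<beta> * X \<omega> ^ 2) * (1 - \<beta> * \<Delta> \<omega> + (\<beta> * \<Delta> \<omega>) ^ 2 / 2)))"
  have r: "\<bar>r \<omega>\<bar> \<le> b ^ 3 * \<bar>\<Delta> \<omega>\<bar> ^ 3" for \<omega>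
  proof -
    have "0 \<le> \<beta> * X \<omega> ^ 2" "0 \<le> \<beta> * Y \<omega> ^ 2" using \<beta> by simp_all
    from exp_minus_taylor_2[OF this]
    have T: "\<bar>exp (- \<beta> * Y \<omega> ^ 2) - exp (- \<beta> * X \<omega> ^ 2) * (1 - \<beta> * \<Delta> \<omega> + (\<beta> * \<Delta> \<omega>) ^ 2 / 2)\<bar>
        \<le> \<bar>\<beta> * \<Delta> \<omega>\<bar> ^ 3"
      by (simp flip: right_diff_distrib)
    have "\<bar>r \<omega>\<bar> \<le> 1 * \<bar>\<beta> * \<Delta> \<omega>\<bar> ^ 3"
      unfolding r_def abs_mult[of "w \<omega>"] abs_mult[of "Y \<omega>"]
      by (intro mult_mono w1 T mult_left_mono) auto
    also have "\<dots> \<le> (b * \<bar>\<Delta> \<omega>\<bar>) ^ 3"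
      using \<beta> by (simp add: abs_mult power_mult_distrib mult_right_mono power_mono)
    finally show ?thesis by (simp add: power_mult_distrib)
  qed
  have [measurable]: "w \<in> borel_measurable M" "X \<in> borel_measurable M" "Y \<in> borel_measurable M"
    using X_meas Y_meas measurable_from_subalg[OF subalg w] by auto
  \<comment> \<open>The closure rules do not apply to the exponential at \<open>Y\<close>, so the
    degree is read off from the cubic bound \<open>r\<close>.\<close>
  have rgr: "growth 6 r"
  proof -
    have "growth (3 * (max (2 * 1) (2 * 1))) (\<lambda>\<omega>. \<Delta> \<omega> ^ 3)" by (rule growth_intros)+
    then obtain C where C: "C \<ge> 0" "\<And>\<omega>. \<bar>\<Delta> \<omega> ^ 3\<bar> \<le> C * (1 + \<bar>X \<omega>\<bar> + \<bar>Y \<omega>\<bar>) ^ 6"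
      by (auto elim: growthE)
    show ?thesis
    proof (rule growthI)
      show "\<bar>r \<omega>\<bar> \<le> (b ^ 3 * C) * (1 + \<bar>X \<omega>\<bar> + \<bar>Y \<omega>\<bar>) ^ 6" for \<omega>
      proof -
        have "\<bar>r \<omega>\<bar> \<le> b ^ 3 * \<bar>\<Delta> \<omega> ^ 3\<bar>" using r[of \<omega>] by (simp add: power_abs)
        also have "\<dots> \<le> b ^ 3 * (C * (1 + \<bar>X \<omega>\<bar> + \<bar>Y \<omega>\<bar>) ^ 6)"
          using b by (intro mult_left_mono C) auto
        finally show ?thesis by simp
      qed
    qed (unfold r_def, measurable)
  qed
  note gr = growth_weight[OF W W1] rgr growth_intros
  have i: "integrable M (\<lambda>\<omega>. W \<omega> * (X \<omega> ^ 0 * \<Delta> \<omega>))" "integrable M (\<lambda>\<omega>. W \<omega> * (X \<omega> ^ 0 * \<Delta> \<omega> ^ 2))"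
    "integrable M r" "integrable M W" "integrable M (\<lambda>\<omega>. W \<omega> * X \<omega> ^ 2)"
    by (rule integrable_growth, (rule gr)+, simp)+
  have "w \<omega> * (exp (- \<beta> * Y \<omega> ^ 2) - exp (- \<beta> * X \<omega> ^ 2)) =
      - \<beta> * (W \<omega> * (X \<omega> ^ 0 * \<Delta> \<omega>)) + \<beta> ^ 2 / 2 * (W \<omega> * (X \<omega> ^ 0 * \<Delta> \<omega> ^ 2)) + r \<omega>" for \<omega>
  proof -
    have "v * (E' - E) = - \<beta> * (v * E * d) + \<beta> ^ 2 / 2 * (v * E * d ^ 2)
        + v * (E' - E * (1 - \<beta> * d + (\<beta> * d) ^ 2 / 2))" for v E E' d :: real
      by (simp add: power_mult_distrib algebra_simps)
    from this[of "w \<omega>" "exp (- \<beta> * Y \<omega> ^ 2)" "exp (- \<beta> * X \<omega> ^ 2)" "\<Delta> \<omega>"] show ?thesis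
      by (simp only: W_def r_def power_0 mult_1)
  qed
  then have e1: "expectation (\<lambda>\<omega>. w \<omega> * (exp (- \<beta> * Y \<omega> ^ 2) - exp (- \<beta> * X \<omega> ^ 2))) =
      - \<beta> * expectation (\<lambda>\<omega>. W \<omega> * (X \<omega> ^ 0 * \<Delta> \<omega>))
      + \<beta> ^ 2 / 2 * expectation (\<lambda>\<omega>. W \<omega> * (X \<omega> ^ 0 * \<Delta> \<omega> ^ 2)) + expectation r"
    using i by simp
  have "w \<omega> * (exp (- \<beta> * X \<omega> ^ 2) * (4 * \<beta> ^ 2 * X \<omega> ^ 2 - 4 * \<kappa> * \<beta>)) =
      4 * \<beta> ^ 2 * (W \<omega> * X \<omega> ^ 2) - 4 * \<kappa> * \<beta> * W \<omega>" for \<omega>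
    by (simp add: W_def algebra_simps)
  then have e2: "expectation (\<lambda>\<omega>. w \<omega> * (exp (- \<beta> * X \<omega> ^ 2) * (4 * \<beta> ^ 2 * X \<omega> ^ 2 - 4 * \<kappa> * \<beta>))) =
      4 * \<beta> ^ 2 * expectation (\<lambda>\<omega>. W \<omega> * X \<omega> ^ 2) - 4 * \<kappa> * \<beta> * expectation W"
    using i by simp
  have e3: "expectation (\<lambda>\<omega>. w \<omega> * (exp (- \<beta> * Y \<omega> ^ 2) - exp (- \<beta> * X \<omega> ^ 2)))
    - h * expectation (\<lambda>\<omega>. w \<omega> * (exp (- \<beta> * X \<omega> ^ 2) * (4 * \<beta> ^ 2 * X \<omega> ^ 2 - 4 * \<kappa> * \<beta>))) =
    \<beta> ^ 2 / 2 * (16 * \<kappa> * (\<kappa> + 1)) * h ^ 2 * expectation W + expectation r"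
    unfolding e1 e2
    using expectation_Delta_square[OF W W1, of 0] expectation_square_difference(2)[OF W W1, of 0]
    by (simp add: algebra_simps eval_nat_numeral)
  have b23: "\<beta> ^ 2 \<le> b ^ 3"
    using power_mono[OF \<beta>(2,1), of 2] power_increasing[of 2 3 b] b by simp
  then have b23': "\<bar>\<beta> ^ 2 / 2\<bar> \<le> b ^ 3"
    using zero_le_power2[of \<beta>] by linarith
  have b1: "\<bar>\<beta> ^ 2 / 2 * (16 * \<kappa> * (\<kappa> + 1)) * h ^ 2 * expectation W\<bar> \<le> b ^ 3 * c * q ^ 9"
  proof -
    have "\<bar>expectation W\<bar> \<le> expectation (\<lambda>\<omega>. 1)"
      by (rule abs_expectation_le[OF _ _ _ _ W1], (rule gr)+, simp, (rule gr)+, simp)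
    then have "\<bar>\<beta> ^ 2 / 2 * (16 * \<kappa> * (\<kappa> + 1)) * h ^ 2 * expectation W\<bar> \<le> b ^ 3 * c * q ^ 16 * 1"
      unfolding abs_mult[of _ "expectation _"] abs_mult[of _ "h ^ 2"] abs_mult[of "\<beta> ^ 2 / 2"]
      using const_simple(1) kappa_nonneg c_pos b
      by (intro mult_mono b23') (auto simp: prob_space h_q simp flip: power_mult)
    also have "\<dots> \<le> b ^ 3 * c * q ^ 9"
      using c_pos b by (simp add: q_power_le)
    finally show ?thesis .
  qed
  have b2: "\<bar>expectation r\<bar> \<le> b ^ 3 * c * q ^ 9"
  proof -
    have "\<bar>expectation r\<bar> \<le> expectation (\<lambda>\<omega>. b ^ 3 * \<bar>\<Delta> \<omega>\<bar> ^ 3)"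
      by (rule abs_expectation_le[OF _ _ _ _ r], (rule gr)+, simp, (rule gr)+, simp)
    also have "\<dots> \<le> b ^ 3 * (c * q ^ 12)"
      using bound_Delta3 b by (simp add: mult_left_mono)
    also have "\<dots> \<le> b ^ 3 * (c * q ^ 9)"
      using c_pos b by (intro mult_left_mono q_power_le) auto
    finally show ?thesis by simp
  qed
  \<comment> \<open>Padding: the two remainders give the factor 2, and 13 + \<open>K\<close> is the
    constant of the odd case.\<close>
  have "1 * (b ^ 3 * c * q ^ 9) \<le> (11 + K) * (b ^ 3 * c * q ^ 9)"
    using K_ge b c_pos q_pos by (intro mult_right_mono) auto
  then show ?thesis unfolding e3 using b1 b2 by (simp add: algebra_simps)
qed

text \<open>On \<open>x exp (- \<beta> x^2)\<close> the Dunkl Laplacian acts with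
  \<open>\<kappa> + 1\<close> in place of \<open>\<kappa>\<close>. The new difficulty is the factor
  \<open>Y\<close> before the exponential: the term linear in \<open>\<beta>\<close> becomes
  \<open>Y * \<Delta>\<close>, whose mean involves that of \<open>D ^ 3\<close>.\<close>

lemma heat_step_odd:
  assumes w[measurable]: "w \<in> borel_measurable F" and w1: "\<And>\<omega>. \<bar>w \<omega>\<bar> \<le> 1"
    and \<beta>: "0 \<le> \<beta>" "\<beta> \<le> b" and b: "1 \<le> b"
  shows "\<bar>expectation (\<lambda>\<omega>. w \<omega> * (Y \<omega> * exp (- \<beta> * Y \<omega> ^ 2) - X \<omega> * exp (- \<beta> * X \<omega> ^ 2)))
    - h * expectation (\<lambda>\<omega>. w \<omega> * (X \<omega> * exp (- \<beta> * X \<omega> ^ 2) * (4 * \<beta> ^ 2 * X \<omega> ^ 2 - 4 * (\<kappa> + 1) * \<beta>)))\<bar>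
    \<le> (13 + K) * b ^ 3 * c * q ^ 9"
proof -
  note [measurable] = X_F
  define W where "W = (\<lambda>\<omega>. w \<omega> * exp (- \<beta> * X \<omega> ^ 2))"
  have W: "W \<in> borel_measurable F" unfolding W_def by measurable
  have W1: "\<bar>W \<omega>\<bar> \<le> 1" for \<omega>
    using mult_mono[OF w1[of \<omega>], of "exp (- \<beta> * X \<omega> ^ 2)" 1] \<beta> by (auto simp: W_def abs_mult)
  define r where "r = (\<lambda>\<omega>. w \<omega> * (Y \<omega> * (exp (- \<beta> * Y \<omega> ^ 2)
    - exp (- \<beta> * X \<omega> ^ 2) * (1 - \<beta> * \<Delta> \<omega> + (\<beta> * \<Delta> \<omega>) ^ 2 / 2))))"
  have r: "\<bar>r \<omega>\<bar> \<le> b ^ 3 * (\<bar>Y \<omega>\<bar> * \<bar>\<Delta> \<omega>\<bar> ^ 3)" for \<omega>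
  proof -
    have "0 \<le> \<beta> * X \<omega> ^ 2" "0 \<le> \<beta> * Y \<omega> ^ 2" using \<beta> by simp_all
    from exp_minus_taylor_2[OF this]
    have T: "\<bar>exp (- \<beta> * Y \<omega> ^ 2) - exp (- \<beta> * X \<omega> ^ 2) * (1 - \<beta> * \<Delta> \<omega> + (\<beta> * \<Delta> \<omega>) ^ 2 / 2)\<bar>
        \<le> \<bar>\<beta> * \<Delta> \<omega>\<bar> ^ 3"
      by (simp flip: right_diff_distrib)
    have "\<bar>r \<omega>\<bar> \<le> 1 * (\<bar>Y \<omega>\<bar> * \<bar>\<beta> * \<Delta> \<omega>\<bar> ^ 3)"
      unfolding r_def abs_mult[of "w \<omega>"] abs_mult[of "Y \<omega>"]
      by (intro mult_mono w1 T mult_left_mono) auto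
    also have "\<dots> \<le> \<bar>Y \<omega>\<bar> * (b * \<bar>\<Delta> \<omega>\<bar>) ^ 3"
      using \<beta> by (simp add: abs_mult power_mult_distrib mult_right_mono mult_left_mono power_mono)
    finally show ?thesis by (simp add: power_mult_distrib mult_ac)
  qed
  have [measurable]: "w \<in> borel_measurable M" "X \<in> borel_measurable M" "Y \<in> borel_measurable M"
    using X_meas Y_meas measurable_from_subalg[OF subalg w] by auto
  have rgr: "growth 7 r"
  proof -
    have "growth (1 + 3 * (max (2 * 1) (2 * 1))) (\<lambda>\<omega>. Y \<omega> * \<Delta> \<omega> ^ 3)" by (rule growth_intros)+
    then obtain C where C: "C \<ge> 0" "\<And>\<omega>. \<bar>Y \<omega> * \<Delta> \<omega> ^ 3\<bar> \<le> C * (1 + \<bar>X \<omega>\<bar> + \<bar>Y \<omega>\<bar>) ^ 7"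
      by (auto elim: growthE)
    show ?thesis
    proof (rule growthI)
      show "\<bar>r \<omega>\<bar> \<le> (b ^ 3 * C) * (1 + \<bar>X \<omega>\<bar> + \<bar>Y \<omega>\<bar>) ^ 7" for \<omega>
      proof -
        have "\<bar>r \<omega>\<bar> \<le> b ^ 3 * \<bar>Y \<omega> * \<Delta> \<omega> ^ 3\<bar>" using r[of \<omega>] by (simp add: power_abs abs_mult)
        also have "\<dots> \<le> b ^ 3 * (C * (1 + \<bar>X \<omega>\<bar> + \<bar>Y \<omega>\<bar>) ^ 7)"
          using b by (intro mult_left_mono C) auto
        finally show ?thesis by simp
      qed
    qed (unfold r_def, measurable)
  qed
  note gr = growth_weight[OF W W1] rgr growth_intros
  have i: "integrable M (\<lambda>\<omega>. W \<omega> * (X \<omega> ^ 0 * Y \<omega> ^ 1))" "integrable M (\<lambda>\<omega>. W \<omega> * X \<omega> ^ 1)"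
    "integrable M (\<lambda>\<omega>. W \<omega> * (X \<omega> ^ 1 * \<Delta> \<omega>))" "integrable M (\<lambda>\<omega>. W \<omega> * (X \<omega> ^ 1 * D \<omega> ^ 2))"
    "integrable M (\<lambda>\<omega>. W \<omega> * D \<omega> ^ 3)"
    "integrable M (\<lambda>\<omega>. W \<omega> * (X \<omega> ^ 1 * \<Delta> \<omega> ^ 2))" "integrable M (\<lambda>\<omega>. W \<omega> * (D \<omega> * \<Delta> \<omega> ^ 2))"
    "integrable M r" "integrable M (\<lambda>\<omega>. W \<omega> * X \<omega> ^ 3)"
    by (rule integrable_growth, (rule gr)+, simp)+
  have "w \<omega> * (Y \<omega> * exp (- \<beta> * Y \<omega> ^ 2) - X \<omega> * exp (- \<beta> * X \<omega> ^ 2)) =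
      W \<omega> * (X \<omega> ^ 0 * Y \<omega> ^ 1) - W \<omega> * X \<omega> ^ 1 - \<beta> * (W \<omega> * (X \<omega> ^ 1 * \<Delta> \<omega>))
      - 2 * \<beta> * (W \<omega> * (X \<omega> ^ 1 * D \<omega> ^ 2)) - \<beta> * (W \<omega> * D \<omega> ^ 3)
      + \<beta> ^ 2 / 2 * (W \<omega> * (X \<omega> ^ 1 * \<Delta> \<omega> ^ 2)) + \<beta> ^ 2 / 2 * (W \<omega> * (D \<omega> * \<Delta> \<omega> ^ 2)) + r \<omega>" for \<omega>
  proof -
    \<comment> \<open>From \<open>D * \<Delta> = D ^ 2 * (2 X + D)\<close>; every piece has a
      conditional mean known at least up to a negligible error.\<close>
    have 1: "Y \<omega> * \<Delta> \<omega> = X \<omega> * \<Delta> \<omega> + 2 * (X \<omega> * D \<omega> ^ 2) + D \<omega> ^ 3"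
      by (simp add: algebra_simps eval_nat_numeral)
    have "w \<omega> * (Y \<omega> * exp (- \<beta> * Y \<omega> ^ 2) - X \<omega> * exp (- \<beta> * X \<omega> ^ 2)) =
      W \<omega> * D \<omega> - \<beta> * (W \<omega> * (Y \<omega> * \<Delta> \<omega>)) + \<beta> ^ 2 / 2 * (W \<omega> * (X \<omega> * \<Delta> \<omega> ^ 2))
      + \<beta> ^ 2 / 2 * (W \<omega> * (D \<omega> * \<Delta> \<omega> ^ 2)) + r \<omega>"
    proof -
      have "v * (y * E' - x * E) = v * E * (y - x) - \<beta> * (v * E * (y * d)) + \<beta> ^ 2 / 2 * (v * E * (x * d ^ 2))
          + \<beta> ^ 2 / 2 * (v * E * ((y - x) * d ^ 2)) + v * (y * (E' - E * (1 - \<beta> * d + (\<beta> * d) ^ 2 / 2)))"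
        for v E E' d x y :: real
        by (simp add: power_mult_distrib algebra_simps)
      from this[of "w \<omega>" "Y \<omega>" "exp (- \<beta> * Y \<omega> ^ 2)" "X \<omega>" "exp (- \<beta> * X \<omega> ^ 2)" "\<Delta> \<omega>"] show ?thesis
        by (simp only: W_def r_def)
    qed
    then show ?thesis unfolding 1 by (simp add: algebra_simps)
  qed
  then have e1: "expectation (\<lambda>\<omega>. w \<omega> * (Y \<omega> * exp (- \<beta> * Y \<omega> ^ 2) - X \<omega> * exp (- \<beta> * X \<omega> ^ 2))) =
      expectation (\<lambda>\<omega>. W \<omega> * (X \<omega> ^ 0 * Y \<omega> ^ 1)) - expectation (\<lambda>\<omega>. W \<omega> * X \<omega> ^ 1)
      - \<beta> * expectation (\<lambda>\<omega>. W \<omega> * (X \<omega> ^ 1 * \<Delta> \<omega>))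
      - 2 * \<beta> * expectation (\<lambda>\<omega>. W \<omega> * (X \<omega> ^ 1 * D \<omega> ^ 2)) - \<beta> * expectation (\<lambda>\<omega>. W \<omega> * D \<omega> ^ 3)
      + \<beta> ^ 2 / 2 * expectation (\<lambda>\<omega>. W \<omega> * (X \<omega> ^ 1 * \<Delta> \<omega> ^ 2))
      + \<beta> ^ 2 / 2 * expectation (\<lambda>\<omega>. W \<omega> * (D \<omega> * \<Delta> \<omega> ^ 2)) + expectation r"
    using i by simp
  have "w \<omega> * (X \<omega> * exp (- \<beta> * X \<omega> ^ 2) * (4 * \<beta> ^ 2 * X \<omega> ^ 2 - 4 * (\<kappa> + 1) * \<beta>)) =
      4 * \<beta> ^ 2 * (W \<omega> * X \<omega> ^ 3) - 4 * (\<kappa> + 1) * \<beta> * (W \<omega> * X \<omega> ^ 1)" for \<omega>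
    by (simp add: W_def algebra_simps eval_nat_numeral)
  then have e2: "expectation (\<lambda>\<omega>. w \<omega> * (X \<omega> * exp (- \<beta> * X \<omega> ^ 2) * (4 * \<beta> ^ 2 * X \<omega> ^ 2 - 4 * (\<kappa> + 1) * \<beta>))) =
      4 * \<beta> ^ 2 * expectation (\<lambda>\<omega>. W \<omega> * X \<omega> ^ 3) - 4 * (\<kappa> + 1) * \<beta> * expectation (\<lambda>\<omega>. W \<omega> * X \<omega> ^ 1)"
    using i by simp
  \<comment> \<open>The contributions \<open>4 \<kappa>\<close>, \<open>8 \<kappa>\<close> and
    \<open>4 - 8 \<kappa>\<close> to the coefficient of \<open>- \<beta> h X\<close> add up to
    \<open>4 (\<kappa> + 1)\<close>.\<close>
  have e3: "expectation (\<lambda>\<omega>. w \<omega> * (Y \<omega> * exp (- \<beta> * Y \<omega> ^ 2) - X \<omega> * exp (- \<beta> * X \<omega> ^ 2)))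
    - h * expectation (\<lambda>\<omega>. w \<omega> * (X \<omega> * exp (- \<beta> * X \<omega> ^ 2) * (4 * \<beta> ^ 2 * X \<omega> ^ 2 - 4 * (\<kappa> + 1) * \<beta>))) =
    \<beta> ^ 2 / 2 * (16 * \<kappa> * (\<kappa> + 1)) * h ^ 2 * expectation (\<lambda>\<omega>. W \<omega> * X \<omega>) +
    \<beta> ^ 2 / 2 * expectation (\<lambda>\<omega>. W \<omega> * (D \<omega> * \<Delta> \<omega> ^ 2)) -
    \<beta> * (expectation (\<lambda>\<omega>. W \<omega> * D \<omega> ^ 3) - (4 - 8 * \<kappa>) * h * expectation (\<lambda>\<omega>. W \<omega> * X \<omega>)) + expectation r"
    unfolding e1 e2
    using expectation_Delta_square[OF W W1, of 1] expectation_square_difference[OF W W1, of 1]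
      mom1[OF W W1, of 0]
    by (simp add: eval_nat_numeral) (simp add: algebra_simps)
  have b23: "\<beta> ^ 2 \<le> b ^ 3"
    using power_mono[OF \<beta>(2,1), of 2] power_increasing[of 2 3 b] b by simp
  then have b23': "\<bar>\<beta> ^ 2 / 2\<bar> \<le> b ^ 3"
    using zero_le_power2[of \<beta>] by linarith
  have b13: "\<beta> \<le> b ^ 3"
    using \<beta> power_increasing[of 1 3 b] b by simp
  have b1: "\<bar>\<beta> ^ 2 / 2 * (16 * \<kappa> * (\<kappa> + 1)) * h ^ 2 * expectation (\<lambda>\<omega>. W \<omega> * X \<omega>)\<bar> \<le> K * (b ^ 3 * c * q ^ 9)"
  proof -
    have "\<bar>expectation (\<lambda>\<omega>. W \<omega> * X \<omega>)\<bar> \<le> expectation (\<lambda>\<omega>. 1 / 2 * (1 + X \<omega> ^ 2))"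
    proof (rule abs_expectation_le)
      show "\<bar>W \<omega> * X \<omega>\<bar> \<le> 1 / 2 * (1 + X \<omega> ^ 2)" for \<omega>
        using mult_right_mono[OF W1[of \<omega>], of "\<bar>X \<omega>\<bar>"] young_product[of 1 1 "\<bar>X \<omega>\<bar>"]
        by (simp add: abs_mult)
    qed ((rule gr)+, simp, (rule gr)+, simp)
    also have "\<dots> = (1 + expectation (\<lambda>\<omega>. X \<omega> ^ 2)) / 2"
    proof -
      have "integrable M (\<lambda>\<omega>. X \<omega> ^ 2)" by (rule integrable_growth, (rule gr)+, simp)
      then show ?thesis by (simp add: prob_space)
    qed
    also have "\<dots> \<le> K" using K2 K_ge by simp
    finally have "\<bar>\<beta> ^ 2 / 2 * (16 * \<kappa> * (\<kappa> + 1)) * h ^ 2 * expectation (\<lambda>\<omega>. W \<omega> * X \<omega>)\<bar> \<le> b ^ 3 * c * q ^ 16 * K"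
      unfolding abs_mult[of _ "expectation _"] abs_mult[of _ "h ^ 2"] abs_mult[of "\<beta> ^ 2 / 2"]
      using const_simple(1) kappa_nonneg c_pos b
      by (intro mult_mono b23') (auto simp: prob_space h_q simp flip: power_mult)
    also have "\<dots> \<le> b ^ 3 * c * q ^ 9 * K"
      using c_pos b K_ge by (intro mult_right_mono mult_left_mono q_power_le) auto
    finally show ?thesis by (simp add: mult_ac)
  qed
  have b2: "\<bar>\<beta> ^ 2 / 2 * expectation (\<lambda>\<omega>. W \<omega> * (D \<omega> * \<Delta> \<omega> ^ 2))\<bar> \<le> b ^ 3 * c * q ^ 9"
  proof -
    have "\<bar>expectation (\<lambda>\<omega>. W \<omega> * (D \<omega> * \<Delta> \<omega> ^ 2))\<bar> \<le> expectation (\<lambda>\<omega>. \<bar>D \<omega>\<bar> * \<Delta> \<omega> ^ 2)"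
    proof (rule abs_expectation_le)
      show "\<bar>W \<omega> * (D \<omega> * \<Delta> \<omega> ^ 2)\<bar> \<le> \<bar>D \<omega>\<bar> * \<Delta> \<omega> ^ 2" for \<omega>
        using mult_right_mono[OF W1[of \<omega>], of "\<bar>D \<omega>\<bar> * \<Delta> \<omega> ^ 2"] by (simp add: abs_mult)
    qed ((rule gr)+, simp, (rule gr)+, simp)
    also have "\<dots> \<le> c * q ^ 12" by (rule bound_D_Delta2)
    also have "\<dots> \<le> c * q ^ 9" using c_pos by (intro mult_left_mono q_power_le) auto
    finally have "\<bar>\<beta> ^ 2 / 2 * expectation (\<lambda>\<omega>. W \<omega> * (D \<omega> * \<Delta> \<omega> ^ 2))\<bar> \<le> b ^ 3 * (c * q ^ 9)"
      unfolding abs_mult[of "\<beta> ^ 2 / 2"] using b by (intro mult_mono b23') auto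
    then show ?thesis by simp
  qed
  have b3: "\<bar>\<beta> * (expectation (\<lambda>\<omega>. W \<omega> * D \<omega> ^ 3) - (4 - 8 * \<kappa>) * h * expectation (\<lambda>\<omega>. W \<omega> * X \<omega>))\<bar>
      \<le> 11 * (b ^ 3 * c * q ^ 9)"
  proof -
    have "\<bar>\<beta> * (expectation (\<lambda>\<omega>. W \<omega> * D \<omega> ^ 3) - (4 - 8 * \<kappa>) * h * expectation (\<lambda>\<omega>. W \<omega> * X \<omega>))\<bar>
      \<le> b ^ 3 * (11 * c * q ^ 9)"
      unfolding abs_mult[of \<beta>] using expectation_D3[OF W W1] \<beta> b13 b by (intro mult_mono) auto
    then show ?thesis by simp
  qed
  have b4: "\<bar>expectation r\<bar> \<le> b ^ 3 * c * q ^ 9"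
  proof -
    have "\<bar>expectation r\<bar> \<le> expectation (\<lambda>\<omega>. b ^ 3 * (\<bar>Y \<omega>\<bar> * \<bar>\<Delta> \<omega>\<bar> ^ 3))"
      by (rule abs_expectation_le[OF _ _ _ _ r], (rule gr)+, simp, (rule gr)+, simp)
    also have "\<dots> \<le> b ^ 3 * (c * q ^ 12)"
      using bound_Y_Delta3 b by (simp add: mult_left_mono)
    also have "\<dots> \<le> b ^ 3 * (c * q ^ 9)"
      using c_pos b by (intro mult_left_mono q_power_le) auto
    finally show ?thesis by simp
  qed
  \<comment> \<open>The number 13 is 1 + 11 + 1, with 11 from \<open>expectation_D3\<close>;
    \<open>K\<close> comes from bounding \<open>|W X|\<close> by
    \<open>(1 + X ^ 2) / 2\<close>.\<close>
  have "(13 + K) * b ^ 3 * c * q ^ 9 =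
      K * (b ^ 3 * c * q ^ 9) + b ^ 3 * c * q ^ 9 + 11 * (b ^ 3 * c * q ^ 9) + b ^ 3 * c * q ^ 9"
    by (simp add: algebra_simps)
  then show ?thesis unfolding e3 using b1 b2 b3 b4 by linarith
qed

lemma heat_step:
  assumes "w \<in> borel_measurable F" "\<And>\<omega>. \<bar>w \<omega>\<bar> \<le> 1"
    and "0 \<le> \<beta>" "\<beta> \<le> b" and "1 \<le> b" and e: "e = 0 \<or> e = 1"
  shows "\<bar>expectation (\<lambda>\<omega>. w \<omega> * (Y \<omega> ^ e * exp (- \<beta> * Y \<omega> ^ 2) - X \<omega> ^ e * exp (- \<beta> * X \<omega> ^ 2)))
    - h * expectation (\<lambda>\<omega>. w \<omega> * (X \<omega> ^ e * exp (- \<beta> * X \<omega> ^ 2) * (4 * \<beta> ^ 2 * X \<omega> ^ 2 - 4 * (\<kappa> + real e) * \<beta>)))\<bar>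
    \<le> (13 + K) * b ^ 3 * c * q ^ 9"
  using heat_step_even[OF assms(1-5)] heat_step_odd[OF assms(1-5)] e by auto

end

section \<open>Martingales from solutions of the heat equation\<close>

text \<open>
  With \<open>\<rho> = \<tau> - t\<close> these functions solve the backward Dunkl heat equation up to time \<open>\<tau>\<close>.
\<close>

definition heat_solution :: "real \<Rightarrow> nat \<Rightarrow> real \<Rightarrow> real \<Rightarrow> real" where
  "heat_solution \<kappa> e \<rho> x = x ^ e * (\<rho> powr (- (\<kappa> + real e)) * exp (- (x ^ 2) / (4 * \<rho>)))"

text \<open>The linear coefficient is the derivative in \<open>\<rho>\<close>. For
  \<open>z = x ^ 2\<close> and \<open>A = \<kappa> + e\<close> it is the multiplier of the Dunkl
  Laplacian in \<open>heat_step\<close>, which is the heat equation. The second derivative is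
  controlled uniformly for all parameters above \<open>1 / (4 b)\<close>.\<close>

lemma gaussian_time_taylor:
  fixes A b z :: real
  assumes A: "A \<ge> 0" and z: "z \<ge> 0" and b1: "b \<ge> 1" and \<rho>: "1 / (4 * b) \<le> \<rho>" and h: "h > 0"
  defines "\<beta> \<equiv> 1 / (4 * \<rho>)"
  shows "\<bar>(\<rho> + h) powr (- A) * exp (- z / (4 * (\<rho> + h))) - \<rho> powr (- A) * exp (- z / (4 * \<rho>))
     - h * (\<rho> powr (- A) * exp (- z / (4 * \<rho>)) * (4 * \<beta> ^ 2 * z - 4 * A * \<beta>))\<bar>
     \<le> (1 / (4 * b)) powr (- A) * (8 * b ^ 4 * (A + 1) ^ 2) * (1 + z) ^ 2 * h ^ 2"
proof -
  define f where "f = (\<lambda>r. r powr (- A) * exp (- z / (4 * r)))"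
  define f' where "f' = (\<lambda>r. f r * (z / (4 * r ^ 2) - A / r))"
  define f'' where "f'' = (\<lambda>r. f r * ((z / (4 * r ^ 2) - A / r) ^ 2 + A / r ^ 2 - z / (2 * r ^ 3)))"
  have b: "b > 0" using b1 by simp
  have \<rho>0: "\<rho> > 0" using \<rho> b by (smt (verit) divide_pos_pos)
  have d1: "(f has_real_derivative f' r) (at r)" if "r > 0" for r
    unfolding f_def f'_def using that
    by (auto intro!: derivative_eq_intros simp: powr_diff field_simps power2_eq_square)
  have d2: "(f' has_real_derivative f'' r) (at r)" if "r > 0" for r
  proof -
    have g: "((\<lambda>r. z / (4 * r ^ 2) - A / r) has_real_derivative (A / r ^ 2 - z / (2 * r ^ 3))) (at r)"
      using that by (auto intro!: derivative_eq_intros simp: field_simps eval_nat_numeral)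
    show ?thesis unfolding f'_def f''_def
      by (rule DERIV_cong[OF DERIV_mult[OF d1[OF that] g]])
        (simp add: f'_def power2_eq_square algebra_simps)
  qed
  define diff where "diff = (\<lambda>m. if m = (0::nat) then f else if m = 1 then f' else f'')"
  have "\<exists>t. (if \<rho> + h < \<rho> then \<rho> + h < t \<and> t < \<rho> else \<rho> < t \<and> t < \<rho> + h) \<and>
      f (\<rho> + h) = (\<Sum>m<2. diff m \<rho> / fact m * (\<rho> + h - \<rho>) ^ m) + diff 2 t / fact 2 * (\<rho> + h - \<rho>) ^ 2"
  proof (rule Taylor[where a = \<rho> and b = "\<rho> + h"])
    show "\<forall>m t. m < 2 \<and> \<rho> \<le> t \<and> t \<le> \<rho> + h \<longrightarrow> (diff m has_real_derivative diff (Suc m) t) (at t)"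
    proof (intro allI impI)
      fix m :: nat and t assume "m < 2 \<and> \<rho> \<le> t \<and> t \<le> \<rho> + h"
      then have "m = 0 \<or> m = 1" "t > 0" using \<rho>0 by auto
      then show "(diff m has_real_derivative diff (Suc m) t) (at t)"
        using d1 d2 by (auto simp: diff_def)
    qed
  qed (use h in \<open>auto simp: diff_def\<close>)
  then obtain t where t: "\<rho> < t" and eq: "f (\<rho> + h) = f \<rho> + f' \<rho> * h + f'' t / 2 * h ^ 2"
    using h by (auto simp: diff_def eval_nat_numeral)
  \<comment> \<open>In terms of \<open>1 / (4 t)\<close> the second derivative is \<open>f t\<close>
    times a polynomial, and \<open>t > \<rho>\<close> puts \<open>\<gamma>\<close> between 0 and
    \<open>b\<close>.\<close>
  define \<gamma> where "\<gamma> = 1 / (4 * t)"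
  have t0: "t > 0" using t \<rho>0 by simp
  have \<gamma>: "0 < \<gamma>" "\<gamma> \<le> b"
  proof -
    show "0 < \<gamma>" using t0 by (simp add: \<gamma>_def)
    have "1 / (4 * b) \<le> t" using \<rho> t by simp
    then show "\<gamma> \<le> b" using b t0 by (simp add: \<gamma>_def field_simps)
  qed
  have "f'' t = f t * ((4 * \<gamma> ^ 2 * z - 4 * A * \<gamma>) ^ 2 + 16 * A * \<gamma> ^ 2 - 32 * \<gamma> ^ 3 * z)"
    using t0 by (simp add: f''_def \<gamma>_def field_simps eval_nat_numeral)
  moreover have "\<bar>(4 * \<gamma> ^ 2 * z - 4 * A * \<gamma>) ^ 2 + 16 * A * \<gamma> ^ 2 - 32 * \<gamma> ^ 3 * z\<bar>
      \<le> 16 * b ^ 4 * (A + 1) ^ 2 * (1 + z) ^ 2"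
  proof -
    have g2: "\<gamma> ^ 2 \<le> b ^ 2" using \<gamma> by (simp add: power_mono)
    have g3: "\<gamma> ^ 3 \<le> b ^ 3" using \<gamma> by (simp add: power_mono)
    have p: "b \<le> b ^ 2" "b ^ 2 \<le> b ^ 4" "b ^ 3 \<le> b ^ 4"
      using power_increasing[of 1 2 b] b1 by (simp_all add: power_increasing)
    have "\<bar>4 * \<gamma> ^ 2 * z - 4 * A * \<gamma>\<bar> \<le> 4 * b ^ 2 * (z + A)"
    proof -
      have "\<gamma> ^ 2 * z \<le> b ^ 2 * z" "\<gamma> ^ 2 * z \<ge> 0" using g2 z by (simp_all add: mult_right_mono)
      moreover have "\<gamma> * A \<le> b ^ 2 * A" "\<gamma> * A \<ge> 0"
        using \<gamma> p A by (simp_all add: mult_right_mono)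
      ultimately show ?thesis by (simp add: algebra_simps abs_le_iff)
    qed
    then have "(4 * \<gamma> ^ 2 * z - 4 * A * \<gamma>) ^ 2 \<le> (4 * b ^ 2 * (z + A)) ^ 2"
      using A z by (subst abs_le_square_iff[symmetric]) auto
    also have "\<dots> = 16 * b ^ 4 * (z + A) ^ 2" by (simp add: power_mult_distrib flip: power_mult)
    finally have 1: "(4 * \<gamma> ^ 2 * z - 4 * A * \<gamma>) ^ 2 \<le> 16 * b ^ 4 * (z + A) ^ 2" .
    have 2: "A * \<gamma> ^ 2 \<le> b ^ 4 * A" "0 \<le> A * \<gamma> ^ 2"
      using mult_right_mono[of "\<gamma> ^ 2" "b ^ 4" A] g2 p A by (simp_all add: mult_ac)
    have 3: "\<gamma> ^ 3 * z \<le> b ^ 4 * z" "0 \<le> \<gamma> ^ 3 * z"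
      using mult_right_mono[of "\<gamma> ^ 3" "b ^ 4" z] g3 p z \<gamma> by simp_all
    have "\<bar>(4 * \<gamma> ^ 2 * z - 4 * A * \<gamma>) ^ 2 + 16 * A * \<gamma> ^ 2 - 32 * \<gamma> ^ 3 * z\<bar>
        \<le> 16 * b ^ 4 * (z + A) ^ 2 + 32 * (b ^ 4 * A) + 32 * (b ^ 4 * z)"
      using 1 2 3 zero_le_power2[of "4 * \<gamma> ^ 2 * z - 4 * A * \<gamma>"] by linarith
    also have "\<dots> \<le> 16 * b ^ 4 * (z + A + 1) ^ 2"
      using b by (simp add: algebra_simps power2_eq_square)
    also have "\<dots> \<le> 16 * b ^ 4 * ((A + 1) * (1 + z)) ^ 2"
      using A z b by (intro mult_left_mono power_mono) (auto simp: algebra_simps)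
    finally show ?thesis by (simp add: power_mult_distrib)
  qed
  moreover have "0 \<le> f t" "f t \<le> (1 / (4 * b)) powr (- A)"
  proof -
    show "0 \<le> f t" by (simp add: f_def)
    have "t powr (- A) * exp (- z / (4 * t)) \<le> (1 / (4 * b)) powr (- A) * 1"
      using \<rho> t t0 b A z by (intro mult_mono powr_mono2') auto
    then show "f t \<le> (1 / (4 * b)) powr (- A)" by (simp add: f_def)
  qed
  ultimately have f'': "\<bar>f'' t\<bar> \<le> (1 / (4 * b)) powr (- A) * (16 * b ^ 4 * (A + 1) ^ 2 * (1 + z) ^ 2)"
    unfolding abs_mult by (simp only: abs_mult) (intro mult_mono, auto)
  have \<beta>: "f' \<rho> = \<rho> powr (- A) * exp (- z / (4 * \<rho>)) * (4 * \<beta> ^ 2 * z - 4 * A * \<beta>)"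
    using \<rho>0 by (simp add: f'_def f_def \<beta>_def field_simps power2_eq_square)
  have "(\<rho> + h) powr (- A) * exp (- z / (4 * (\<rho> + h))) - \<rho> powr (- A) * exp (- z / (4 * \<rho>))
     - h * (\<rho> powr (- A) * exp (- z / (4 * \<rho>)) * (4 * \<beta> ^ 2 * z - 4 * A * \<beta>)) = f'' t * (h ^ 2 / 2)"
    using eq unfolding \<beta>[symmetric] by (simp add: f_def)
  then have "\<bar>(\<rho> + h) powr (- A) * exp (- z / (4 * (\<rho> + h))) - \<rho> powr (- A) * exp (- z / (4 * \<rho>))
     - h * (\<rho> powr (- A) * exp (- z / (4 * \<rho>)) * (4 * \<beta> ^ 2 * z - 4 * A * \<beta>))\<bar> = \<bar>f'' t\<bar> * (h ^ 2 / 2)"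
    by (simp only: abs_mult) simp
  also have "\<dots> \<le> (1 / (4 * b)) powr (- A) * (16 * b ^ 4 * (A + 1) ^ 2 * (1 + z) ^ 2) * (h ^ 2 / 2)"
    using f'' by (intro mult_right_mono) auto
  finally show ?thesis by (simp add: mult_ac)
qed

text \<open>The modulus has exponent 9/8, so difference quotients are bounded by a multiple of the
  eighth root of \<open>|y - x|\<close> and the derivative vanishes. The restriction to steps of
  length at most 1 is harmless for a local notion.\<close>

lemma constant_of_superlinear_modulus:
  fixes g :: "real \<Rightarrow> real"
  assumes ab: "a \<le> b" and C: "C \<ge> 0"
    and g: "\<And>x y. a \<le> x \<Longrightarrow> x < y \<Longrightarrow> y \<le> b \<Longrightarrow> y - x \<le> 1 \<Longrightarrow> \<bar>g y - g x\<bar> \<le> C * root 8 (y - x) ^ 9"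
  shows "g a = g b"
proof -
  have "(g has_real_derivative 0) (at x within {a..b})" if x: "x \<in> {a..b}" for x
    unfolding has_field_derivative_iff
  proof (rule Lim_null_comparison)
    show "\<forall>\<^sub>F y in at x within {a..b}. norm ((g y - g x) / (y - x)) \<le> C * root 8 \<bar>y - x\<bar>"
      unfolding eventually_at
    proof (intro exI[of _ 1] conjI ballI impI)
      fix y assume y: "y \<in> {a..b}" "y \<noteq> x \<and> dist y x < 1"
      have *: "\<bar>g y - g x\<bar> \<le> C * root 8 \<bar>y - x\<bar> ^ 9"
      proof (cases "x < y")
        case True then show ?thesis using g[of x y] x y by (simp add: dist_real_def)
      next
        case False then show ?thesis using g[of y x] x y by (simp add: dist_real_def abs_minus_commute)
      qed
      have "root 8 \<bar>y - x\<bar> ^ 9 = root 8 \<bar>y - x\<bar> * \<bar>y - x\<bar>"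
        using real_root_pow_pos2[of 8 "\<bar>y - x\<bar>"] by (simp add: eval_nat_numeral)
      then show "norm ((g y - g x) / (y - x)) \<le> C * root 8 \<bar>y - x\<bar>"
        using * y by (simp add: abs_divide field_simps)
    qed simp
    have "((\<lambda>y. C * root 8 \<bar>y - x\<bar>) \<longlongrightarrow> C * root 8 \<bar>x - x\<bar>) (at x within {a..b})"
      by (intro tendsto_intros)
    then show "((\<lambda>y. C * root 8 \<bar>y - x\<bar>) \<longlongrightarrow> 0) (at x within {a..b})" by simp
  qed
  then have "\<exists>c. \<forall>x\<in>{a..b}. g x = c"
    by (intro has_field_derivative_zero_constant) auto
  then show ?thesis using ab by auto
qed

section \<open>Conditional moments along the process\<close>

context dunkl_martingales
begin

lemma filtration_mono:
  assumes "s \<le> t" "w \<in> borel_measurable (F s)"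
  shows "w \<in> borel_measurable (F t)"
proof -
  have "subalgebra (F t) (F s)"
    using assms(1) unfolding subalgebra_def natural_filtration_def
    by (auto simp: space_measure_of_conv sets_measure_of_conv intro!: sigma_sets_mono')
      (metis order_trans)
  then show ?thesis using assms(2) by (rule measurable_from_subalg)
qed

lemma eighth_moments_increment:
  assumes "0 \<le> s" "s \<le> t"
  shows "eighth_moments M (F s) (X s) (X t)"
  using assms subalgebra_filtration X_measurable_filtration X_measurable integrable_power_8
  by unfold_locales auto

context
  fixes s t :: real and w :: "'a \<Rightarrow> real" and B :: real and m :: "nat \<Rightarrow> real" and E :: "nat \<Rightarrow> nat \<Rightarrow> real"
  assumes st: "0 \<le> s" "s \<le> t"
    and w: "w \<in> borel_measurable (F s)" and B: "\<And>\<omega>. \<bar>w \<omega>\<bar> \<le> B"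
  defines "m \<equiv> \<lambda>i. expectation (\<lambda>\<omega>. w \<omega> * X s \<omega> ^ i)"
    and "E \<equiv> \<lambda>i j. expectation (\<lambda>\<omega>. w \<omega> * (X s \<omega> ^ i * X t \<omega> ^ j))"
begin

interpretation eighth_moments M "F s" "X s" "X t"
  by (rule eighth_moments_increment[OF st])

text \<open>Testing the martingale with \<open>w * X s ^ i\<close> relates moments at time
  \<open>t\<close> linearly to moments at time \<open>s\<close>. The relations are triangular in
  \<open>n\<close>, and back substitution in the lemmas below leaves only powers of
  \<open>t - s\<close>.\<close>

lemma heat_poly_moments:
  assumes n: "n \<in> {1, 2, 3, 4}" and i: "i + 2 * n \<le> 8"
  shows "(\<Sum>j\<le>n. real (n choose j) * (- 4 * t) ^ j * pochhammer (\<kappa> + real (n - j)) j * E i (2 * (n - j))) =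
         (\<Sum>j\<le>n. real (n choose j) * (- 4 * s) ^ j * pochhammer (\<kappa> + real (n - j)) j * m (i + 2 * (n - j)))"
proof -
  note int = integrable_monomial[OF growth_weight[OF w B]]
  have W: "(\<lambda>\<omega>. w \<omega> * X s \<omega> ^ i) \<in> borel_measurable (F s)"
    using w X_F by measurable
  have ex: "w \<omega> * X s \<omega> ^ i * heat_poly \<kappa> n u x =
      (\<Sum>j\<le>n. real (n choose j) * (- 4 * u) ^ j * pochhammer (\<kappa> + real (n - j)) j *
        (w \<omega> * (X s \<omega> ^ i * x ^ (2 * (n - j)))))" for \<omega> u x
    by (simp add: heat_poly_def sum_distrib_left mult_ac)
  have int1: "integrable M (\<lambda>\<omega>. w \<omega> * (X s \<omega> ^ i * X t \<omega> ^ (2 * (n - j))))" for j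
    using i by (intro int) auto
  have int2: "integrable M (\<lambda>\<omega>. w \<omega> * (X s \<omega> ^ i * X s \<omega> ^ (2 * (n - j))))" for j
    using int(2)[of i "2 * (n - j)"] i by (simp add: power_add)
  have "integrable M (\<lambda>\<omega>. w \<omega> * X s \<omega> ^ i * heat_poly \<kappa> n t (X t \<omega>))"
    unfolding ex using int1 by simp
  from expectation_heat_poly[OF n st W this] show ?thesis
    unfolding ex m_def E_def
    by (simp only: Bochner_Integration.integral_sum integrable_mult_right int1 int2 integral_mult_right_zero power_add)
qed

lemma moment_0: "E i 0 = m i"
  by (simp add: E_def m_def)

lemma moment_1:
  assumes i: "i + 1 \<le> 8"
  shows "E i 1 = m (i + 1)"
proof -
  have W: "(\<lambda>\<omega>. w \<omega> * X s \<omega> ^ i) \<in> borel_measurable (F s)"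
    using w X_F by measurable
  have R: "w \<omega> * X s \<omega> ^ i * dunkl_appell k 1 u x = 1 / (2 * \<kappa>) * (w \<omega> * (X s \<omega> ^ i * x ^ 1))" for \<omega> u x
    unfolding dunkl_appell_1[OF k_nonneg] by (simp add: kappa algebra_simps)
  have "integrable M (\<lambda>\<omega>. w \<omega> * (X s \<omega> ^ i * X t \<omega> ^ 1))"
    by (rule integrable_monomial[OF growth_weight[OF w B] i])
  then have int: "integrable M (\<lambda>\<omega>. w \<omega> * X s \<omega> ^ i * dunkl_appell k 1 t (X t \<omega>))"
    unfolding R by simp
  have "1 / (2 * \<kappa>) * E i 1 = 1 / (2 * \<kappa>) * m (i + 1)"
    using expectation_martingale[OF _ st W int] unfolding R E_def m_def
    by (simp del: mult_cancel_left add: mult_ac)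
  then show ?thesis using kappa_pos by simp
qed

lemma moment_2:
  assumes "i + 2 \<le> 8"
  shows "E i 2 = m (i + 2) + 4 * \<kappa> * (t - s) * m i"
  using heat_poly_moments[of 1 i] assms moment_0[of i]
  by (simp add: algebra_simps del: add_2_eq_Suc')

lemma moment_4:
  assumes "i + 4 \<le> 8"
  shows "E i 4 = m (i + 4) + 8 * (\<kappa> + 1) * (t - s) * m (i + 2) + 16 * \<kappa> * (\<kappa> + 1) * (t - s) ^ 2 * m i"
proof -
  have "E i 4 = m (i + 4) - 8 * (\<kappa> + 1) * s * m (i + 2) + 16 * \<kappa> * (\<kappa> + 1) * s ^ 2 * m i
     + 8 * (\<kappa> + 1) * t * E i 2 - 16 * \<kappa> * (\<kappa> + 1) * t ^ 2 * E i 0"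
    using heat_poly_moments[of 2 i] assms
    by (simp add: atMost_nat_numeral eval_nat_numeral pochhammer_Suc) (simp add: algebra_simps)
  then show ?thesis
    using moment_2[of i] moment_0[of i] assms
    by (simp only:) (simp add: algebra_simps power2_eq_square)
qed

lemma moment_6:
  assumes "i + 6 \<le> 8"
  shows "E i 6 = m (i + 6) + 12 * (\<kappa> + 2) * (t - s) * m (i + 4)
    + 48 * (\<kappa> + 1) * (\<kappa> + 2) * (t - s) ^ 2 * m (i + 2) + 64 * \<kappa> * (\<kappa> + 1) * (\<kappa> + 2) * (t - s) ^ 3 * m i"
proof -
  have "E i 6 = m (i + 6) - 12 * (\<kappa> + 2) * s * m (i + 4) + 48 * (\<kappa> + 1) * (\<kappa> + 2) * s ^ 2 * m (i + 2)
     - 64 * \<kappa> * (\<kappa> + 1) * (\<kappa> + 2) * s ^ 3 * m i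
     + 12 * (\<kappa> + 2) * t * E i 4 - 48 * (\<kappa> + 1) * (\<kappa> + 2) * t ^ 2 * E i 2
     + 64 * \<kappa> * (\<kappa> + 1) * (\<kappa> + 2) * t ^ 3 * E i 0"
    using heat_poly_moments[of 3 i] assms
    by (simp add: atMost_nat_numeral eval_nat_numeral pochhammer_Suc) (simp add: algebra_simps)
  then show ?thesis
    using moment_4[of i] moment_2[of i] moment_0[of i] assms
    by (simp only:) (simp add: algebra_simps eval_nat_numeral)
qed

lemma moment_8:
  "E 0 8 = m 8 + 16 * (\<kappa> + 3) * (t - s) * m 6 + 96 * (\<kappa> + 2) * (\<kappa> + 3) * (t - s) ^ 2 * m 4
    + 256 * (\<kappa> + 1) * (\<kappa> + 2) * (\<kappa> + 3) * (t - s) ^ 3 * m 2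
    + 256 * \<kappa> * (\<kappa> + 1) * (\<kappa> + 2) * (\<kappa> + 3) * (t - s) ^ 4 * m 0"
proof -
  have "E 0 8 = m 8 - 16 * (\<kappa> + 3) * s * m 6 + 96 * (\<kappa> + 2) * (\<kappa> + 3) * s ^ 2 * m 4
     - 256 * (\<kappa> + 1) * (\<kappa> + 2) * (\<kappa> + 3) * s ^ 3 * m 2
     + 256 * \<kappa> * (\<kappa> + 1) * (\<kappa> + 2) * (\<kappa> + 3) * s ^ 4 * m 0
     + 16 * (\<kappa> + 3) * t * E 0 6 - 96 * (\<kappa> + 2) * (\<kappa> + 3) * t ^ 2 * E 0 4
     + 256 * (\<kappa> + 1) * (\<kappa> + 2) * (\<kappa> + 3) * t ^ 3 * E 0 2
     - 256 * \<kappa> * (\<kappa> + 1) * (\<kappa> + 2) * (\<kappa> + 3) * t ^ 4 * E 0 0"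
    using heat_poly_moments[of 4 0]
    by (simp add: atMost_nat_numeral eval_nat_numeral pochhammer_Suc) (simp add: algebra_simps)
  then show ?thesis
    using moment_6[of 0] moment_4[of 0] moment_2[of 0] moment_0[of 0]
    by simp (simp add: algebra_simps eval_nat_numeral)
qed

end

lemma dunkl_increment:
  assumes st: "0 \<le> s" "s \<le> t"
  shows "dunkl_increment M (F s) (X s) (X t) \<kappa> (t - s)"
proof -
  interpret eighth_moments M "F s" "X s" "X t"
    by (rule eighth_moments_increment[OF st])
  show ?thesis
  proof
    show "\<kappa> \<ge> 0" "t - s \<ge> 0" using kappa_pos st by simp_all
  next
    fix w :: "'a \<Rightarrow> real" and B and i :: nat
    assume "w \<in> borel_measurable (F s)" "\<And>\<omega>. \<bar>w \<omega>\<bar> \<le> B" "i + 1 \<le> 8"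
    then show "expectation (\<lambda>\<omega>. w \<omega> * (X s \<omega> ^ i * X t \<omega> ^ 1)) = expectation (\<lambda>\<omega>. w \<omega> * X s \<omega> ^ (i + 1))"
      by (rule moment_1[OF st])
  next
    fix w :: "'a \<Rightarrow> real" and B and i :: nat
    assume "w \<in> borel_measurable (F s)" "\<And>\<omega>. \<bar>w \<omega>\<bar> \<le> B" "i + 2 \<le> 8"
    then show "expectation (\<lambda>\<omega>. w \<omega> * (X s \<omega> ^ i * X t \<omega> ^ 2)) =
        expectation (\<lambda>\<omega>. w \<omega> * X s \<omega> ^ (i + 2)) + 4 * \<kappa> * (t - s) * expectation (\<lambda>\<omega>. w \<omega> * X s \<omega> ^ i)"
      by (rule moment_2[OF st])
  next
    fix w :: "'a \<Rightarrow> real" and B and i :: nat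
    assume "w \<in> borel_measurable (F s)" "\<And>\<omega>. \<bar>w \<omega>\<bar> \<le> B" "i + 4 \<le> 8"
    then show "expectation (\<lambda>\<omega>. w \<omega> * (X s \<omega> ^ i * X t \<omega> ^ 4)) =
        expectation (\<lambda>\<omega>. w \<omega> * X s \<omega> ^ (i + 4)) +
        8 * (\<kappa> + 1) * (t - s) * expectation (\<lambda>\<omega>. w \<omega> * X s \<omega> ^ (i + 2)) +
        16 * \<kappa> * (\<kappa> + 1) * (t - s) ^ 2 * expectation (\<lambda>\<omega>. w \<omega> * X s \<omega> ^ i)"
      by (rule moment_4[OF st])
  next
    fix w :: "'a \<Rightarrow> real" and B and i :: nat
    assume "w \<in> borel_measurable (F s)" "\<And>\<omega>. \<bar>w \<omega>\<bar> \<le> B" "i + 6 \<le> 8"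
    then show "expectation (\<lambda>\<omega>. w \<omega> * (X s \<omega> ^ i * X t \<omega> ^ 6)) =
        expectation (\<lambda>\<omega>. w \<omega> * X s \<omega> ^ (i + 6)) +
        12 * (\<kappa> + 2) * (t - s) * expectation (\<lambda>\<omega>. w \<omega> * X s \<omega> ^ (i + 4)) +
        48 * (\<kappa> + 1) * (\<kappa> + 2) * (t - s) ^ 2 * expectation (\<lambda>\<omega>. w \<omega> * X s \<omega> ^ (i + 2)) +
        64 * \<kappa> * (\<kappa> + 1) * (\<kappa> + 2) * (t - s) ^ 3 * expectation (\<lambda>\<omega>. w \<omega> * X s \<omega> ^ i)"
      by (rule moment_6[OF st])
  next
    show "expectation (\<lambda>\<omega>. X t \<omega> ^ 8) =
        expectation (\<lambda>\<omega>. X s \<omega> ^ 8) +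
        16 * (\<kappa> + 3) * (t - s) * expectation (\<lambda>\<omega>. X s \<omega> ^ 6) +
        96 * (\<kappa> + 2) * (\<kappa> + 3) * (t - s) ^ 2 * expectation (\<lambda>\<omega>. X s \<omega> ^ 4) +
        256 * (\<kappa> + 1) * (\<kappa> + 2) * (\<kappa> + 3) * (t - s) ^ 3 * expectation (\<lambda>\<omega>. X s \<omega> ^ 2) +
        256 * \<kappa> * (\<kappa> + 1) * (\<kappa> + 2) * (\<kappa> + 3) * (t - s) ^ 4"
      using moment_8[OF st, of "\<lambda>_. 1" 1] by (simp add: prob_space)
  qed
qed

end

section \<open>Gaussian heat solutions along the process\<close>

context dunkl_martingales
begin

text \<open>Computed from time 0, the moments are polynomials in \<open>r\<close> with nonnegative
  coefficients, so their values at \<open>T\<close> dominate. The sixth moment pays for the error of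
  the expansion in time.\<close>

lemma moment_bound:
  assumes "T \<ge> 0"
  obtains K where "K \<ge> 1" "\<And>r. 0 \<le> r \<Longrightarrow> r \<le> T \<Longrightarrow> expectation (\<lambda>\<omega>. X r \<omega> ^ 2) \<le> K"
    "\<And>r. 0 \<le> r \<Longrightarrow> r \<le> T \<Longrightarrow> expectation (\<lambda>\<omega>. X r \<omega> ^ 4) \<le> K"
    "\<And>r. 0 \<le> r \<Longrightarrow> r \<le> T \<Longrightarrow> expectation (\<lambda>\<omega>. X r \<omega> ^ 6) \<le> K"
proof -
  define m where "m = (\<lambda>i. expectation (\<lambda>\<omega>. X 0 \<omega> ^ i))"
  have m: "m 2 \<ge> 0" "m 4 \<ge> 0" "m 6 \<ge> 0"
    by (simp_all add: m_def)
  define K2 where "K2 = m 2 + 4 * \<kappa> * T"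
  define K4 where "K4 = m 4 + 8 * (\<kappa> + 1) * T * m 2 + 16 * \<kappa> * (\<kappa> + 1) * T ^ 2"
  define K6 where "K6 = m 6 + 12 * (\<kappa> + 2) * T * m 4 + 48 * (\<kappa> + 1) * (\<kappa> + 2) * T ^ 2 * m 2
    + 64 * \<kappa> * (\<kappa> + 1) * (\<kappa> + 2) * T ^ 3"
  have nn: "K2 \<ge> 0" "K4 \<ge> 0" "K6 \<ge> 0"
    using m kappa_pos assms by (simp_all add: K2_def K4_def K6_def)
  have le: "expectation (\<lambda>\<omega>. X r \<omega> ^ 2) \<le> K2" "expectation (\<lambda>\<omega>. X r \<omega> ^ 4) \<le> K4"
    "expectation (\<lambda>\<omega>. X r \<omega> ^ 6) \<le> K6" if r: "0 \<le> r" "r \<le> T" for r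
  proof -
    interpret dunkl_increment M "F 0" "X 0" "X r" \<kappa> "r - 0"
      by (rule dunkl_increment) (use r in auto)
    have p: "r ^ n \<le> T ^ n" for n using r by (simp add: power_mono)
    show "expectation (\<lambda>\<omega>. X r \<omega> ^ 2) \<le> K2"
      using mom2[of "\<lambda>_. 1" 1 0] kappa_pos r
      by (simp add: prob_space K2_def m_def power2_eq_square)
    have "expectation (\<lambda>\<omega>. X r \<omega> ^ 4) = m 4 + 8 * (\<kappa> + 1) * r * m 2 + 16 * \<kappa> * (\<kappa> + 1) * r ^ 2"
      using mom4[of "\<lambda>_. 1" 1 0] by (simp add: prob_space m_def power2_eq_square)
    also have "\<dots> \<le> K4"
      unfolding K4_def using p[of 2] kappa_pos r m
      by (intro add_mono mult_left_mono mult_right_mono) auto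
    finally show "expectation (\<lambda>\<omega>. X r \<omega> ^ 4) \<le> K4" .
    have "expectation (\<lambda>\<omega>. X r \<omega> ^ 6) = m 6 + 12 * (\<kappa> + 2) * r * m 4
        + 48 * (\<kappa> + 1) * (\<kappa> + 2) * r ^ 2 * m 2 + 64 * \<kappa> * (\<kappa> + 1) * (\<kappa> + 2) * r ^ 3"
      using mom6[of "\<lambda>_. 1" 1 0] by (simp add: prob_space m_def power2_eq_square)
    also have "\<dots> \<le> K6"
      unfolding K6_def using p[of 2] p[of 3] kappa_pos r m
      by (intro add_mono mult_left_mono mult_right_mono) auto
    finally show "expectation (\<lambda>\<omega>. X r \<omega> ^ 6) \<le> K6" .
  qed
  show ?thesis
  proof (rule that[of "1 + K2 + K4 + K6"])
    fix r assume "0 \<le> r" "r \<le> T"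
    from le[OF this] nn show "expectation (\<lambda>\<omega>. X r \<omega> ^ 2) \<le> 1 + K2 + K4 + K6"
      "expectation (\<lambda>\<omega>. X r \<omega> ^ 4) \<le> 1 + K2 + K4 + K6"
      "expectation (\<lambda>\<omega>. X r \<omega> ^ 6) \<le> 1 + K2 + K4 + K6" by linarith+
  qed (use nn in simp)
qed

text \<open>The step is split at the point \<open>(\<tau> - t, X s)\<close>: moving from
  \<open>X s\<close> to \<open>X t\<close> with \<open>\<rho> = \<tau> - t\<close> frozen is
  \<open>heat_step\<close>, moving from \<open>\<rho>\<close> to \<open>\<rho> + h\<close> with
  \<open>X s\<close> frozen is \<open>gaussian_time_taylor\<close>. Their terms linear in
  \<open>h\<close> cancel.\<close>

lemma heat_solution_step:
  assumes st: "0 \<le> s" "s < t" "t - s \<le> 1"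
    and K: "K \<ge> 1" "expectation (\<lambda>\<omega>. X s \<omega> ^ 2) \<le> K" "expectation (\<lambda>\<omega>. X s \<omega> ^ 4) \<le> K"
      "expectation (\<lambda>\<omega>. X s \<omega> ^ 6) \<le> K"
    and w: "w \<in> borel_measurable (F s)" and w1: "\<And>\<omega>. \<bar>w \<omega>\<bar> \<le> 1" and e: "e = 0 \<or> e = (1::nat)"
    and b: "b \<ge> 1" "1 / (4 * b) \<le> \<tau> - t"
  shows "\<bar>expectation (\<lambda>\<omega>. w \<omega> * heat_solution \<kappa> e (\<tau> - t) (X t \<omega>))
      - expectation (\<lambda>\<omega>. w \<omega> * heat_solution \<kappa> e (\<tau> - s) (X s \<omega>))\<bar>
    \<le> (1 / (4 * b)) powr (- (\<kappa> + real e)) *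
      ((13 + K) * b ^ 3 * increment_const \<kappa> K + 32 * b ^ 4 * (\<kappa> + real e + 1) ^ 2 * (1 + K))
      * root 8 (t - s) ^ 9"
proof -
  define A where "A = \<kappa> + real e"
  define \<rho> where "\<rho> = \<tau> - t"
  define h where "h = t - s"
  define q where "q = root 8 h"
  define P where "P = (1 / (4 * b)) powr (- A)"
  have h: "0 < h" "h \<le> 1" and \<rho>h: "\<tau> - s = \<rho> + h" using st by (simp_all add: h_def \<rho>_def)
  have q: "0 < q" "q \<le> 1" "h = q ^ 8" using h by (simp_all add: q_def)
  have \<rho>: "\<rho> > 0" using b unfolding \<rho>_def by (smt (verit) divide_pos_pos)
  have A: "A \<ge> 0" using kappa_pos by (simp add: A_def)
  interpret dunkl_increment M "F s" "X s" "X t" \<kappa> h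
    unfolding h_def by (rule dunkl_increment) (use st in auto)
  interpret dunkl_small_increment M "F s" "X s" "X t" \<kappa> h q K
    by unfold_locales (use q K in auto)
  define \<beta> where "\<beta> = 1 / (4 * \<rho>)"
  have \<beta>: "0 \<le> \<beta>" "\<beta> \<le> b"
  proof -
    show "0 \<le> \<beta>" using \<rho> by (simp add: \<beta>_def)
    show "\<beta> \<le> b" using b \<rho> unfolding \<rho>_def[symmetric] by (simp add: \<beta>_def field_simps)
  qed
  have P: "0 \<le> \<rho> powr (- A)" "\<rho> powr (- A) \<le> P" "0 \<le> P"
    using b \<rho> A unfolding P_def \<rho>_def[symmetric] by (auto intro!: powr_mono2')
  define T1 where "T1 = (\<lambda>\<omega>. w \<omega> * (X t \<omega> ^ e * exp (- \<beta> * X t \<omega> ^ 2) - X s \<omega> ^ e * exp (- \<beta> * X s \<omega> ^ 2)))"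
  define T2 where "T2 = (\<lambda>\<omega>. w \<omega> * (X s \<omega> ^ e * exp (- \<beta> * X s \<omega> ^ 2) * (4 * \<beta> ^ 2 * X s \<omega> ^ 2 - 4 * A * \<beta>)))"
  define R where "R = (\<lambda>\<omega>. w \<omega> * (X s \<omega> ^ e *
    ((\<rho> + h) powr (- A) * exp (- (X s \<omega> ^ 2) / (4 * (\<rho> + h))) - \<rho> powr (- A) * exp (- (X s \<omega> ^ 2) / (4 * \<rho>))
     - h * (\<rho> powr (- A) * exp (- (X s \<omega> ^ 2) / (4 * \<rho>)) * (4 * \<beta> ^ 2 * X s \<omega> ^ 2 - 4 * A * \<beta>)))))"
  have exp\<beta>: "exp (- (x ^ 2) / (4 * \<rho>)) = exp (- \<beta> * x ^ 2)" for x
    by (simp add: \<beta>_def)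
  note [measurable] = X_meas Y_meas
  have wM: "w \<in> borel_measurable M" by (rule measurable_filtrationD[OF w])
  have g: "growth 0 w" "growth 0 (\<lambda>\<omega>. exp (- \<beta> * X t \<omega> ^ 2))" "growth 0 (\<lambda>\<omega>. exp (- \<beta> * X s \<omega> ^ 2))"
    "growth 0 (\<lambda>\<omega>. exp (- (X s \<omega> ^ 2) / (4 * (\<rho> + h))))"
    using w1 wM \<beta> \<rho> h by (auto intro!: growth_bounded[where B=1])
  have e8: "e \<le> 1" using e by auto
  have int: "integrable M T1" "integrable M T2" "integrable M R"
    unfolding T1_def T2_def R_def exp\<beta>
    by (rule integrable_growth, (rule g growth_intros)+, use e8 in simp)+
  \<comment> \<open>An exact identity: \<open>R\<close> contains the compensating multiple of
    \<open>h * T2\<close>.\<close>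
  have pw: "w \<omega> * heat_solution \<kappa> e (\<tau> - t) (X t \<omega>) - w \<omega> * heat_solution \<kappa> e (\<tau> - s) (X s \<omega>) =
      \<rho> powr (- A) * (T1 \<omega> - h * T2 \<omega>) - R \<omega>" for \<omega>
    unfolding heat_solution_def T1_def T2_def R_def \<rho>h \<rho>_def[symmetric] A_def[symmetric] exp\<beta>
    by (simp add: algebra_simps)
  have i: "integrable M (\<lambda>\<omega>. w \<omega> * heat_solution \<kappa> e (\<tau> - t) (X t \<omega>))"
    "integrable M (\<lambda>\<omega>. w \<omega> * heat_solution \<kappa> e (\<tau> - s) (X s \<omega>))"
    unfolding heat_solution_def \<rho>h \<rho>_def[symmetric] exp\<beta>
    by (rule integrable_growth, (rule g growth_intros)+, use e8 in simp)+
  have "expectation (\<lambda>\<omega>. w \<omega> * heat_solution \<kappa> e (\<tau> - t) (X t \<omega>))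
      - expectation (\<lambda>\<omega>. w \<omega> * heat_solution \<kappa> e (\<tau> - s) (X s \<omega>))
      = expectation (\<lambda>\<omega>. w \<omega> * heat_solution \<kappa> e (\<tau> - t) (X t \<omega>) - w \<omega> * heat_solution \<kappa> e (\<tau> - s) (X s \<omega>))"
    using i by simp
  also have "\<dots> = \<rho> powr (- A) * (expectation T1 - h * expectation T2) - expectation R"
    unfolding pw using int by simp
  finally have eq: "expectation (\<lambda>\<omega>. w \<omega> * heat_solution \<kappa> e (\<tau> - t) (X t \<omega>))
      - expectation (\<lambda>\<omega>. w \<omega> * heat_solution \<kappa> e (\<tau> - s) (X s \<omega>))
      = \<rho> powr (- A) * (expectation T1 - h * expectation T2) - expectation R" .
  have b1: "\<bar>\<rho> powr (- A) * (expectation T1 - h * expectation T2)\<bar> \<le> P * ((13 + K) * b ^ 3 * c * q ^ 9)"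
    unfolding abs_mult using heat_step[OF w w1 \<beta> b(1) e] P
    by (intro mult_mono) (auto simp: T1_def T2_def A_def)
  have b2: "\<bar>expectation R\<bar> \<le> P * (32 * b ^ 4 * (A + 1) ^ 2 * (1 + K) * q ^ 9)"
  proof -
    define C where "C = P * (8 * b ^ 4 * (A + 1) ^ 2) * h ^ 2"
    have C: "C \<ge> 0" using P by (simp add: C_def)
    \<comment> \<open>Degree 6 arises from \<open>(1 + z) ^ 3\<close> with
      \<open>z = X s ^ 2\<close>: one factor bounds \<open>|X s ^ e|\<close>, two come from the
      expansion in time.\<close>
    have pwR: "\<bar>R \<omega>\<bar> \<le> C * (4 * (1 + X s \<omega> ^ 6))" for \<omega>
    proof -
      let ?z = "X s \<omega> ^ 2"
      have z: "?z \<ge> 0" by simp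
      have xe: "\<bar>X s \<omega> ^ e\<bar> \<le> 1 + ?z"
        using e young_product[of 1 1 "\<bar>X s \<omega>\<bar>"] by (auto simp: power_abs)
      have "\<bar>R \<omega>\<bar> \<le> 1 * ((1 + ?z) * (P * (8 * b ^ 4 * (A + 1) ^ 2) * (1 + ?z) ^ 2 * h ^ 2))"
        unfolding R_def abs_mult[of "w \<omega>"] abs_mult[of "X s \<omega> ^ e"] P_def \<beta>_def
        by (intro mult_mono w1 xe gaussian_time_taylor[OF A z b(1) b(2)[folded \<rho>_def] h(1)]) auto
      also have "\<dots> = C * (1 + ?z) ^ 3"
        by (simp add: C_def eval_nat_numeral algebra_simps)
      also have "(1 + ?z) ^ 3 \<le> 4 * (1 + X s \<omega> ^ 6)"
      proof -
        have "0 \<le> 3 * (1 + ?z) * (1 - ?z) ^ 2" using z by simp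
        also have "\<dots> = 4 * (1 + ?z ^ 3) - (1 + ?z) ^ 3"
          by (simp add: algebra_simps eval_nat_numeral)
        finally show ?thesis by (simp flip: power_mult)
      qed
      finally show ?thesis using C by (simp add: mult_left_mono)
    qed
    have i6: "integrable M (\<lambda>\<omega>. X s \<omega> ^ 6)"
      by (rule integrable_growth, (rule growth_intros)+, simp)
    have "\<bar>expectation R\<bar> \<le> expectation (\<lambda>\<omega>. \<bar>R \<omega>\<bar>)"
      by (rule integral_abs_bound)
    also have "\<dots> \<le> expectation (\<lambda>\<omega>. C * (4 * (1 + X s \<omega> ^ 6)))"
      using int i6 by (intro integral_mono pwR) auto
    also have "\<dots> = C * (4 * (1 + expectation (\<lambda>\<omega>. X s \<omega> ^ 6)))"
      using i6 by (simp add: prob_space)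
    also have "\<dots> \<le> C * (4 * (1 + K))"
      using K C by (intro mult_left_mono) auto
    also have "\<dots> = (P * (32 * b ^ 4 * (A + 1) ^ 2 * (1 + K))) * q ^ 16"
      by (simp add: C_def q(3) flip: power_mult)
    also have "\<dots> \<le> (P * (32 * b ^ 4 * (A + 1) ^ 2 * (1 + K))) * q ^ 9"
      using P K b by (intro mult_left_mono q_power_le) auto
    finally show ?thesis by (simp add: mult_ac)
  qed
  have "\<bar>expectation (\<lambda>\<omega>. w \<omega> * heat_solution \<kappa> e (\<tau> - t) (X t \<omega>))
      - expectation (\<lambda>\<omega>. w \<omega> * heat_solution \<kappa> e (\<tau> - s) (X s \<omega>))\<bar>
    \<le> P * ((13 + K) * b ^ 3 * c * q ^ 9) + P * (32 * b ^ 4 * (A + 1) ^ 2 * (1 + K) * q ^ 9)"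
    unfolding eq using b1 b2 by linarith
  then show ?thesis
    unfolding P_def A_def q_def h_def by (simp add: algebra_simps)
qed

text \<open>One constant serves every short subinterval: \<open>w\<close> stays measurable for the
  later past, the moments are bounded up to \<open>t\<close>, and the remaining time is at least
  \<open>\<tau> - t\<close>. The mean thus has a modulus of exponent 9/8 and is constant.\<close>

lemma heat_solution_martingale:
  assumes st: "0 \<le> s" "s \<le> t" "t < \<tau>"
    and w: "w \<in> borel_measurable (F s)" and w1: "\<And>\<omega>. \<bar>w \<omega>\<bar> \<le> 1" and e: "e = 0 \<or> e = (1::nat)"
  shows "expectation (\<lambda>\<omega>. w \<omega> * heat_solution \<kappa> e (\<tau> - t) (X t \<omega>)) =
         expectation (\<lambda>\<omega>. w \<omega> * heat_solution \<kappa> e (\<tau> - s) (X s \<omega>))"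
proof -
  \<comment> \<open>Keeps the Gaussian rate \<open>1 / (4 \<rho>)\<close> below \<open>b\<close> for
    all times up to \<open>t\<close>.\<close>
  define b where "b = max 1 (1 / (4 * (\<tau> - t)))"
  have b: "b \<ge> 1" by (simp add: b_def)
  have b': "1 / (4 * b) \<le> \<tau> - t"
  proof -
    have "1 / (4 * (\<tau> - t)) \<le> b" by (simp add: b_def)
    then show ?thesis using b st by (simp add: field_simps)
  qed
  obtain K where K: "K \<ge> 1" "\<And>r. 0 \<le> r \<Longrightarrow> r \<le> t \<Longrightarrow> expectation (\<lambda>\<omega>. X r \<omega> ^ 2) \<le> K"
    "\<And>r. 0 \<le> r \<Longrightarrow> r \<le> t \<Longrightarrow> expectation (\<lambda>\<omega>. X r \<omega> ^ 4) \<le> K"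
    "\<And>r. 0 \<le> r \<Longrightarrow> r \<le> t \<Longrightarrow> expectation (\<lambda>\<omega>. X r \<omega> ^ 6) \<le> K"
    using moment_bound[of t] st by auto
  define g where "g = (\<lambda>r. expectation (\<lambda>\<omega>. w \<omega> * heat_solution \<kappa> e (\<tau> - r) (X r \<omega>)))"
  have "g s = g t"
  proof (rule constant_of_superlinear_modulus[OF st(2)])
    let ?C = "(1 / (4 * b)) powr (- (\<kappa> + real e)) *
      ((13 + K) * b ^ 3 * increment_const \<kappa> K + 32 * b ^ 4 * (\<kappa> + real e + 1) ^ 2 * (1 + K))"
    have "increment_const \<kappa> K \<ge> 0"
      unfolding increment_const_def using K kappa_pos by (intro mult_nonneg_nonneg add_nonneg_nonneg) auto
    then show "?C \<ge> 0" using K b by (intro mult_nonneg_nonneg add_nonneg_nonneg) auto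
    fix x y assume xy: "s \<le> x" "x < y" "y \<le> t" "y - x \<le> 1"
    show "\<bar>g y - g x\<bar> \<le> ?C * root 8 (y - x) ^ 9"
      unfolding g_def using st xy b' K
      by (intro heat_solution_step[OF _ _ _ _ _ _ _ filtration_mono[OF _ w] w1 e b]) auto
  qed
  then show ?thesis by (simp add: g_def)
qed

end

section \<open>The Dunkl heat kernel\<close>

text \<open>For \<open>z > 0\<close> this is the modified Bessel function \<open>I\<close> of order
  \<open>\<kappa> - 1\<close> at \<open>2 sqrt z\<close>, divided by \<open>z\<close> to the power
  \<open>(\<kappa> - 1) / 2\<close>. In this normalization differentiation simply raises
  \<open>\<kappa>\<close> by 1.\<close>

definition bessel_series :: "real \<Rightarrow> real \<Rightarrow> real" where
  "bessel_series \<kappa> z = (\<Sum>n. 1 / (fact n * Gamma (real n + \<kappa>)) * z ^ n)"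

lemma Gamma_plus1_pos: "x > 0 \<Longrightarrow> Gamma (x + 1) = x * Gamma x" for x :: real
  by (rule Gamma_plus1) (auto dest: nonpos_Ints_nonpos)

text \<open>Each factor of \<open>Gamma (n + \<kappa>) / Gamma \<kappa>\<close> is at least
  \<open>\<kappa>\<close>. This compares the series with that of
  \<open>exp (|z| / \<kappa>)\<close>.\<close>

lemma Gamma_shift_lower_bound:
  assumes "\<kappa> > 0"
  shows "Gamma \<kappa> * \<kappa> ^ n \<le> Gamma (real n + \<kappa>)"
proof (induction n)
  case (Suc n)
  have "Gamma (real (Suc n) + \<kappa>) = (real n + \<kappa>) * Gamma (real n + \<kappa>)"
    using Gamma_plus1_pos[of "real n + \<kappa>"] assms by (simp add: add_ac)
  moreover have "\<kappa> * (Gamma \<kappa> * \<kappa> ^ n) \<le> (real n + \<kappa>) * Gamma (real n + \<kappa>)"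
    using Suc assms by (intro mult_mono) (auto intro!: mult_nonneg_nonneg less_imp_le[OF Gamma_real_pos])
  ultimately show ?case by (simp add: mult_ac)
qed (simp add: add_ac)

lemma summable_bessel_series:
  assumes "\<kappa> > 0"
  shows "summable (\<lambda>n. 1 / (fact n * Gamma (real n + \<kappa>)) * z ^ n)"
proof (rule summable_comparison_test)
  have G: "Gamma \<kappa> > 0" using assms by (rule Gamma_real_pos)
  show "summable (\<lambda>n. 1 / Gamma \<kappa> * (inverse (fact n) * (\<bar>z\<bar> / \<kappa>) ^ n))"
    using summable_exp[of "\<bar>z\<bar> / \<kappa>"] by (intro summable_mult) simp
  show "\<exists>N. \<forall>n\<ge>N. norm (1 / (fact n * Gamma (real n + \<kappa>)) * z ^ n)
      \<le> 1 / Gamma \<kappa> * (inverse (fact n) * (\<bar>z\<bar> / \<kappa>) ^ n)"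
  proof (intro exI allI impI)
    fix n :: nat
    have Gn: "Gamma (real n + \<kappa>) > 0" using assms by (intro Gamma_real_pos) auto
    have "norm (1 / (fact n * Gamma (real n + \<kappa>)) * z ^ n) = \<bar>z\<bar> ^ n / fact n * (1 / Gamma (real n + \<kappa>))"
      using Gn by (simp add: abs_mult power_abs)
    also have "\<dots> \<le> \<bar>z\<bar> ^ n / fact n * (1 / (Gamma \<kappa> * \<kappa> ^ n))"
      using Gamma_shift_lower_bound[OF assms, of n] G assms
      by (intro mult_left_mono divide_left_mono) auto
    also have "\<dots> = 1 / Gamma \<kappa> * (inverse (fact n) * (\<bar>z\<bar> / \<kappa>) ^ n)"
      by (simp add: power_divide field_simps)
    finally show "norm (1 / (fact n * Gamma (real n + \<kappa>)) * z ^ n)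
      \<le> 1 / Gamma \<kappa> * (inverse (fact n) * (\<bar>z\<bar> / \<kappa>) ^ n)" .
  qed
qed

lemma bessel_series_deriv:
  assumes "\<kappa> > 0"
  shows "(bessel_series \<kappa> has_real_derivative bessel_series (\<kappa> + 1) z) (at z)"
proof -
  have "diffs (\<lambda>n. 1 / (fact n * Gamma (real n + \<kappa>))) = (\<lambda>n. 1 / (fact n * Gamma (real n + (\<kappa> + 1))))"
    by (simp add: diffs_def fun_eq_iff add_ac del: of_nat_Suc)
      (simp add: add_ac)
  then show ?thesis
    using termdiffs_strong_converges_everywhere[of "\<lambda>n. 1 / (fact n * Gamma (real n + \<kappa>))" z]
      summable_bessel_series[OF assms]
    by (simp add: bessel_series_def[abs_def])
qed

lemma continuous_on_bessel_series: "\<kappa> > 0 \<Longrightarrow> continuous_on A (bessel_series \<kappa>)"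
  by (meson DERIV_isCont bessel_series_deriv continuous_at_imp_continuous_on)

lemma bessel_series_measurable [measurable]: "\<kappa> > 0 \<Longrightarrow> bessel_series \<kappa> \<in> borel_measurable borel"
  by (intro borel_measurable_continuous_onI continuous_on_bessel_series)

lemma bessel_series_pos:
  assumes "\<kappa> > 0" "z \<ge> 0"
  shows "bessel_series \<kappa> z > 0"
  unfolding bessel_series_def
proof (rule suminf_pos2[OF summable_bessel_series[OF assms(1)], of _ 0])
  fix n
  have "Gamma (real n + \<kappa>) > 0" using assms by (intro Gamma_real_pos) auto
  then show "0 \<le> 1 / (fact n * Gamma (real n + \<kappa>)) * z ^ n"
    using assms by simp
qed (use assms Gamma_real_pos in simp)

text \<open>On coefficients this is \<open>1 / Gamma (n + \<kappa>) = (\<kappa> + n) / Gamma (n +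
  \<kappa> + 1)\<close>; a shift of the index turns the part with \<open>n\<close> into
  \<open>z\<close> times the series for \<open>\<kappa> + 2\<close>.\<close>

lemma bessel_series_recurrence:
  assumes "\<kappa> > 0"
  shows "\<kappa> * bessel_series (\<kappa> + 1) z + z * bessel_series (\<kappa> + 2) z = bessel_series \<kappa> z"
proof -
  define c where "c = (\<lambda>\<kappa> n. 1 / (fact n * Gamma (real n + \<kappa>)))"
  have c: "c \<kappa> n = \<kappa> * c (\<kappa> + 1) n + real n * c (\<kappa> + 1) n" for n
  proof -
    have G: "Gamma (real n + \<kappa>) > 0" using assms by (intro Gamma_real_pos) auto
    have "Gamma (real n + (\<kappa> + 1)) = (real n + \<kappa>) * Gamma (real n + \<kappa>)"
      using Gamma_plus1_pos[of "real n + \<kappa>"] assms by (simp add: add_ac)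
    then show ?thesis using G assms
      by (simp add: c_def divide_simps)
  qed
  have s: "(\<lambda>n. c \<kappa>' n * z ^ n) sums bessel_series \<kappa>' z" if "\<kappa>' > 0" for \<kappa>'
    unfolding c_def bessel_series_def using summable_bessel_series[OF that] by (rule summable_sums)
  have "(\<lambda>n. z * (c (\<kappa> + 2) n * z ^ n)) sums (z * bessel_series (\<kappa> + 2) z)"
    using assms by (intro sums_mult s) auto
  also have "(\<lambda>n. z * (c (\<kappa> + 2) n * z ^ n)) = (\<lambda>n. real (Suc n) * c (\<kappa> + 1) (Suc n) * z ^ Suc n)"
    by (simp add: c_def fun_eq_iff add_ac del: of_nat_Suc) (simp add: add_ac)
  finally have "(\<lambda>n. real n * c (\<kappa> + 1) n * z ^ n) sums (z * bessel_series (\<kappa> + 2) z)"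
    by (subst (asm) sums_Suc_iff) simp
  moreover have "(\<lambda>n. \<kappa> * (c (\<kappa> + 1) n * z ^ n)) sums (\<kappa> * bessel_series (\<kappa> + 1) z)"
    using assms by (intro sums_mult s) auto
  ultimately have "(\<lambda>n. \<kappa> * (c (\<kappa> + 1) n * z ^ n) + real n * c (\<kappa> + 1) n * z ^ n) sums
      (\<kappa> * bessel_series (\<kappa> + 1) z + z * bessel_series (\<kappa> + 2) z)"
    by (intro sums_add)
  also have "(\<lambda>n. \<kappa> * (c (\<kappa> + 1) n * z ^ n) + real n * c (\<kappa> + 1) n * z ^ n) = (\<lambda>n. c \<kappa> n * z ^ n)"
    by (simp add: c algebra_simps)
  finally show ?thesis using s[OF assms] sums_unique2 by blast
qed

text \<open>This is the positivity of the Dunkl kernel. By the recurrence \<open>H\<close> has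
  derivative \<open>2 \<kappa> - 1\<close> times a square, so for \<open>\<kappa> \<ge> 1/2\<close>,
  that is \<open>k \<ge> 0\<close>, it stays above \<open>H 0 > 0\<close> on the positive axis; at
  \<open>s ^ 2\<close> this compares two squares.\<close>

lemma bessel_series_odd_bound:
  assumes "\<kappa> \<ge> 1/2"
  shows "\<bar>s * bessel_series (\<kappa> + 1) (s ^ 2)\<bar> < bessel_series \<kappa> (s ^ 2)"
proof -
  define H where "H = (\<lambda>z. bessel_series \<kappa> z ^ 2 - z * bessel_series (\<kappa> + 1) z ^ 2)"
  have k: "\<kappa> > 0" "\<kappa> + 1 > 0" using assms by auto
  have d: "(H has_real_derivative (2 * \<kappa> - 1) * bessel_series (\<kappa> + 1) z ^ 2) (at z)" for z
  proof -
    have "(H has_real_derivative 2 * bessel_series \<kappa> z * bessel_series (\<kappa> + 1) z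
       - (bessel_series (\<kappa> + 1) z ^ 2 + z * (2 * bessel_series (\<kappa> + 1) z * bessel_series (\<kappa> + 2) z))) (at z)"
      unfolding H_def using bessel_series_deriv[OF k(2), of z] bessel_series_deriv[OF k(1), of z]
      by (auto intro!: derivative_eq_intros simp: add.assoc algebra_simps)
    also have "2 * bessel_series \<kappa> z * bessel_series (\<kappa> + 1) z
       - (bessel_series (\<kappa> + 1) z ^ 2 + z * (2 * bessel_series (\<kappa> + 1) z * bessel_series (\<kappa> + 2) z))
       = (2 * \<kappa> - 1) * bessel_series (\<kappa> + 1) z ^ 2"
      unfolding bessel_series_recurrence[OF k(1), of z, symmetric] by (simp add: algebra_simps power2_eq_square)
    finally show ?thesis .
  qed
  have "H 0 \<le> H (s ^ 2)"
  proof (rule DERIV_nonneg_imp_nondecreasing[where f = H])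
    show "\<exists>y. (H has_real_derivative y) (at z) \<and> 0 \<le> y" for z
      by (rule exI, rule conjI[OF d]) (use assms in simp)
  qed simp
  moreover have "H 0 > 0"
    using bessel_series_pos[OF k(1), of 0] by (simp add: H_def)
  ultimately have "0 < H (s ^ 2)" by linarith
  then have "(s * bessel_series (\<kappa> + 1) (s ^ 2)) ^ 2 < bessel_series \<kappa> (s ^ 2) ^ 2"
    by (simp add: H_def power_mult_distrib)
  then have "\<bar>s * bessel_series (\<kappa> + 1) (s ^ 2)\<bar> < \<bar>bessel_series \<kappa> (s ^ 2)\<bar>"
    using abs_le_square_iff not_le by blast
  then show ?thesis
    using bessel_series_pos[OF k(1), of "s ^ 2"] by simp
qed

lemma bessel_j_imaginary:
  assumes "\<alpha> \<ge> - 1/2"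
  shows "bessel_j \<alpha> (\<i> * of_real r) = of_real (Gamma (\<alpha> + 1) * bessel_series (\<alpha> + 1) ((r / 2) ^ 2))"
proof -
  define f :: "nat \<Rightarrow> real" where
    "f = (\<lambda>n. 1 / (fact n * Gamma (real n + (\<alpha> + 1))) * ((r / 2) ^ 2) ^ n)"
  have eq: "(- 1) ^ n * (\<i> * of_real r / 2) ^ (2 * n) /
              of_real (fact n * Gamma (real n + \<alpha> + 1)) = (of_real (f n) :: complex)" for n
  proof -
    have "(- 1) ^ n * (\<i> * of_real r / 2) ^ (2 * n) = ((- 1) * (\<i> * of_real r / 2)\<^sup>2 :: complex) ^ n"
      by (simp only: power_mult power_mult_distrib)
    also have "(- 1) * (\<i> * of_real r / 2)\<^sup>2 = (of_real ((r / 2)\<^sup>2) :: complex)"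
      by (simp add: power_mult_distrib power_divide)
    finally show ?thesis
      by (simp add: f_def add_ac)
  qed
  have "summable f"
    unfolding f_def using assms by (intro summable_bessel_series) auto
  then have "(\<Sum>n. of_real (f n) :: complex) = of_real (\<Sum>n. f n)"
    by (rule suminf_of_real[symmetric])
  then show ?thesis
    unfolding bessel_j_def eq by (simp add: bessel_series_def f_def)
qed

lemma dunkl_E_bessel_series:
  assumes "k \<ge> 0" "\<kappa> = k + 1/2"
  shows "dunkl_E k x y = Gamma \<kappa> * (bessel_series \<kappa> ((x * y / 2) ^ 2)
           + x * y / 2 * bessel_series (\<kappa> + 1) ((x * y / 2) ^ 2))"
proof -
  have G: "Gamma (\<kappa> + 1) = \<kappa> * Gamma \<kappa>" using assms by (intro Gamma_plus1_pos) simp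
  have 1: "bessel_j (k - 1/2) (\<i> * of_real (x * y)) = of_real (Gamma \<kappa> * bessel_series \<kappa> ((x * y / 2) ^ 2))"
    using bessel_j_imaginary[of "k - 1/2" "x * y"] assms by (simp add: algebra_simps)
  have 2: "bessel_j (k + 1/2) (\<i> * of_real (x * y)) =
      of_real (Gamma (\<kappa> + 1) * bessel_series (\<kappa> + 1) ((x * y / 2) ^ 2))"
    using bessel_j_imaginary[of "k + 1/2" "x * y"] assms by (simp add: algebra_simps)
  have 3: "2 * k + 1 = 2 * \<kappa>" "\<kappa> > 0" using assms by auto
  have "dunkl_E k x y = Gamma \<kappa> * bessel_series \<kappa> ((x * y / 2) ^ 2)
      + x * y / (2 * \<kappa>) * (Gamma (\<kappa> + 1) * bessel_series (\<kappa> + 1) ((x * y / 2) ^ 2))"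
    unfolding dunkl_E_def 1 2 3 by (simp only: Re_complex_of_real flip: of_real_mult of_real_add)
  then show ?thesis
    using 3 unfolding G by (simp add: distrib_left)
qed

text \<open>The substitution \<open>t = b * y ^ 2\<close> in the Gamma integral, followed by
  reflection at 0.\<close>

lemma has_bochner_integral_gaussian_powr:
  assumes p: "p > 0" and b: "b > 0"
  shows "has_bochner_integral lborel (\<lambda>y::real. \<bar>y\<bar> powr (2 * p - 1) * exp (- b * y ^ 2)) (Gamma p * b powr (- p))"
proof -
  define f where "f = (\<lambda>t::real. t powr (p - 1) / exp t)"
  define g where "g = (\<lambda>y::real. b * y ^ 2)"
  have I0: "(f has_integral Gamma p) {0..}"
    unfolding f_def by (rule Gamma_integral_real[OF p])
  \<comment> \<open>The pointwise identity \<open>ff\<close> is stated for \<open>y > 0\<close>, so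
    the point 0 is removed now and restored later.\<close>
  have spike: "(u has_integral I) {0..} \<longleftrightarrow> (u has_integral I) {0<..}" for u :: "real \<Rightarrow> real" and I
    by (rule has_integral_spike_set_eq; rule negligible_subset[OF negligible_sing[of 0]]) auto
  from I0 have I: "(f has_integral Gamma p) {0<..}" by (simp add: spike)
  have abs: "f absolutely_integrable_on {0<..}"
    using I by (intro nonnegative_absolutely_integrable_1) (auto simp: f_def)
  have img: "g ` {0<..} = {0<..}"
  proof (intro equalityI subsetI)
    fix t :: real assume "t \<in> {0<..}"
    then have "t = g (sqrt (t / b))" "sqrt (t / b) \<in> {0<..}" using b by (auto simp: g_def)
    then show "t \<in> g ` {0<..}" by (rule image_eqI)
  qed (use b in \<open>auto simp: g_def\<close>)
  have inj: "inj_on g {0<..}"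
    using b by (auto simp: g_def inj_on_def power2_eq_iff)
  have der: "(g has_field_derivative 2 * b * y) (at y within {0<..})" for y
    unfolding g_def by (auto intro!: derivative_eq_intros)
  have "(\<lambda>y. \<bar>2 * b * y\<bar> * f (g y)) absolutely_integrable_on {0<..} \<and>
      integral {0<..} (\<lambda>y. \<bar>2 * b * y\<bar> * f (g y)) = Gamma p"
    using has_absolute_integral_change_of_variables_1'[of "{0<..}" g "\<lambda>y. 2 * b * y" f "Gamma p"]
      der inj abs I unfolding img by (auto simp: integral_unique)
  then have J: "((\<lambda>y. \<bar>2 * b * y\<bar> * f (g y)) has_integral Gamma p) {0<..}"
    by (metis absolutely_integrable_on_def integrable_integral set_lebesgue_integral_eq_integral(1))
  have ff: "\<bar>2 * b * y\<bar> * f (g y) = 2 * b powr p * (\<bar>y\<bar> powr (2 * p - 1) * exp (- b * y ^ 2))" if "y > 0" for y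
  proof -
    have 1: "(b * y ^ 2) powr (p - 1) = b powr (p - 1) * y powr (2 * (p - 1))"
      using that b by (simp add: powr_mult powr_powr flip: powr_numeral)
    have 2: "b * b powr (p - 1) = b powr p" using b by (simp add: powr_diff)
    have "y powr 1 * y powr (2 * (p - 1)) = y powr (1 + 2 * (p - 1))" by (rule powr_add[symmetric])
    then have 3: "y * y powr (2 * (p - 1)) = y powr (2 * p - 1)"
      using that by (simp add: algebra_simps)
    have "b * y * (b * y ^ 2) powr (p - 1) = (b * b powr (p - 1)) * (y * y powr (2 * (p - 1)))"
      unfolding 1 by (simp only: mult_ac)
    also have "\<dots> = b powr p * y powr (2 * p - 1)" unfolding 2 3 ..
    finally have "b * y * (b * y ^ 2) powr (p - 1) = b powr p * y powr (2 * p - 1)" .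
    then show ?thesis using that b by (simp add: f_def g_def exp_minus field_simps)
  qed
  have "((\<lambda>y. 2 * b powr p * (\<bar>y\<bar> powr (2 * p - 1) * exp (- b * y ^ 2))) has_integral Gamma p) {0<..}"
    by (rule has_integral_eq[OF _ J]) (simp add: ff)
  then have "((\<lambda>y. \<bar>y\<bar> powr (2 * p - 1) * exp (- b * y ^ 2)) has_integral (Gamma p / (2 * b powr p))) {0<..}"
    using has_integral_mult_right[of "\<lambda>y. 2 * b powr p * (\<bar>y\<bar> powr (2 * p - 1) * exp (- b * y ^ 2))" "Gamma p" "{0<..}" "1 / (2 * b powr p)"] b
    by simp
  then have "((\<lambda>y. \<bar>y\<bar> powr (2 * p - 1) * exp (- b * y ^ 2)) has_integral (Gamma p / (2 * b powr p))) {0..}"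
    by (simp only: spike)
  then have "((\<lambda>y. if y \<in> {0..} then \<bar>y\<bar> powr (2 * p - 1) * exp (- b * y ^ 2) else 0) has_integral
      (Gamma p / (2 * b powr p))) UNIV"
    by (simp only: has_integral_restrict_UNIV)
  also have "(\<lambda>y. if y \<in> {0..} then \<bar>y\<bar> powr (2 * p - 1) * exp (- b * y ^ 2) else 0) =
      (\<lambda>y. indicator {0..} y *\<^sub>R (\<bar>y\<bar> powr (2 * p - 1) * exp (- b * y ^ 2)))"
    by (auto simp: fun_eq_iff)
  finally have "has_bochner_integral lborel (\<lambda>y. indicator {0..} y *\<^sub>R (\<bar>y\<bar> powr (2 * p - 1) * exp (- b * y ^ 2)))
      (Gamma p / (2 * b powr p))"
    using p by (intro has_bochner_integral_nn_integral nn_integral_has_integral_lborel)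
      (auto intro!: divide_nonneg_nonneg less_imp_le[OF Gamma_real_pos])
  from has_bochner_integral_even_function[OF this] show ?thesis
    by (simp add: powr_minus field_simps)
qed

text \<open>Termwise integration: the Gamma value of each integral cancels the one in the
  coefficient, which leaves the exponential series in \<open>\<xi> ^ 2 / b\<close>. The terms are
  nonnegative, so the norms required for the interchange are the terms themselves.\<close>

lemma has_bochner_integral_bessel_gaussian:
  assumes \<kappa>: "\<kappa> > 0" and b: "b > 0"
  shows "has_bochner_integral lborel
    (\<lambda>y. bessel_series \<kappa> ((\<xi> * y) ^ 2) * (\<bar>y\<bar> powr (2 * \<kappa> - 1) * exp (- b * y ^ 2)))
    (b powr (- \<kappa>) * exp (\<xi> ^ 2 / b))"
proof -
  define f where "f = (\<lambda>n y. (\<xi> ^ 2) ^ n / (fact n * Gamma (real n + \<kappa>)) *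
    (\<bar>y\<bar> powr (2 * (real n + \<kappa>) - 1) * exp (- b * y ^ 2)))"
  have G: "Gamma (real n + \<kappa>) > 0" for n using \<kappa> by (intro Gamma_real_pos) auto
  have nn: "f n y \<ge> 0" for n y
    using G[of n] by (simp add: f_def)
  have fb: "has_bochner_integral lborel (f n) (b powr (- \<kappa>) * (inverse (fact n) * (\<xi> ^ 2 / b) ^ n))" for n
  proof -
    have "has_bochner_integral lborel (f n)
        ((\<xi> ^ 2) ^ n / (fact n * Gamma (real n + \<kappa>)) * (Gamma (real n + \<kappa>) * b powr (- (real n + \<kappa>))))"
      unfolding f_def using \<kappa> b by (intro has_bochner_integral_mult_right has_bochner_integral_gaussian_powr) auto
    also have "(\<xi> ^ 2) ^ n / (fact n * Gamma (real n + \<kappa>)) * (Gamma (real n + \<kappa>) * b powr (- (real n + \<kappa>)))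
        = b powr (- \<kappa>) * (inverse (fact n) * (\<xi> ^ 2 / b) ^ n)"
    proof -
      have "- (real n + \<kappa>) = - \<kappa> - real n" by simp
      then have "b powr (- (real n + \<kappa>)) = b powr (- \<kappa>) / b ^ n"
        using b by (simp only: powr_diff powr_realpow)
      then show ?thesis using G[of n] by (simp add: power_divide field_simps)
    qed
    finally show ?thesis .
  qed
  have fs: "(\<lambda>n. f n y) sums (bessel_series \<kappa> ((\<xi> * y) ^ 2) * (\<bar>y\<bar> powr (2 * \<kappa> - 1) * exp (- b * y ^ 2)))" for y
  proof -
    have "f n y = 1 / (fact n * Gamma (real n + \<kappa>)) * ((\<xi> * y) ^ 2) ^ n * (\<bar>y\<bar> powr (2 * \<kappa> - 1) * exp (- b * y ^ 2))" for n
    proof (cases "y = 0")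
      case False
      then have "\<bar>y\<bar> powr (2 * (real n + \<kappa>) - 1) = \<bar>y\<bar> powr (real (2 * n)) * \<bar>y\<bar> powr (2 * \<kappa> - 1)"
        by (simp add: algebra_simps flip: powr_add)
      also have "\<bar>y\<bar> powr (real (2 * n)) = y ^ (2 * n)"
        using False by (subst powr_realpow) (auto simp: power_mult)
      finally show ?thesis
        by (simp add: f_def power_mult power_mult_distrib)
    qed (simp add: f_def)
    then show ?thesis
      unfolding bessel_series_def using summable_bessel_series[OF \<kappa>, of "(\<xi> * y) ^ 2"]
      by (simp only:) (intro sums_mult2 summable_sums)
  qed
  have norm: "norm (f n y) = f n y" for n y using nn by simp
  have ex: "(\<lambda>n. b powr (- \<kappa>) * (inverse (fact n) * (\<xi> ^ 2 / b) ^ n)) sums (b powr (- \<kappa>) * exp (\<xi> ^ 2 / b))"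
    using exp_converges[of "\<xi> ^ 2 / b"] by (intro sums_mult) (simp add: divide_inverse mult.commute)
  have F: "(\<Sum>n. f n y) = bessel_series \<kappa> ((\<xi> * y) ^ 2) * (\<bar>y\<bar> powr (2 * \<kappa> - 1) * exp (- b * y ^ 2))" for y
    using fs[of y] by (rule sums_unique[symmetric])
  have *: "\<And>n. integrable lborel (f n)" "AE y in lborel. summable (\<lambda>n. norm (f n y))"
    "summable (\<lambda>n. \<integral>y. norm (f n y) \<partial>lborel)"
    using fb fs ex unfolding norm by (auto simp: has_bochner_integral_iff sums_iff)
  have "integrable lborel (\<lambda>y. \<Sum>n. f n y)"
    by (rule integrable_suminf[OF *])
  moreover have "(\<lambda>n. integral\<^sup>L lborel (f n)) sums (\<integral>y. (\<Sum>n. f n y) \<partial>lborel)"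
    by (rule sums_integral[OF *])
  moreover have "integral\<^sup>L lborel (f n) = b powr (- \<kappa>) * (inverse (fact n) * (\<xi> ^ 2 / b) ^ n)" for n
    using fb[of n] by (simp add: has_bochner_integral_iff)
  ultimately show ?thesis
    using ex unfolding F has_bochner_integral_iff by (auto dest: sums_unique2)
qed

lemma dunkl_c_eq:
  assumes "k \<ge> 0" "\<kappa> = k + 1/2"
  shows "dunkl_c k = Gamma \<kappa> * 2 powr \<kappa>"
proof -
  have "has_bochner_integral lborel (\<lambda>y. \<bar>y\<bar> powr (2 * \<kappa> - 1) * exp (- (1/2) * y ^ 2)) (Gamma \<kappa> * (1/2) powr (- \<kappa>))"
    using assms by (intro has_bochner_integral_gaussian_powr) auto
  moreover have "(1/2) powr (- \<kappa>) = 2 powr \<kappa>"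
    by (simp add: powr_divide powr_minus)
  ultimately show ?thesis
    using assms by (simp add: dunkl_c_def has_bochner_integral_iff mult.commute)
qed

section \<open>Even and odd parts of the transition density\<close>

definition dunkl_density :: "real \<Rightarrow> real \<Rightarrow> real \<Rightarrow> real \<Rightarrow> real" where
  "dunkl_density k h x y = dunkl_heat_kernel k h x y * \<bar>y\<bar> powr (2 * k)"

text \<open>The rate \<open>b\<close> is a free parameter because multiplying the density by a
  Gaussian merely changes it. The exponent \<open>2 \<kappa> - 1\<close> is the weight
  \<open>2 k\<close>.\<close>

definition even_part :: "real \<Rightarrow> real \<Rightarrow> real \<Rightarrow> real \<Rightarrow> real" where
  "even_part \<kappa> b \<xi> y = bessel_series \<kappa> ((\<xi> * y) ^ 2) * (\<bar>y\<bar> powr (2 * \<kappa> - 1) * exp (- b * y ^ 2))"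

definition odd_part :: "real \<Rightarrow> real \<Rightarrow> real \<Rightarrow> real \<Rightarrow> real" where
  "odd_part \<kappa> b \<xi> y = \<xi> * y * bessel_series (\<kappa> + 1) ((\<xi> * y) ^ 2) * (\<bar>y\<bar> powr (2 * \<kappa> - 1) * exp (- b * y ^ 2))"

lemma odd_part_bound: "\<kappa> \<ge> 1/2 \<Longrightarrow> \<bar>odd_part \<kappa> b \<xi> y\<bar> \<le> even_part \<kappa> b \<xi> y"
  unfolding odd_part_def even_part_def abs_mult[of "\<xi> * y * _"]
  using bessel_series_odd_bound[of \<kappa> "\<xi> * y"] by (intro mult_mono) auto

lemma part_minus: "even_part \<kappa> b \<xi> (- y) = even_part \<kappa> b \<xi> y" "odd_part \<kappa> b \<xi> (- y) = - odd_part \<kappa> b \<xi> y"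
  by (simp_all add: even_part_def odd_part_def)

lemma part_measurable [measurable]:
  assumes "\<kappa> > 0"
  shows "even_part \<kappa> b \<xi> \<in> borel_measurable borel" "odd_part \<kappa> b \<xi> \<in> borel_measurable borel"
proof -
  have [measurable]: "bessel_series \<kappa> \<in> borel_measurable borel" "bessel_series (\<kappa> + 1) \<in> borel_measurable borel"
    using assms by auto
  show "even_part \<kappa> b \<xi> \<in> borel_measurable borel" "odd_part \<kappa> b \<xi> \<in> borel_measurable borel"
    unfolding even_part_def[abs_def] odd_part_def[abs_def] by measurable
qed

lemma dunkl_density_parts:
  assumes k: "k \<ge> 0" "\<kappa> = k + 1/2" and h: "h > 0"
  shows "dunkl_density k h x y = exp (- (x ^ 2) / (4 * h)) * (4 * h) powr (- \<kappa>) *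
    (even_part \<kappa> (1 / (4 * h)) (x / (4 * h)) y + odd_part \<kappa> (1 / (4 * h)) (x / (4 * h)) y)"
proof -
  have kap: "2 * k = 2 * \<kappa> - 1" "\<kappa> > 0" using k by auto
  have G: "Gamma \<kappa> > 0" using kap by (intro Gamma_real_pos) auto
  have arg: "x / sqrt (2 * h) * (y / sqrt (2 * h)) / 2 = x / (4 * h) * y"
    using h by (simp add: field_simps)
  have ex: "exp (- (x\<^sup>2 + y\<^sup>2) / (4 * h)) = exp (- (x ^ 2) / (4 * h)) * exp (- (1 / (4 * h)) * y ^ 2)"
    by (simp add: diff_divide_distrib flip: exp_add)
  have "(2 * h) powr \<kappa> * 2 powr \<kappa> = (4 * h) powr \<kappa>"
    using powr_mult[of "2 * h" 2 \<kappa>] h by simp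
  then have Q: "1 / ((2 * h) powr (k + 1/2) * dunkl_c k) * Gamma \<kappa> = (4 * h) powr (- \<kappa>)"
    unfolding dunkl_c_eq[OF k] k(2)[symmetric] using G h by (simp add: powr_minus field_simps)
  have c: "1 / ((2 * h) powr (k + 1/2) * dunkl_c k) * e * (Gamma \<kappa> * S) * p = (4 * h) powr (- \<kappa>) * e * S * p" for e S p
    unfolding Q[symmetric] by (simp only: mult_ac)
  show ?thesis
    unfolding dunkl_density_def dunkl_heat_kernel_def dunkl_E_bessel_series[OF k] arg kap(1) ex c
    unfolding even_part_def odd_part_def by (simp add: algebra_simps)
qed

lemma has_bochner_integral_odd:
  fixes f :: "real \<Rightarrow> real"
  assumes "integrable lborel f" "\<And>x. f (- x) = - f x"
  shows "has_bochner_integral lborel f 0"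
proof -
  have "integral\<^sup>L lborel f = - integral\<^sup>L lborel f"
    using lborel_integral_real_affine[of "-1" f 0] assms by simp
  then show ?thesis using assms(1) by (simp add: has_bochner_integral_iff)
qed

lemma integrable_even_part:
  assumes "\<kappa> > 0" "b > 0"
  shows "has_bochner_integral lborel (even_part \<kappa> b \<xi>) (b powr (- \<kappa>) * exp (\<xi> ^ 2 / b))"
  using has_bochner_integral_bessel_gaussian[OF assms] by (simp add: even_part_def[abs_def])

lemma integrable_odd_part:
  assumes "\<kappa> \<ge> 1/2" "b > 0"
  shows "integrable lborel (odd_part \<kappa> b \<xi>)"
proof (rule Bochner_Integration.integrable_bound)
  show "integrable lborel (even_part \<kappa> b \<xi>)"
    using integrable_even_part[of \<kappa> b \<xi>] assms by (simp add: has_bochner_integral_iff)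
  show "AE y in lborel. norm (odd_part \<kappa> b \<xi> y) \<le> norm (even_part \<kappa> b \<xi> y)"
  proof (rule AE_I2)
    fix y
    have "\<bar>odd_part \<kappa> b \<xi> y\<bar> \<le> even_part \<kappa> b \<xi> y" by (rule odd_part_bound[OF assms(1)])
    also have "\<dots> \<le> \<bar>even_part \<kappa> b \<xi> y\<bar>" by simp
    finally show "norm (odd_part \<kappa> b \<xi> y) \<le> norm (even_part \<kappa> b \<xi> y)" by simp
  qed
qed (use assms in \<open>simp add: part_measurable\<close>)

text \<open>The semigroup reads its density through \<open>ennreal\<close>, which would cut negative
  values to 0.\<close>

lemma dunkl_density_nonneg:
  assumes "k \<ge> 0" "h > 0"
  shows "dunkl_density k h x y \<ge> 0"
proof -
  have "even_part (k + 1/2) (1 / (4 * h)) (x / (4 * h)) y + odd_part (k + 1/2) (1 / (4 * h)) (x / (4 * h)) y \<ge> 0"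
    using odd_part_bound[of "k + 1/2" "1 / (4 * h)" "x / (4 * h)" y] assms by simp
  then show ?thesis
    unfolding dunkl_density_parts[OF assms(1) refl assms(2)] by (intro mult_nonneg_nonneg) auto
qed

text \<open>The odd part integrates to 0, and the exponential produced by the even part cancels
  \<open>exp (- x^2 / (4 h))\<close>.\<close>

lemma has_bochner_integral_dunkl_density:
  assumes k: "k \<ge> 0" and h: "h > 0"
  shows "has_bochner_integral lborel (dunkl_density k h x) 1"
proof -
  define \<kappa> where "\<kappa> = k + 1/2"
  have kap: "\<kappa> \<ge> 1/2" "\<kappa> > 0" using k by (auto simp: \<kappa>_def)
  let ?b = "1 / (4 * h)" and ?x = "x / (4 * h)"
  have o: "has_bochner_integral lborel (odd_part \<kappa> ?b ?x) 0"
    using integrable_odd_part[OF kap(1), of ?b ?x] h by (intro has_bochner_integral_odd) (auto simp: part_minus)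
  have "has_bochner_integral lborel (\<lambda>y. exp (- (x ^ 2) / (4 * h)) * (4 * h) powr (- \<kappa>) *
      (even_part \<kappa> ?b ?x y + odd_part \<kappa> ?b ?x y))
      (exp (- (x ^ 2) / (4 * h)) * (4 * h) powr (- \<kappa>) * (?b powr (- \<kappa>) * exp (?x ^ 2 / ?b) + 0))"
    using h kap by (intro has_bochner_integral_mult_right has_bochner_integral_add o integrable_even_part) auto
  also have "exp (- (x ^ 2) / (4 * h)) * (4 * h) powr (- \<kappa>) * (?b powr (- \<kappa>) * exp (?x ^ 2 / ?b) + 0) = 1"
  proof -
    have "(4 * h) powr (- \<kappa>) * ?b powr (- \<kappa>) = 1"
      using h by (simp flip: powr_mult)
    moreover have "?x ^ 2 / ?b = x ^ 2 / (4 * h)" using h by (simp add: field_simps power2_eq_square)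
    then have "exp (- (x ^ 2) / (4 * h)) * exp (?x ^ 2 / ?b) = 1" by (simp flip: exp_add)
    ultimately show ?thesis by (simp add: algebra_simps)
  qed
  finally show ?thesis
    by (simp only: dunkl_density_parts[OF k \<kappa>_def h, abs_def])
qed

lemma integral_dunkl_semigroup:
  assumes k: "k \<ge> 0" and h: "h > 0" and f[measurable]: "f \<in> borel_measurable borel"
  shows "integral\<^sup>L (dunkl_semigroup k h x) f = (\<integral>y. dunkl_density k h x y * f y \<partial>lborel)"
proof -
  have "integrable lborel (dunkl_density k h x)"
    using has_bochner_integral_dunkl_density[OF k h, of x] by (simp add: has_bochner_integral_iff)
  then have m: "dunkl_density k h x \<in> borel_measurable lborel"
    by (rule borel_measurable_integrable)
  have "dunkl_semigroup k h x = density lborel (\<lambda>y. ennreal (dunkl_density k h x y))"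
    using h by (simp add: dunkl_semigroup_def dunkl_density_def)
  then show ?thesis
    using integral_density[of f lborel "dunkl_density k h x"] m dunkl_density_nonneg[OF k h, of x] by simp
qed

lemma dunkl_density_measurable:
  assumes k: "k \<ge> 0" and h: "h > 0"
  shows "(\<lambda>(x, y). dunkl_density k h x y) \<in> borel_measurable (borel \<Otimes>\<^sub>M borel)"
proof -
  have [measurable]: "bessel_series (k + 1/2) \<in> borel_measurable borel" "bessel_series (k + 1/2 + 1) \<in> borel_measurable borel"
    using k by auto
  show ?thesis
    unfolding dunkl_density_parts[OF k refl h] even_part_def odd_part_def by measurable
qed

text \<open>The product with the Gaussian has the same shape as the density, with the rates added to
  \<open>b = (\<rho> + h) / (4 h \<rho>)\<close>. By parity the even part alone contributes for
  \<open>e = 0\<close>, and \<open>y\<close> times the odd part alone for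
  \<open>e = 1\<close>.\<close>

lemma has_bochner_integral_heat_solution:
  assumes k: "k \<ge> 0" and \<kappa>: "\<kappa> = k + 1/2" and h: "h > 0" and \<rho>: "\<rho> > 0" and e: "e = 0 \<or> e = 1"
  shows "has_bochner_integral lborel (\<lambda>y. dunkl_density k h x y * heat_solution \<kappa> e \<rho> y)
    (heat_solution \<kappa> e (\<rho> + h) x)"
proof -
  define b where "b = 1 / (4 * h) + 1 / (4 * \<rho>)"
  define \<xi> where "\<xi> = x / (4 * h)"
  define D where "D = exp (- (x ^ 2) / (4 * h)) * (4 * h) powr (- \<kappa>) * \<rho> powr (- (\<kappa> + real e))"
  have kap: "\<kappa> \<ge> 1/2" "\<kappa> > 0" using k \<kappa> by auto
  have b: "b > 0" using h \<rho> by (simp add: b_def add_pos_pos)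
  have beq: "b = (\<rho> + h) / (4 * h * \<rho>)" using h \<rho> by (simp add: b_def field_simps)
  have ex: "exp (- (1 / (4 * h)) * y ^ 2) * exp (- (y ^ 2) / (4 * \<rho>)) = exp (- b * y ^ 2)" for y
    by (simp add: b_def algebra_simps flip: exp_add)
  have parts: "even_part \<kappa> (1 / (4 * h)) \<xi> y * exp (- (y ^ 2) / (4 * \<rho>)) = even_part \<kappa> b \<xi> y"
    "odd_part \<kappa> (1 / (4 * h)) \<xi> y * exp (- (y ^ 2) / (4 * \<rho>)) = odd_part \<kappa> b \<xi> y" for y
    unfolding even_part_def odd_part_def ex[symmetric] by (simp_all only: mult_ac)
  have dens: "dunkl_density k h x y * heat_solution \<kappa> e \<rho> y =
      D * (y ^ e * even_part \<kappa> b \<xi> y + y ^ e * odd_part \<kappa> b \<xi> y)" for y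
    unfolding dunkl_density_parts[OF k \<kappa> h] heat_solution_def D_def \<xi>_def[symmetric] parts[symmetric]
    by (simp add: algebra_simps)
  have A: "exp (- (x ^ 2) / (4 * h)) * exp (\<xi> ^ 2 / b) = exp (- (x ^ 2) / (4 * (\<rho> + h)))"
  proof -
    have "- (x ^ 2) / (4 * h) + \<xi> ^ 2 / b = - (x ^ 2) / (4 * (\<rho> + h))"
      using h \<rho> unfolding beq \<xi>_def by (simp add: divide_simps) (simp add: algebra_simps power2_eq_square)
    then show ?thesis by (simp flip: exp_add)
  qed
  have P: "(4 * h) powr (- p) * \<rho> powr (- p) * b powr (- p) = (\<rho> + h) powr (- p)" for p
  proof -
    have "(4 * h) * \<rho> * b = \<rho> + h" using h \<rho> by (simp add: beq)
    then show ?thesis using h \<rho> b by (simp flip: powr_mult)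
  qed
  show ?thesis
  proof (cases "e = 0")
    case True
    have "has_bochner_integral lborel (odd_part \<kappa> b \<xi>) 0"
      using integrable_odd_part[OF kap(1) b] by (intro has_bochner_integral_odd) (auto simp: part_minus)
    then have "has_bochner_integral lborel (\<lambda>y. D * (even_part \<kappa> b \<xi> y + odd_part \<kappa> b \<xi> y))
        (D * (b powr (- \<kappa>) * exp (\<xi> ^ 2 / b) + 0))"
      using kap b by (intro has_bochner_integral_mult_right has_bochner_integral_add integrable_even_part) auto
    also have "D * (b powr (- \<kappa>) * exp (\<xi> ^ 2 / b) + 0) = heat_solution \<kappa> e (\<rho> + h) x"
      unfolding D_def heat_solution_def True A[symmetric] P[symmetric] by (simp add: mult_ac)
    finally show ?thesis unfolding dens using True by simp
  next
    case False
    then have e: "e = 1" using e by simp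
    \<comment> \<open>Half of the Gaussian rate is spent on absorbing the factor
      \<open>y\<close>.\<close>
    have int: "integrable lborel (\<lambda>y. y * even_part \<kappa> b \<xi> y)"
    proof (rule Bochner_Integration.integrable_bound)
      show "integrable lborel (\<lambda>y. (1 + 2 / b) * even_part \<kappa> (b / 2) \<xi> y)"
        using integrable_even_part[of \<kappa> "b / 2" \<xi>] kap b by (simp add: has_bochner_integral_iff)
      have [measurable]: "even_part \<kappa> b \<xi> \<in> borel_measurable borel" using kap(2) by (rule part_measurable)
      show "(\<lambda>y. y * even_part \<kappa> b \<xi> y) \<in> borel_measurable lborel" by measurable
      show "AE y in lborel. norm (y * even_part \<kappa> b \<xi> y) \<le> norm ((1 + 2 / b) * even_part \<kappa> (b / 2) \<xi> y)"
      proof (rule AE_I2)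
        fix y
        have pos: "even_part \<kappa> b' \<xi> y \<ge> 0" for b'
          using odd_part_bound[OF kap(1), of b' \<xi> y] by simp
        have 1: "\<bar>y\<bar> \<le> (1 + 2 / b) * exp (b / 2 * y ^ 2)"
        proof -
          have "\<bar>y\<bar> \<le> 1 + y ^ 2"
            using zero_le_power2[of "\<bar>y\<bar> - 1"] by (simp add: power2_eq_square algebra_simps)
          also have "y ^ 2 = 2 / b * (b / 2 * y ^ 2)" using b by simp
          also have "1 + 2 / b * (b / 2 * y ^ 2) \<le> exp (b / 2 * y ^ 2) + 2 / b * exp (b / 2 * y ^ 2)"
          proof (intro add_mono mult_left_mono)
            have "1 + b / 2 * y ^ 2 \<le> exp (b / 2 * y ^ 2)" "0 \<le> b / 2 * y ^ 2"
              using b by (simp_all only: exp_ge_add_one_self) simp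
            then show "1 \<le> exp (b / 2 * y ^ 2)" "b / 2 * y ^ 2 \<le> exp (b / 2 * y ^ 2)"
              by linarith+
          qed (use b in simp)
          finally show ?thesis by (simp add: algebra_simps)
        qed
        have 2: "even_part \<kappa> (b / 2) \<xi> y = exp (b / 2 * y ^ 2) * even_part \<kappa> b \<xi> y"
        proof -
          have "exp (- (b / 2) * y ^ 2) = exp (b / 2 * y ^ 2) * exp (- b * y ^ 2)"
            by (simp add: algebra_simps flip: exp_add)
          then show ?thesis unfolding even_part_def by (simp only: mult_ac)
        qed
        have "\<bar>y\<bar> * even_part \<kappa> b \<xi> y \<le> (1 + 2 / b) * exp (b / 2 * y ^ 2) * even_part \<kappa> b \<xi> y"
          using 1 pos by (rule mult_right_mono)
        then show "norm (y * even_part \<kappa> b \<xi> y) \<le> norm ((1 + 2 / b) * even_part \<kappa> (b / 2) \<xi> y)"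
          unfolding 2 using pos b by (simp add: abs_mult mult_ac)
      qed
    qed
    have 1: "has_bochner_integral lborel (\<lambda>y. y * even_part \<kappa> b \<xi> y) 0"
      using int by (rule has_bochner_integral_odd) (simp add: part_minus)
    \<comment> \<open>The two factors \<open>y\<close> go into the weight and raise
      \<open>\<kappa>\<close> to \<open>\<kappa> + 1\<close>, so the integral of the even case
      applies again.\<close>
    have "y * odd_part \<kappa> b \<xi> y = \<xi> * even_part (\<kappa> + 1) b \<xi> y" for y
    proof (cases "y = 0")
      case False
      have "2 * (\<kappa> + 1) - 1 = 2 + (2 * \<kappa> - 1)" by simp
      then have "\<bar>y\<bar> powr (2 * (\<kappa> + 1) - 1) = \<bar>y\<bar> powr 2 * \<bar>y\<bar> powr (2 * \<kappa> - 1)"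
        by (simp only: powr_add)
      also have "\<bar>y\<bar> powr 2 = y * y" using False by (simp add: power2_eq_square)
      finally show ?thesis unfolding even_part_def odd_part_def by (simp only: mult_ac)
    qed (simp add: even_part_def)
    then have 2: "has_bochner_integral lborel (\<lambda>y. y * odd_part \<kappa> b \<xi> y) (\<xi> * (b powr (- (\<kappa> + 1)) * exp (\<xi> ^ 2 / b)))"
      using kap b by (simp only:) (intro has_bochner_integral_mult_right integrable_even_part, auto)
    have "has_bochner_integral lborel (\<lambda>y. D * (y * even_part \<kappa> b \<xi> y + y * odd_part \<kappa> b \<xi> y))
        (D * (0 + \<xi> * (b powr (- (\<kappa> + 1)) * exp (\<xi> ^ 2 / b))))"
      by (intro has_bochner_integral_mult_right has_bochner_integral_add 1 2)
    also have "D * (0 + \<xi> * (b powr (- (\<kappa> + 1)) * exp (\<xi> ^ 2 / b))) = heat_solution \<kappa> e (\<rho> + h) x"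
    proof -
      have "(4 * h) powr (- \<kappa>) = (4 * h) * (4 * h) powr (- (\<kappa> + 1))"
        using h powr_add[of "4 * h" 1 "- (\<kappa> + 1)"] by simp
      then have "(4 * h) powr (- \<kappa>) * \<xi> = x * (4 * h) powr (- (\<kappa> + 1))"
        using h by (simp add: \<xi>_def)
      then have "D * (0 + \<xi> * (b powr (- (\<kappa> + 1)) * exp (\<xi> ^ 2 / b))) =
          x * ((4 * h) powr (- (\<kappa> + 1)) * \<rho> powr (- (\<kappa> + 1)) * b powr (- (\<kappa> + 1)))
            * (exp (- (x ^ 2) / (4 * h)) * exp (\<xi> ^ 2 / b))"
        unfolding D_def e by (simp add: algebra_simps)
      then show ?thesis unfolding A P by (simp add: heat_solution_def e)
    qed
    finally show ?thesis unfolding dens using e by simp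
  qed
qed

section \<open>Uniqueness of finite measures on the line\<close>

text \<open>On \<open>[0, 1]\<close> the characteristic function is approximated by Taylor
  polynomials built from the moments, with error at most \<open>2 |t| ^ n / n!\<close>; Levy
  uniqueness then concludes. That theorem concerns probability measures, whence the scaling by
  \<open>1 / c\<close>.\<close>

lemma moments_determine_unit_interval:
  fixes M N :: "real measure"
  assumes M: "finite_measure M" "sets M = sets borel" "AE x in M. x \<in> {0..1}"
    and N: "finite_measure N" "sets N = sets borel" "AE x in N. x \<in> {0..1}"
    and mom: "\<And>n. (\<integral>x. x ^ n \<partial>M) = (\<integral>x. x ^ n \<partial>N)"
  shows "M = N"
proof -
  have sp: "space M = UNIV" "space N = UNIV"
    using M(2) N(2) by (auto dest: sets_eq_imp_space_eq)
  define c where "c = measure M UNIV"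
  have cN: "c = measure N UNIV"
    using mom[of 0] sp by (simp add: c_def)
  have em: "emeasure M UNIV = ennreal c" "emeasure N UNIV = ennreal c"
    using finite_measure.emeasure_eq_measure[OF M(1)] finite_measure.emeasure_eq_measure[OF N(1)] cN
    by (simp_all add: c_def)
  show ?thesis
  \<comment> \<open>Mass 0 cannot be normalized and is settled by monotonicity.\<close>
  proof (cases "c = 0")
    case True
    show ?thesis
    proof (rule measure_eqI)
      fix A assume "A \<in> sets M"
      have "emeasure M A \<le> emeasure M UNIV" "emeasure N A \<le> emeasure N UNIV"
        using M(2) N(2) by (auto intro: emeasure_mono)
      then show "emeasure M A = emeasure N A" using True em by simp
    qed (simp add: M N)
  next
    case False
    then have c: "c > 0" by (simp add: c_def less_le)
    have key: "real_distribution (density K (\<lambda>_. ennreal (1 / c)))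
        \<and> (\<forall>n t. cmod (char (density K (\<lambda>_. ennreal (1 / c))) t
            - (\<Sum>k\<le>n. (\<i> * t) ^ k / fact k * (1 / c * (\<integral>x. x ^ k \<partial>K)))) \<le> 2 * \<bar>t\<bar> ^ n / fact n)"
      if K: "finite_measure K" "sets K = sets borel" "AE x in K. x \<in> {0..1}" "emeasure K UNIV = ennreal c"
        "space K = UNIV" for K
    proof -
      let ?D = "density K (\<lambda>_. ennreal (1 / c))"
      have D1: "emeasure ?D UNIV = 1"
        using K c by (simp add: emeasure_density_const flip: ennreal_mult)
      interpret D: real_distribution ?D
        using D1 K by (intro real_distribution.intro prob_spaceI real_distribution_axioms.intro)
          (auto simp: space_density)
      have meas: "(\<lambda>x. f x) \<in> borel_measurable K" if "f \<in> borel_measurable borel" for f :: "real \<Rightarrow> real"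
        using that K(2) by (simp cong: measurable_cong_sets)
      have aeD: "AE x in ?D. x \<in> {0..1}"
        using K(3) by (simp add: AE_density)
      have int: "integrable ?D (\<lambda>x. x ^ k)" for k
      proof (rule D.integrable_const_bound[where B=1])
        show "AE x in ?D. norm (x ^ k) \<le> 1"
          using aeD by eventually_elim (simp add: power_le_one)
      qed (use meas[of "\<lambda>x. x ^ k"] in simp)
      have E: "D.expectation (\<lambda>x. x ^ k) = 1 / c * (\<integral>x. x ^ k \<partial>K)" for k
        using c meas[of "\<lambda>x. x ^ k"] by (subst integral_density) auto
      have E1: "D.expectation (\<lambda>x. \<bar>x\<bar> ^ n) \<le> 1" for n
      proof -
        have "D.expectation (\<lambda>x. \<bar>x\<bar> ^ n) \<le> D.expectation (\<lambda>x. 1)"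
        proof (rule integral_mono_AE)
          show "integrable ?D (\<lambda>x. \<bar>x\<bar> ^ n)" using integrable_abs[OF int[of n]] by (simp add: power_abs)
          show "AE x in ?D. \<bar>x\<bar> ^ n \<le> 1"
            using aeD by eventually_elim (simp add: power_le_one)
        qed simp
        then show ?thesis using D.prob_space by simp
      qed
      have "cmod (char ?D t - (\<Sum>k\<le>n. (\<i> * t) ^ k / fact k * (1 / c * (\<integral>x. x ^ k \<partial>K)))) \<le> 2 * \<bar>t\<bar> ^ n / fact n"
        for n t
      proof -
        have "cmod (char ?D t - (\<Sum>k\<le>n. (\<i> * t) ^ k / fact k * D.expectation (\<lambda>x. x ^ k)))
            \<le> 2 * \<bar>t\<bar> ^ n / fact n * D.expectation (\<lambda>x. \<bar>x\<bar> ^ n)"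
          by (rule D.char_approx1[OF int])
        also have "\<dots> \<le> 2 * \<bar>t\<bar> ^ n / fact n * 1"
          by (intro mult_left_mono E1) auto
        finally show ?thesis by (simp only: E mult_1_right)
      qed
      then show ?thesis using D.real_distribution_axioms by blast
    qed
    note kM = key[OF M em(1) sp(1)] and kN = key[OF N em(2) sp(2)]
    have "char (density M (\<lambda>_. ennreal (1 / c))) t = char (density N (\<lambda>_. ennreal (1 / c))) t" for t
    proof -
      let ?cM = "char (density M (\<lambda>_. ennreal (1 / c))) t" and ?cN = "char (density N (\<lambda>_. ennreal (1 / c))) t"
      have "cmod (?cM - ?cN) \<le> 2 * (2 * \<bar>t\<bar> ^ n / fact n)" for n
      proof -
        let ?S = "\<Sum>k\<le>n. (\<i> * t) ^ k / fact k * (1 / c * (\<integral>x. x ^ k \<partial>M))"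
        have "cmod (?cM - ?S) \<le> 2 * \<bar>t\<bar> ^ n / fact n" using kM by blast
        moreover have "cmod (?cN - ?S) \<le> 2 * \<bar>t\<bar> ^ n / fact n" using kN unfolding mom by blast
        ultimately show ?thesis
          using norm_triangle_ineq4[of "?cM - ?S" "?cN - ?S"] by simp
      qed
      moreover have "(\<lambda>n. 2 * (2 * \<bar>t\<bar> ^ n / fact n)) \<longlonglongrightarrow> 0"
      proof -
        have "(\<lambda>n. 4 * (inverse (fact n) * \<bar>t\<bar> ^ n)) \<longlonglongrightarrow> 4 * 0"
          using summable_LIMSEQ_zero[OF summable_exp[of "\<bar>t\<bar>"]] by (intro tendsto_mult tendsto_const)
        then show ?thesis by (simp add: divide_inverse mult_ac)
      qed
      ultimately have "cmod (?cM - ?cN) \<le> 0"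
        by (intro LIMSEQ_le_const) auto
      then show ?thesis by simp
    qed
    then have eq: "density M (\<lambda>_. ennreal (1 / c)) = density N (\<lambda>_. ennreal (1 / c))"
      using kM kN by (intro Levy_uniqueness) auto
    show ?thesis
    proof (rule measure_eqI)
      fix A assume A: "A \<in> sets M"
      then have "emeasure (density M (\<lambda>_. ennreal (1 / c))) A = emeasure (density N (\<lambda>_. ennreal (1 / c))) A"
        by (simp add: eq)
      then have "ennreal c * (ennreal (1 / c) * emeasure M A) = ennreal c * (ennreal (1 / c) * emeasure N A)"
        using A M(2) N(2) by (simp add: emeasure_density_const)
      then show "emeasure M A = emeasure N A"
        using c by (simp flip: mult.assoc ennreal_mult)
    qed (simp add: M N)
  qed
qed

text \<open>The map \<open>u = exp (- x^2)\<close> sends the line into \<open>[0, 1]\<close>, and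
  its powers are the given Gaussians, so the hypothesis equates all moments of the image measures.
  An even function factors through \<open>u\<close> because \<open>x^2 = - ln u\<close>.\<close>

lemma even_integral_eq:
  fixes \<mu> \<nu> :: "real measure"
  assumes \<mu>: "finite_measure \<mu>" "sets \<mu> = sets borel" and \<nu>: "finite_measure \<nu>" "sets \<nu> = sets borel"
    and eq: "\<And>n::nat. (\<integral>x. exp (- real n * x ^ 2) \<partial>\<mu>) = (\<integral>x. exp (- real n * x ^ 2) \<partial>\<nu>)"
    and \<phi>: "\<phi> \<in> borel_measurable borel" "\<And>x. \<phi> (- x) = \<phi> x"
  shows "(\<integral>x. \<phi> x \<partial>\<mu>) = (\<integral>x. \<phi> x \<partial>\<nu> :: real)"
proof -
  define u where "u = (\<lambda>x::real. exp (- (x ^ 2)))"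
  have um: "u \<in> borel_measurable K" if "sets K = sets borel" for K
    unfolding u_def using that by (simp cong: measurable_cong_sets)
  note [measurable] = um[OF \<mu>(2)] um[OF \<nu>(2)] \<phi>(1)
  have un: "u x ^ n = exp (- real n * x ^ 2)" for x n
    by (simp add: u_def flip: exp_of_nat_mult)
  have "distr \<mu> borel u = distr \<nu> borel u"
  proof (rule moments_determine_unit_interval)
    show "finite_measure (distr \<mu> borel u)" "finite_measure (distr \<nu> borel u)"
      using \<mu> \<nu> um by (auto intro: finite_measure.finite_measure_distr)
    show "AE x in distr \<mu> borel u. x \<in> {0..1}" "AE x in distr \<nu> borel u. x \<in> {0..1}"
      using um[OF \<mu>(2)] um[OF \<nu>(2)] by (auto simp: AE_distr_iff u_def)
    show "(\<integral>x. x ^ n \<partial>distr \<mu> borel u) = (\<integral>x. x ^ n \<partial>distr \<nu> borel u)" for n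
      using eq[of n] by (simp add: integral_distr un)
  qed auto
  then have *: "(\<integral>y. \<phi> (sqrt (- ln y)) \<partial>distr \<mu> borel u) = (\<integral>y. \<phi> (sqrt (- ln y)) \<partial>distr \<nu> borel u)"
    by simp
  have "\<phi> (sqrt (- ln (u x))) = \<phi> x" for x
    using \<phi>(2)[of x] by (simp add: u_def abs_if)
  then show ?thesis
    using * by (simp add: integral_distr)
qed

lemma abs_mult_exp_minus_square_le: "\<bar>x\<bar> * exp (- (x ^ 2)) \<le> (1::real)"
proof -
  have "\<bar>x\<bar> \<le> 1 + x ^ 2"
    using zero_le_power2[of "\<bar>x\<bar> - 1"] by (simp add: power2_eq_square algebra_simps)
  also have "\<dots> \<le> exp (x ^ 2)" by (rule exp_ge_add_one_self)
  finally show ?thesis by (simp add: exp_minus field_simps)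
qed

text \<open>Even functions see only the law of \<open>|x|\<close>. The sign is recovered through the
  bounded odd function \<open>v\<close>, which vanishes only at 0, so that the measure off 0 is
  regained by dividing by \<open>|v|\<close>.\<close>

lemma finite_measure_eq_gaussian:
  fixes \<mu> \<nu> :: "real measure"
  assumes \<mu>: "finite_measure \<mu>" "sets \<mu> = sets borel" and \<nu>: "finite_measure \<nu>" "sets \<nu> = sets borel"
    and even: "\<And>n::nat. (\<integral>x. exp (- real n * x ^ 2) \<partial>\<mu>) = (\<integral>x. exp (- real n * x ^ 2) \<partial>\<nu>)"
    and odd: "\<And>n::nat. n > 0 \<Longrightarrow> (\<integral>x. x * exp (- real n * x ^ 2) \<partial>\<mu>) = (\<integral>x. x * exp (- real n * x ^ 2) \<partial>\<nu>)"
  shows "\<mu> = \<nu>"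
proof -
  define v where "v = (\<lambda>x::real. x * exp (- (x ^ 2)))"
  have v1: "\<bar>v x\<bar> \<le> 1" for x
    using abs_mult_exp_minus_square_le[of x] by (simp add: v_def abs_mult)
  have [measurable]: "v \<in> borel_measurable borel" unfolding v_def by measurable
  have meas: "f \<in> borel_measurable K" if "f \<in> borel_measurable borel" "sets K = sets borel"
    for f :: "real \<Rightarrow> real" and K
    using that by (simp cong: measurable_cong_sets)
  have bint: "integrable K f" if K: "finite_measure K" "sets K = sets borel"
    and f: "f \<in> borel_measurable borel" "\<And>x. \<bar>f x\<bar> \<le> B" for K and f :: "real \<Rightarrow> real" and B
  proof (rule finite_measure.integrable_const_bound[OF K(1)])
    show "AE x in K. norm (f x) \<le> B" using f(2) by simp
    show "f \<in> borel_measurable K" by (rule meas[OF f(1) K(2)])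
  qed
  \<comment> \<open>Tilting by \<open>1 + v \<ge> 0\<close> turns the odd integrals into even integrals of finite measures.\<close>
  define tilt where "tilt = (\<lambda>K. density K (\<lambda>x. ennreal (1 + v x)))"
  have v0: "0 \<le> 1 + v x" for x using v1[of x] by linarith
  have tilt_sets: "sets (tilt K) = sets borel" if "sets K = sets borel" for K
    using that by (simp add: tilt_def)
  have tilt_int: "(\<integral>x. f x \<partial>tilt K) = (\<integral>x. (1 + v x) * f x \<partial>K)"
    if "sets K = sets borel" "f \<in> borel_measurable borel" for K and f :: "real \<Rightarrow> real"
    unfolding tilt_def using v0 meas[OF _ that(1), of v] meas[OF that(2,1)]
    by (subst integral_density) auto
  have tilt_fin: "finite_measure (tilt K)" if K: "finite_measure K" "sets K = sets borel" for K
  proof (rule finite_measureI)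
    interpret finite_measure K by (rule K)
    have "emeasure (tilt K) (space (tilt K)) = (\<integral>\<^sup>+x. ennreal (1 + v x) \<partial>K)"
      unfolding tilt_def using meas[OF _ K(2), of v] by (subst emeasure_density) (auto intro!: nn_integral_cong)
    also have "\<dots> \<le> (\<integral>\<^sup>+x. ennreal 2 \<partial>K)"
    proof (intro nn_integral_mono ennreal_leI)
      show "1 + v x \<le> 2" for x using v1[of x] by linarith
    qed
    also have "\<dots> < \<infinity>" using emeasure_finite[of "space K"] by (simp add: ennreal_mult_eq_top_iff less_top[symmetric])
    finally show "emeasure (tilt K) (space (tilt K)) \<noteq> \<infinity>" by simp
  qed
  have e0: "(\<integral>x. \<phi> x \<partial>\<mu>) = (\<integral>x. \<phi> x \<partial>\<nu>)"
    if "\<phi> \<in> borel_measurable borel" "\<And>x. \<phi> (- x) = \<phi> x" for \<phi> :: "real \<Rightarrow> real"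
    by (rule even_integral_eq[OF \<mu> \<nu> even that])
  have tilt_split: "(\<integral>x. (1 + v x) * f x \<partial>K) = (\<integral>x. f x \<partial>K) + (\<integral>x. v x * f x \<partial>K)"
    if K: "finite_measure K" "sets K = sets borel"
    and f: "f \<in> borel_measurable borel" "\<And>x. \<bar>f x\<bar> \<le> B" for K f B
  proof -
    have "integrable K f" by (rule bint[OF K f])
    moreover have "integrable K (\<lambda>x. v x * f x)"
    proof (rule bint[OF K])
      show "\<bar>v x * f x\<bar> \<le> 1 * B" for x
        unfolding abs_mult using v1 f by (intro mult_mono) auto
      show "(\<lambda>x. v x * f x) \<in> borel_measurable borel" using f by measurable
    qed
    ultimately show ?thesis by (simp add: distrib_right)
  qed
  have e1: "(\<integral>x. v x * \<phi> x \<partial>\<mu>) = (\<integral>x. v x * \<phi> x \<partial>\<nu>)"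
    if \<phi>: "\<phi> \<in> borel_measurable borel" "\<And>x. \<phi> (- x) = \<phi> x" "\<And>x. \<bar>\<phi> x\<bar> \<le> B" for \<phi> :: "real \<Rightarrow> real" and B
  proof -
    have "(\<integral>x. \<phi> x \<partial>tilt \<mu>) = (\<integral>x. \<phi> x \<partial>tilt \<nu>)"
    proof (rule even_integral_eq[OF tilt_fin[OF \<mu>] tilt_sets[OF \<mu>(2)] tilt_fin[OF \<nu>] tilt_sets[OF \<nu>(2)] _ \<phi>(1,2)])
      fix n :: nat
      have b: "\<bar>exp (- real n * x ^ 2)\<bar> \<le> 1" for x by simp
      have m: "(\<lambda>x. exp (- real n * x ^ 2)) \<in> borel_measurable borel" by measurable
      \<comment> \<open>The Gaussian inside \<open>v\<close> raises \<open>n\<close> to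
        \<open>Suc n\<close>, so the odd hypothesis is called for positive indices.\<close>
      have "v x * exp (- real n * x ^ 2) = x * exp (- real (Suc n) * x ^ 2)" for x
        by (simp add: v_def algebra_simps flip: exp_add)
      then show "(\<integral>x. exp (- real n * x ^ 2) \<partial>tilt \<mu>) = (\<integral>x. exp (- real n * x ^ 2) \<partial>tilt \<nu>)"
        using even[of n] odd[of "Suc n"]
        unfolding tilt_int[OF \<mu>(2) m] tilt_int[OF \<nu>(2) m] tilt_split[OF \<mu> m b] tilt_split[OF \<nu> m b]
        by (simp only:)
    qed
    then show ?thesis
      using e0[OF \<phi>(1,2)]
      unfolding tilt_int[OF \<mu>(2) \<phi>(1)] tilt_int[OF \<nu>(2) \<phi>(1)] tilt_split[OF \<mu> \<phi>(1,3)] tilt_split[OF \<nu> \<phi>(1,3)]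
      by simp
  qed
  \<comment> \<open>The odd part of an indicator is \<open>v\<close> times an even function, which
    in general blows up at 0 and at infinity. Weighting with \<open>|v|\<close> keeps it bounded:
    the integrand is \<open>\<phi>1 + v * \<phi>2\<close> with both functions even and bounded by
    1.\<close>
  have key: "(\<integral>x. \<bar>v x\<bar> * indicator B x \<partial>\<mu>) = (\<integral>x. \<bar>v x\<bar> * indicator B x \<partial>\<nu>)"
    if [measurable]: "B \<in> sets borel" for B
  proof -
    define \<phi>1 where "\<phi>1 = (\<lambda>x. \<bar>v x\<bar> * ((indicator B x + indicator B (- x)) / 2))"
    define \<phi>2 where "\<phi>2 = (\<lambda>x. sgn x * ((indicator B x - indicator B (- x)) / 2) :: real)"
    have m: "\<phi>1 \<in> borel_measurable borel" "\<phi>2 \<in> borel_measurable borel"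
      unfolding \<phi>1_def \<phi>2_def by measurable
    have ev: "\<phi>1 (- x) = \<phi>1 x" "\<phi>2 (- x) = \<phi>2 x" for x
      by (simp_all add: \<phi>1_def \<phi>2_def v_def sgn_if)
    have b1: "\<bar>\<phi>1 x\<bar> \<le> 1" for x
    proof -
      have "\<bar>\<phi>1 x\<bar> \<le> 1 * 1" unfolding \<phi>1_def abs_mult using v1[of x]
        by (intro mult_mono) (auto simp: indicator_def)
      then show ?thesis by simp
    qed
    have b2: "\<bar>\<phi>2 x\<bar> \<le> 1" for x
      by (auto simp: \<phi>2_def sgn_if indicator_def)
    have "v x * sgn x = \<bar>v x\<bar>" for x by (simp add: v_def sgn_if abs_mult)
    then have split: "\<bar>v x\<bar> * indicator B x = \<phi>1 x + v x * \<phi>2 x" for x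
      unfolding \<phi>1_def \<phi>2_def mult.assoc[symmetric] by (simp add: field_simps)
    have int: "(\<integral>x. \<phi>1 x + v x * \<phi>2 x \<partial>K) = (\<integral>x. \<phi>1 x \<partial>K) + (\<integral>x. v x * \<phi>2 x \<partial>K)"
      if K: "finite_measure K" "sets K = sets borel" for K
    proof (rule Bochner_Integration.integral_add)
      show "integrable K \<phi>1" by (rule bint[OF K m(1) b1])
      show "integrable K (\<lambda>x. v x * \<phi>2 x)"
      proof (rule bint[OF K])
        show "\<bar>v x * \<phi>2 x\<bar> \<le> 1 * 1" for x
          unfolding abs_mult using v1 b2 by (intro mult_mono) auto
        show "(\<lambda>x. v x * \<phi>2 x) \<in> borel_measurable borel" using m by measurable
      qed
    qed
    show ?thesis
      unfolding split int[OF \<mu>] int[OF \<nu>] using e0[OF m(1) ev(1)] e1[OF m(2) ev(2) b2] by simp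
  qed
  have dens: "density \<mu> (\<lambda>x. ennreal \<bar>v x\<bar>) = density \<nu> (\<lambda>x. ennreal \<bar>v x\<bar>)"
  proof (rule measure_eqI)
    fix B assume "B \<in> sets (density \<mu> (\<lambda>x. ennreal \<bar>v x\<bar>))"
    then have B[measurable]: "B \<in> sets borel" using \<mu> by simp
    have em: "emeasure (density K (\<lambda>x. ennreal \<bar>v x\<bar>)) B = ennreal (\<integral>x. \<bar>v x\<bar> * indicator B x \<partial>K)"
      if K: "finite_measure K" "sets K = sets borel" for K
    proof -
      have "integrable K (\<lambda>x. \<bar>v x\<bar> * indicator B x)"
        by (rule bint[OF K, of _ 1]) (use v1 in \<open>auto simp: indicator_def\<close>)
      then have "(\<integral>\<^sup>+x. ennreal (\<bar>v x\<bar> * indicator B x) \<partial>K) = ennreal (\<integral>x. \<bar>v x\<bar> * indicator B x \<partial>K)"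
        by (intro nn_integral_eq_integral) auto
      moreover have "(\<lambda>x. ennreal \<bar>v x\<bar>) \<in> borel_measurable K" using K(2) meas[of v K] by simp
      ultimately show ?thesis
        using K(2) B by (simp add: emeasure_density ennreal_mult' ennreal_indicator)
    qed
    show "emeasure (density \<mu> (\<lambda>x. ennreal \<bar>v x\<bar>)) B = emeasure (density \<nu> (\<lambda>x. ennreal \<bar>v x\<bar>)) B"
      unfolding em[OF \<mu>] em[OF \<nu>] key[OF B] ..
  qed (simp add: \<mu> \<nu>)
  show ?thesis
  proof (rule measure_eqI)
    fix B assume "B \<in> sets \<mu>"
    then have B[measurable]: "B \<in> sets borel" using \<mu> by simp
    have nz: "emeasure K (B - {0}) = (\<integral>\<^sup>+x. ennreal (1 / \<bar>v x\<bar>) * indicator (B - {0}) x \<partial>density K (\<lambda>x. ennreal \<bar>v x\<bar>))"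
      if K: "sets K = sets borel" for K
    proof -
      have [measurable]: "v \<in> borel_measurable K" "B - {0} \<in> sets K" using K meas[of v K] B by auto
      have "(\<integral>\<^sup>+x. ennreal (1 / \<bar>v x\<bar>) * indicator (B - {0}) x \<partial>density K (\<lambda>x. ennreal \<bar>v x\<bar>)) =
          (\<integral>\<^sup>+x. ennreal \<bar>v x\<bar> * (ennreal (1 / \<bar>v x\<bar>) * indicator (B - {0}) x) \<partial>K)"
        by (rule nn_integral_density) measurable
      also have "\<dots> = (\<integral>\<^sup>+x. indicator (B - {0}) x \<partial>K)"
        by (intro nn_integral_cong) (auto simp: v_def indicator_def simp flip: ennreal_mult)
      also have "\<dots> = emeasure K (B - {0})" by (rule nn_integral_indicator) measurable
      finally show ?thesis ..
    qed
    \<comment> \<open>The atom at 0 is lost under the weight \<open>|v|\<close>, but its indicator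
      is even.\<close>
    have "measure \<mu> {0} = measure \<nu> {0}"
    proof -
      have "(\<integral>x. indicator {0} x \<partial>\<mu>) = (\<integral>x. indicator {0} x \<partial>\<nu> :: real)"
        by (rule e0) (auto simp: indicator_def)
      then show ?thesis using \<mu>(2) \<nu>(2) by (simp add: sets_eq_imp_space_eq)
    qed
    then have z: "emeasure \<mu> (B \<inter> {0}) = emeasure \<nu> (B \<inter> {0})"
      using finite_measure.emeasure_eq_measure[OF \<mu>(1)] finite_measure.emeasure_eq_measure[OF \<nu>(1)]
      by (cases "0 \<in> B") auto
    have sum: "emeasure K B = emeasure K (B - {0}) + emeasure K (B \<inter> {0})" if "sets K = sets borel" for K
      using that B by (subst plus_emeasure) (auto intro!: arg_cong[where f="emeasure K"])
    show "emeasure \<mu> B = emeasure \<nu> B"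
      unfolding sum[OF \<mu>(2)] sum[OF \<nu>(2)] z nz[OF \<mu>(2)] nz[OF \<nu>(2)] dens ..
  qed (simp add: \<mu> \<nu>)
qed

section \<open>Identification of the transition kernels\<close>

lemma exp_minus_mult_conv_heat_solution:
  assumes "a > 0"
  shows "y ^ e * exp (- a * y ^ 2) = (1 / (4 * a)) powr (\<kappa> + real e) * heat_solution \<kappa> e (1 / (4 * a)) y"
proof -
  have "(1 / (4 * a)) powr (\<kappa> + real e) * (1 / (4 * a)) powr (- (\<kappa> + real e)) = 1"
    using assms by (simp flip: powr_add)
  moreover have "- (y ^ 2) / (4 * (1 / (4 * a))) = - a * y ^ 2"
    by simp
  moreover have "c * (u * (d * v)) = (c * d) * (u * v)" for c d u v :: real
    by simp
  ultimately show ?thesis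
    unfolding heat_solution_def by (simp only: mult_1)
qed

lemma dunkl_semigroup_density:
  "h > 0 \<Longrightarrow> dunkl_semigroup k h x = density lborel (\<lambda>y. ennreal (dunkl_density k h x y))"
  by (simp add: dunkl_semigroup_def dunkl_density_def)

lemma prob_space_dunkl_semigroup:
  assumes k: "k \<ge> 0" and h: "h > 0"
  shows "prob_space (dunkl_semigroup k h x)"
proof (rule prob_spaceI)
  have "(\<integral>\<^sup>+y. ennreal (dunkl_density k h x y) \<partial>lborel) = ennreal 1"
    using has_bochner_integral_dunkl_density[OF k h, of x] dunkl_density_nonneg[OF k h]
    by (simp add: nn_integral_eq_integral has_bochner_integral_iff)
  moreover have "dunkl_density k h x \<in> borel_measurable lborel"
    using has_bochner_integral_dunkl_density[OF k h, of x] has_bochner_integral_iff borel_measurable_integrable by blast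
  ultimately show "emeasure (dunkl_semigroup k h x) (space (dunkl_semigroup k h x)) = 1"
    using h by (simp add: dunkl_semigroup_density emeasure_density)
qed

lemma dunkl_semigroup_kernel:
  assumes k: "k \<ge> 0" and h: "h > 0"
  shows "dunkl_semigroup k h \<in> borel \<rightarrow>\<^sub>M subprob_algebra borel"
proof (rule measurable_subprob_algebra)
  fix x
  show "subprob_space (dunkl_semigroup k h x)"
    using prob_space_dunkl_semigroup[OF assms] by (rule prob_space_imp_subprob_space)
  show "sets (dunkl_semigroup k h x) = sets borel"
    using h by (simp add: dunkl_semigroup_density)
next
  fix A :: "real set" assume A[measurable]: "A \<in> sets borel"
  have m[measurable]: "(\<lambda>(x, y). dunkl_density k h x y) \<in> borel_measurable (borel \<Otimes>\<^sub>M lborel)"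
    using dunkl_density_measurable[OF k h] by (simp cong: measurable_cong_sets)
  have "(\<lambda>x. \<integral>\<^sup>+y. ennreal (dunkl_density k h x y) * indicator A y \<partial>lborel) \<in> borel_measurable borel"
    by measurable
  moreover have "dunkl_density k h x \<in> borel_measurable lborel" for x
    using has_bochner_integral_dunkl_density[OF k h, of x] has_bochner_integral_iff borel_measurable_integrable by blast
  ultimately show "(\<lambda>x. emeasure (dunkl_semigroup k h x) A) \<in> borel_measurable borel"
    using h by (simp add: dunkl_semigroup_density emeasure_density)
qed

lemma sets_dunkl_semigroup: "sets (dunkl_semigroup k h x) = sets borel"
  by (simp add: dunkl_semigroup_def)

section \<open>The law of \<open>X t\<close> on events of the past, and the Markov property\<close>

context dunkl_martingales
begin

text \<open>Conditioning is encoded by restricting \<open>M\<close> to an event \<open>A\<close> of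
  the past, so that both sides are finite measures on the line and Gaussian test functions decide.
  The martingale property carries the left integral, and the kernel the right one, to the same heat
  solution at time \<open>s\<close>.\<close>

lemma distr_eq_bind_dunkl_semigroup:
  assumes st: "0 \<le> s" "s < t" and A: "A \<in> sets (F s)"
  shows "distr (density M (indicator A)) borel (X t) =
    density M (indicator A) \<bind> (\<lambda>\<omega>. dunkl_semigroup k (t - s) (X s \<omega>))"
    (is "?\<mu> = ?\<nu>")
proof -
  define h where "h = t - s"
  have h: "h > 0" using st by (simp add: h_def)
  define MA where "MA = density M (indicator A :: 'a \<Rightarrow> ennreal)"
  have AM[measurable]: "A \<in> sets M"
    using A subalgebra_filtration[of s] by (auto simp: subalgebra_def)
  have [measurable]: "X s \<in> borel_measurable M" "X t \<in> borel_measurable M"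
    using X_measurable st by auto
  have MA_meas: "X s \<in> borel_measurable MA" "X t \<in> borel_measurable MA" by (simp_all add: MA_def)
  have fin: "finite_measure MA"
    unfolding MA_def using finite_measure_restricted[OF AM] by simp
  have MA_int: "(\<integral>\<omega>. f \<omega> \<partial>MA) = expectation (\<lambda>\<omega>. indicator A \<omega> * f \<omega>)"
    if "f \<in> borel_measurable M" for f :: "'a \<Rightarrow> real"
    using integral_density[of f M "indicator A"] that by (simp add: MA_def ennreal_indicator)
  have N: "(\<lambda>\<omega>. dunkl_semigroup k h (X s \<omega>)) \<in> MA \<rightarrow>\<^sub>M subprob_algebra borel"
    using dunkl_semigroup_kernel[OF k_nonneg h] MA_meas(1) by (rule measurable_compose_rev)
  have spM: "space MA \<noteq> {}" by (simp add: MA_def not_empty)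
  have sets\<nu>: "sets (MA \<bind> (\<lambda>\<omega>. dunkl_semigroup k h (X s \<omega>))) = sets borel"
    by (rule sets_bind[OF _ spM]) (simp add: sets_dunkl_semigroup)
  interpret P: prob_space "dunkl_semigroup k h x" for x
    by (rule prob_space_dunkl_semigroup[OF k_nonneg h])
  have fin\<nu>: "finite_measure (MA \<bind> (\<lambda>\<omega>. dunkl_semigroup k h (X s \<omega>)))"
  proof (rule finite_measureI)
    have "emeasure (MA \<bind> (\<lambda>\<omega>. dunkl_semigroup k h (X s \<omega>))) UNIV
        = (\<integral>\<^sup>+\<omega>. emeasure (dunkl_semigroup k h (X s \<omega>)) UNIV \<partial>MA)"
      by (rule emeasure_bind[OF spM N]) simp
    also have "\<dots> = (\<integral>\<^sup>+\<omega>. 1 \<partial>MA)"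
    proof (rule nn_integral_cong)
      fix \<omega>
      have "space (dunkl_semigroup k h (X s \<omega>)) = UNIV"
        using sets_eq_imp_space_eq[OF sets_dunkl_semigroup] by simp
      then show "emeasure (dunkl_semigroup k h (X s \<omega>)) UNIV = 1"
        using P.emeasure_space_1[of "X s \<omega>"] by simp
    qed
    also have "\<dots> \<noteq> \<infinity>" using finite_measure.emeasure_finite[OF fin] by simp
    finally show "emeasure (MA \<bind> (\<lambda>\<omega>. dunkl_semigroup k h (X s \<omega>)))
        (space (MA \<bind> (\<lambda>\<omega>. dunkl_semigroup k h (X s \<omega>)))) \<noteq> \<infinity>"
      using sets_eq_imp_space_eq[OF sets\<nu>] by simp
  qed
  have bind_int: "(\<integral>y. f y \<partial>(MA \<bind> (\<lambda>\<omega>. dunkl_semigroup k h (X s \<omega>)))) =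
      (\<integral>\<omega>. (\<integral>y. f y \<partial>dunkl_semigroup k h (X s \<omega>)) \<partial>MA)"
    if "f \<in> borel_measurable borel" "\<And>y. \<bar>f y\<bar> \<le> B" for f and B :: real
  proof (rule integral_bind[OF that(1) _ N fin])
    show "AE \<omega> in MA. emeasure (dunkl_semigroup k h (X s \<omega>)) (space (dunkl_semigroup k h (X s \<omega>))) \<le> ennreal 1"
      by (simp add: P.emeasure_space_1)
  qed (use that in auto)
  have heat: "(\<integral>y. y ^ e * exp (- a * y ^ 2) \<partial>distr MA borel (X t)) =
      (\<integral>y. y ^ e * exp (- a * y ^ 2) \<partial>(MA \<bind> (\<lambda>\<omega>. dunkl_semigroup k h (X s \<omega>))))"
    if a: "a > 0" and e: "e = 0 \<or> e = 1" and B: "\<And>y. \<bar>y ^ e * exp (- a * y ^ 2)\<bar> \<le> B" for a e B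
  proof -
    \<comment> \<open>With this parameter the heat solution is a multiple of the given
      Gaussian.\<close>
    define \<rho> where "\<rho> = 1 / (4 * a)"
    define C where "C = \<rho> powr (\<kappa> + real e)"
    have \<rho>: "\<rho> > 0" using a by (simp add: \<rho>_def)
    have conv: "y ^ e * exp (- a * y ^ 2) = C * heat_solution \<kappa> e \<rho> y" for y
      unfolding C_def \<rho>_def by (rule exp_minus_mult_conv_heat_solution[OF a])
    have [measurable]: "heat_solution \<kappa> e r \<in> borel_measurable borel" for r
      unfolding heat_solution_def[abs_def] by measurable
    have AF: "(indicator A :: 'a \<Rightarrow> real) \<in> borel_measurable (F s)" using A by simp
    have "(\<integral>y. C * heat_solution \<kappa> e \<rho> y \<partial>distr MA borel (X t)) =
        C * expectation (\<lambda>\<omega>. indicator A \<omega> * heat_solution \<kappa> e \<rho> (X t \<omega>))"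
      using MA_meas by (simp add: integral_distr MA_int)
    also have "expectation (\<lambda>\<omega>. indicator A \<omega> * heat_solution \<kappa> e \<rho> (X t \<omega>)) =
        expectation (\<lambda>\<omega>. indicator A \<omega> * heat_solution \<kappa> e (\<rho> + h) (X s \<omega>))"
      \<comment> \<open>The terminal time \<open>\<tau> = \<rho> + t\<close> leaves
        \<open>\<rho>\<close> at time \<open>t\<close> and \<open>\<rho> + h\<close> at time
        \<open>s\<close>.\<close>
      using heat_solution_martingale[of s t "\<rho> + t" "indicator A" e] st \<rho> AF e
      by (simp add: h_def add_diff_eq indicator_def)
    also have "C * expectation (\<lambda>\<omega>. indicator A \<omega> * heat_solution \<kappa> e (\<rho> + h) (X s \<omega>)) =
        (\<integral>\<omega>. C * heat_solution \<kappa> e (\<rho> + h) (X s \<omega>) \<partial>MA)"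
      by (simp add: MA_int)
    also have "\<dots> = (\<integral>\<omega>. (\<integral>y. y ^ e * exp (- a * y ^ 2) \<partial>dunkl_semigroup k h (X s \<omega>)) \<partial>MA)"
    proof (rule Bochner_Integration.integral_cong)
      fix \<omega>
      have "(\<integral>y. C * heat_solution \<kappa> e \<rho> y \<partial>dunkl_semigroup k h (X s \<omega>)) =
          C * (\<integral>y. dunkl_density k h (X s \<omega>) y * heat_solution \<kappa> e \<rho> y \<partial>lborel)"
        by (simp add: integral_dunkl_semigroup[OF k_nonneg h])
      also have "\<dots> = C * heat_solution \<kappa> e (\<rho> + h) (X s \<omega>)"
        using has_bochner_integral_heat_solution[OF k_nonneg kappa h \<rho> e] by (simp add: has_bochner_integral_iff)
      finally show "C * heat_solution \<kappa> e (\<rho> + h) (X s \<omega>) =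
          (\<integral>y. y ^ e * exp (- a * y ^ 2) \<partial>dunkl_semigroup k h (X s \<omega>))"
        by (simp only: conv)
    qed simp
    also have "\<dots> = (\<integral>y. y ^ e * exp (- a * y ^ 2) \<partial>(MA \<bind> (\<lambda>\<omega>. dunkl_semigroup k h (X s \<omega>))))"
      by (rule bind_int[symmetric, OF _ B]) measurable
    finally show ?thesis by (simp only: conv)
  qed
  have "distr MA borel (X t) = MA \<bind> (\<lambda>\<omega>. dunkl_semigroup k h (X s \<omega>))"
  proof (rule finite_measure_eq_gaussian[OF _ _ fin\<nu> sets\<nu>])
    show "finite_measure (distr MA borel (X t))"
      using fin MA_meas(2) by (rule finite_measure.finite_measure_distr)
    fix n :: nat
    show "(\<integral>x. exp (- real n * x ^ 2) \<partial>distr MA borel (X t)) =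
        (\<integral>x. exp (- real n * x ^ 2) \<partial>(MA \<bind> (\<lambda>\<omega>. dunkl_semigroup k h (X s \<omega>))))"
    \<comment> \<open>A constant corresponds to no finite \<open>\<rho>\<close>, so here the total
      masses are compared directly.\<close>
    proof (cases "n = 0")
      case True
      have "(\<integral>y. (1::real) \<partial>(MA \<bind> (\<lambda>\<omega>. dunkl_semigroup k h (X s \<omega>)))) = (\<integral>\<omega>. 1 \<partial>MA)"
        by (subst bind_int[of "\<lambda>_. 1" 1]) (auto simp: P.prob_space)
      moreover have "(\<integral>y. (1::real) \<partial>distr MA borel (X t)) = (\<integral>\<omega>. 1 \<partial>MA)"
        using MA_meas by (subst integral_distr) auto
      ultimately show ?thesis using True by simp
    next
      case False
      then show ?thesis using heat[of "real n" 0 1] by simp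
    qed
    assume n: "n > 0"
    have "\<bar>y ^ 1 * exp (- real n * y ^ 2)\<bar> \<le> 1" for y
    proof -
      have "exp (- real n * y ^ 2) \<le> exp (- (y ^ 2))"
        using n mult_right_mono[of 1 "real n" "y ^ 2"] by simp
      then have "\<bar>y\<bar> * exp (- real n * y ^ 2) \<le> \<bar>y\<bar> * exp (- (y ^ 2))" by (intro mult_left_mono) auto
      then show ?thesis using abs_mult_exp_minus_square_le[of y] by (simp add: abs_mult)
    qed
    then show "(\<integral>x. x * exp (- real n * x ^ 2) \<partial>distr MA borel (X t)) =
        (\<integral>x. x * exp (- real n * x ^ 2) \<partial>(MA \<bind> (\<lambda>\<omega>. dunkl_semigroup k h (X s \<omega>))))"
      using heat[of "real n" 1 1] n by simp
  qed simp
  then show ?thesis by (simp add: MA_def h_def)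
qed

text \<open>The equality of the restricted laws, evaluated at \<open>B\<close> for each event
  \<open>A\<close> of the past, is the characterizing property of the conditional expectation. A
  time step of length 0 is separate: there the kernel is a point mass without density.\<close>

lemma conditional_probability:
  assumes st: "0 \<le> s" "s \<le> t" and B[measurable]: "B \<in> sets borel"
  shows "AE \<omega> in M. real_cond_exp M (F s) (\<lambda>\<omega>'. indicator B (X t \<omega>')) \<omega>
    = measure (dunkl_semigroup k (t - s) (X s \<omega>)) B"
proof -
  interpret S: finite_measure_subalgebra M "F s"
    by (rule finite_measure_subalgebra_filtration)
  have [measurable]: "X s \<in> borel_measurable M" "X t \<in> borel_measurable M"
    using X_measurable st by auto
  have XF[measurable]: "X s \<in> borel_measurable (F s)"
    using st by (intro X_measurable_filtration) auto
  have ind_int: "integrable M (\<lambda>\<omega>. indicator B (X t \<omega>) :: real)"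
    by (rule integrable_const_bound[where B=1]) auto
  show ?thesis
  proof (cases "s = t")
    case True
    have "(\<lambda>\<omega>. indicator B (X s \<omega>) :: real) \<in> borel_measurable (F s)" by measurable
    then have "AE \<omega> in M. real_cond_exp M (F s) (\<lambda>\<omega>'. indicator B (X s \<omega>')) \<omega> = indicator B (X s \<omega>)"
      using ind_int True by (intro S.real_cond_exp_F_meas) auto
    then show ?thesis
      using True by (simp add: dunkl_semigroup_def measure_return)
  next
    case False
    then have h: "t - s > 0" and st': "s < t" using st by auto
    define p where "p = (\<lambda>x. measure (dunkl_semigroup k (t - s) x) B)"
    interpret P: prob_space "dunkl_semigroup k (t - s) x" for x
      by (rule prob_space_dunkl_semigroup[OF k_nonneg h])
    have pm[measurable]: "p \<in> borel_measurable borel"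
      unfolding p_def by (rule measure_measurable_subprob_algebra2[OF _ dunkl_semigroup_kernel[OF k_nonneg h]])
        (simp add: pair_measureI)
    have p_int: "integrable M (\<lambda>\<omega>. p (X s \<omega>))"
    proof (rule integrable_const_bound[where B=1])
      show "AE \<omega> in M. norm (p (X s \<omega>)) \<le> 1" by (simp add: p_def)
    qed measurable
    have "AE \<omega> in M. real_cond_exp M (F s) (\<lambda>\<omega>'. indicator B (X t \<omega>')) \<omega> = p (X s \<omega>)"
    proof (rule S.real_cond_exp_charact[OF _ ind_int p_int])
      show "(\<lambda>\<omega>. p (X s \<omega>)) \<in> borel_measurable (F s)" by measurable
      fix A assume A: "A \<in> sets (F s)"
      then have AM[measurable]: "A \<in> sets M"
        using subalgebra_filtration[of s] by (auto simp: subalgebra_def)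
      let ?MA = "density M (indicator A :: 'a \<Rightarrow> ennreal)"
      have N: "(\<lambda>\<omega>. dunkl_semigroup k (t - s) (X s \<omega>)) \<in> ?MA \<rightarrow>\<^sub>M subprob_algebra borel"
        by (rule measurable_compose_rev[OF dunkl_semigroup_kernel[OF k_nonneg h]]) simp
      have "emeasure (distr ?MA borel (X t)) B =
          emeasure (?MA \<bind> (\<lambda>\<omega>. dunkl_semigroup k (t - s) (X s \<omega>))) B"
        by (simp only: distr_eq_bind_dunkl_semigroup[OF st(1) st' A])
      also have "\<dots> = (\<integral>\<^sup>+\<omega>. emeasure (dunkl_semigroup k (t - s) (X s \<omega>)) B \<partial>?MA)"
        by (rule emeasure_bind[OF _ N B]) (simp add: not_empty)
      also have "\<dots> = (\<integral>\<^sup>+\<omega>. ennreal (p (X s \<omega>)) \<partial>?MA)"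
        by (simp add: p_def P.emeasure_eq_measure)
      also have "\<dots> = (\<integral>\<^sup>+\<omega>. ennreal (indicator A \<omega> * p (X s \<omega>)) \<partial>M)"
        by (subst nn_integral_density) (auto intro!: nn_integral_cong simp: ennreal_mult' ennreal_indicator)
      also have "\<dots> = ennreal (\<integral>\<omega>. indicator A \<omega> * p (X s \<omega>) \<partial>M)"
        using integrable_mult_indicator[OF AM p_int]
        by (intro nn_integral_eq_integral) (auto simp: p_def)
      finally have 1: "emeasure (distr ?MA borel (X t)) B = ennreal (\<integral>\<omega>. indicator A \<omega> * p (X s \<omega>) \<partial>M)" .
      have "emeasure (distr ?MA borel (X t)) B = (\<integral>\<^sup>+\<omega>. indicator B (X t \<omega>) \<partial>?MA)"
        by (subst nn_integral_indicator[symmetric], simp, subst nn_integral_distr) auto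
      also have "\<dots> = (\<integral>\<^sup>+\<omega>. ennreal (indicator A \<omega> * indicator B (X t \<omega>)) \<partial>M)"
        by (subst nn_integral_density) (auto intro!: nn_integral_cong simp: ennreal_mult' ennreal_indicator)
      also have "\<dots> = ennreal (\<integral>\<omega>. indicator A \<omega> * indicator B (X t \<omega>) \<partial>M)"
        using integrable_mult_indicator[OF AM ind_int]
        by (intro nn_integral_eq_integral) auto
      finally have "ennreal (\<integral>\<omega>. indicator A \<omega> * indicator B (X t \<omega>) \<partial>M) = ennreal (\<integral>\<omega>. indicator A \<omega> * p (X s \<omega>) \<partial>M)"
        using 1 by simp
      \<comment> \<open>Both integrals are nonnegative, so the equation in \<open>ennreal\<close>
        descends to the reals.\<close>
      moreover have "0 \<le> (\<integral>\<omega>. (indicator A \<omega> * indicator B (X t \<omega>) :: real) \<partial>M)" "0 \<le> (\<integral>\<omega>. indicator A \<omega> * p (X s \<omega>) \<partial>M)"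
        by (auto intro!: integral_nonneg_AE simp: p_def)
      ultimately show "(\<integral>\<omega>\<in>A. indicator B (X t \<omega>) \<partial>M) = (\<integral>\<omega>\<in>A. p (X s \<omega>) \<partial>M)"
        by (simp add: set_lebesgue_integral_def ennreal_inj)
    qed
    then show ?thesis by (simp add: p_def)
  qed
qed

end

theorem theorem4p51:
  fixes k :: real and M :: "'a measure" and X :: "real \<Rightarrow> 'a \<Rightarrow> real"
  assumes "k \<ge> 0"
    and "prob_space M"
    and "\<And>t. t \<ge> 0 \<Longrightarrow> X t \<in> borel_measurable M"
    and "\<And>n. n \<in> {1, 2, 4, 6, 8} \<Longrightarrow>
           martingale M (natural_filtration M X) (\<lambda>t \<omega>. dunkl_appell k n t (X t \<omega>))"
  shows "dunkl_process k M X"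
proof -
  interpret prob_space M by (rule assms)
  interpret dunkl_martingales M k X "k + 1/2"
    using assms by unfold_locales auto
  show ?thesis
    unfolding dunkl_process_def using assms(3) conditional_probability by auto
qed

end
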